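(* Let $p\in(0,1)$. For any $n\ge1$ and any permutation (pattern) $\pi$ of size $n$, $$\mathbb E\big[\mathrm{dens}(\pi,\boldsymbol{\mu}^{\mathrm{rec}}_p)\big]=\mathbb P\big[\sigma^{(n),p}=\pi\big]=\frac{N_{inc}(\pi)}{(n-1)!}\,(1-p)^{\mathrm{des}(\pi)}\,p^{\,n-1-\mathrm{des}(\pi)},$$ where $\mathrm{des}(\pi)$ is the number of descents of $\pi$ and $N_{inc}(\pi)$ is the number of (decorated) increasing binary trees $T$ such that $\mathrm{Perm}(T)=\pi$.
   Context: $\mathrm{Leb}$ is Lebesgue measure on $[0,1]$. A permuton is a Borel probability measure on $[0,1]^2$ with both marginals equal to $\mathrm{Leb}$. Recursive separable permutations: $\sigma^{(1),p}$ is the unique permutation of size $1$. Given $\sigma^{(n),p}$, the permutation $\sigma^{(n+1),p}$ is obtained as follows, with randomness independent of the past: take $j$ uniformly in $\{1,\dots,n\}$; in one-line notation, increase all values bigger than $j$ by $1$; then with probability $p$ replace $j$ by $j,\,j+1$, and with probability $1-p$ replace $j$ by $j+1,\,j$. Recursive separable permuton $\boldsymbol{\mu}^{\mathrm{rec}}_p$: let $(U_j)_{j\ge1}$ be i.i.d. uniform in $[0,1]$ and $(S_j)_{j\ge1}$ be i.i.d. signs in $\{\oplus,\ominus\}$ with $\mathbb P(S_j=\oplus)=p$, the two sequences being independent. For $x<y$ in $[0,1]$ let $j$ be the minimal index $j\ge 1$ such that $U_j\in(x,y]$; set $x\prec y$ if $S_j=\oplus$ and $y\prec x$ if $S_j=\ominus$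 (no comparison if there is no such $j$). Let $\phi(x)=\mathrm{Leb}(\{y\in[0,1]: y\prec x\})$ and let $\boldsymbol{\mu}^{\mathrm{rec}}_p$ be the push-forward of $\mathrm{Leb}$ by $x\mapsto(x,\phi(x))$; this is almost surely a permuton. Pattern density: for a permuton $\mu$ and $k\ge1$, let $(x_i,y_i)_{1\le i\le k}$ be i.i.d. points with distribution $\mu$, reordered as $(x_{(1)},y_{(1)}),\dots,(x_{(k)},y_{(k)})$ with $y_{(1)}<\dots<y_{(k)}$. The random permutation $\mathrm{Sample}(\mu;k)$ is the (a.s. unique) permutation $\tau$ with $x_{(\tau_1)}<\dots<x_{(\tau_k)}$. For a permutation $\pi$ of size $k$, $\mathrm{dens}(\pi,\mu)=\mathbb P(\mathrm{Sample}(\mu;k)=\pi)$. Trees: the trees considered are rooted complete binary trees, i.e. every internal node has exactly two ordered children; if there are $k$ internal nodes they are labeled bijectively by $1,\dots,k$, and each internal node carries a decoration in $\{\oplus,\ominus\}$. The tree is increasing if labels increase along any path from the root to a leaf. The permutation $\mathrm{Perm}(T)$ is defined recursively: it is the permutation $1$ if $T$ is a single leaf; otherwise, if $T_1,T_2$ are the left and right subtrees at the root and $\otimes\in\{\oplus,\ominus\}$ is the decoration of the root, $\mathrm{Perm}(T)=\mathrm{Perm}(T_1)\otimes\mathrm{Perm}(T_2)$. Here, for permutations $\pi,\sigma$ of sizes $k,\ell$, in one-line notation, $\pi\oplus\sigma=\pi_1\cdots\pi_k(\sigma_1+k)\cdots(\sigma_\ell+k)$ and $\pi\ominus\sigma=(\pi_1+\ell)\cdots(\pi_k+\ell)\sigma_1\cdots\sigma_\ell$.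 *)

theory Defs
  imports
    "HOL-Probability.Probability"
    "HOL-Library.Tree"
    "HOL-Combinatorics.Multiset_Permutations"
begin

text \<open>
  A permutation of size \<open>n\<close> is given by its one-line notation, that is, by an element of
  \<^term>\<open>permutations_of_set {1..n}\<close>; the value \<open>\<pi>\<^sub>i\<close> is \<open>\<pi> ! (i - 1)\<close>.
\<close>

datatype sign = Plus | Minus

definition dsum :: "nat list \<Rightarrow> nat list \<Rightarrow> nat list" where
  "dsum \<pi> \<sigma> = \<pi> @ map (\<lambda>v. v + length \<pi>) \<sigma>"

definition ssum :: "nat list \<Rightarrow> nat list \<Rightarrow> nat list" where
  "ssum \<pi> \<sigma> = map (\<lambda>v. v + length \<sigma>) \<pi> @ \<sigma>"

definition des :: "nat list \<Rightarrow> nat" where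
  "des \<pi> = card {i. Suc i < length \<pi> \<and> \<pi> ! i > \<pi> ! Suc i}"


section \<open>Recursive separable permutations\<close>

definition split_value :: "nat \<Rightarrow> bool \<Rightarrow> nat list \<Rightarrow> nat list" where
  "split_value j up \<sigma> =
     concat (map (\<lambda>v. if v = j then (if up then [j, j + 1] else [j + 1, j])
                      else if v > j then [v + 1] else [v]) \<sigma>)"

text \<open>
  The law of \<open>\<sigma>\<^sup>(\<^sup>n\<^sup>)\<^sup>,\<^sup>p\<close>. The sequence starts at \<open>n = 1\<close>; the value at \<open>0\<close> is a dummy.
\<close>

fun rec_sep_perm :: "real \<Rightarrow> nat \<Rightarrow> nat list pmf" where
  "rec_sep_perm p 0 = return_pmf []"
| "rec_sep_perm p (Suc 0) = return_pmf [1]"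
| "rec_sep_perm p (Suc (Suc n)) =
     bind_pmf (rec_sep_perm p (Suc n)) (\<lambda>\<sigma>.
     bind_pmf (pmf_of_set {1..Suc n}) (\<lambda>j.
     bind_pmf (bernoulli_pmf p) (\<lambda>up.
     return_pmf (split_value j up \<sigma>))))"


section \<open>The recursive separable permuton\<close>

text \<open>
  Measures on \<open>[0,1]\<close> and \<open>[0,1]\<^sup>2\<close> are represented as Borel measures on the real line and the
  plane that are concentrated on these sets.
\<close>

definition Leb :: "real measure" where
  "Leb = uniform_measure lborel {0..1}"

definition separated :: "(nat \<Rightarrow> real) \<Rightarrow> real \<Rightarrow> real \<Rightarrow> bool" where
  "separated u x y \<longleftrightarrow> (\<exists>j\<ge>1. u j \<in> {x<..y})"

definition first_sep :: "(nat \<Rightarrow> real) \<Rightarrow> real \<Rightarrow> real \<Rightarrow> nat" where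
  "first_sep u x y = (LEAST j. j \<ge> 1 \<and> u j \<in> {x<..y})"

text \<open>\<open>prec u s x y\<close> is the relation \<open>x \<prec> y\<close>, where \<open>x\<close> may lie on either side of \<open>y\<close>.\<close>

definition prec :: "(nat \<Rightarrow> real) \<Rightarrow> (nat \<Rightarrow> sign) \<Rightarrow> real \<Rightarrow> real \<Rightarrow> bool" where
  "prec u s x y \<longleftrightarrow>
     (x < y \<and> separated u x y \<and> s (first_sep u x y) = Plus) \<or>
     (y < x \<and> separated u y x \<and> s (first_sep u y x) = Minus)"

definition rec_phi :: "(nat \<Rightarrow> real) \<Rightarrow> (nat \<Rightarrow> sign) \<Rightarrow> real \<Rightarrow> real" where
  "rec_phi u s x = measure Leb {y \<in> {0..1}. prec u s y x}"

definition rec_sep_permuton :: "(nat \<Rightarrow> real) \<Rightarrow> (nat \<Rightarrow> sign) \<Rightarrow> (real \<times> real) measure" where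
  "rec_sep_permuton u s = distr Leb borel (\<lambda>x. (x, rec_phi u s x))"


section \<open>Pattern densities\<close>

text \<open>
  The points \<open>z 1, \<dots>, z k\<close> have the pattern \<open>\<tau>\<close>. Here \<open>\<rho>\<close> is the reordering by increasing
  second coordinate, so \<open>z (\<rho> i)\<close> is the point \<open>(x\<^bsub>(i)\<^esub>, y\<^bsub>(i)\<^esub>)\<close>. If two points share a coordinate,
  no \<open>\<tau>\<close> qualifies; for i.i.d. points from a permuton this is a null event.
\<close>

definition is_sample :: "nat \<Rightarrow> (nat \<Rightarrow> real \<times> real) \<Rightarrow> nat list \<Rightarrow> bool" where
  "is_sample k z \<tau> \<longleftrightarrow>
     \<tau> \<in> permutations_of_set {1..k} \<and>
     (\<exists>\<rho>. \<rho> permutes {1..k} \<and>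
        (\<forall>i\<in>{1..k}. \<forall>j\<in>{1..k}. i < j \<longrightarrow> snd (z (\<rho> i)) < snd (z (\<rho> j))) \<and>
        (\<forall>i\<in>{1..k}. \<forall>j\<in>{1..k}. i < j \<longrightarrow>
           fst (z (\<rho> (\<tau> ! (i - 1)))) < fst (z (\<rho> (\<tau> ! (j - 1))))))"

definition dens :: "nat list \<Rightarrow> (real \<times> real) measure \<Rightarrow> real" where
  "dens \<pi> \<mu> =
     (let k = length \<pi>; P = PiM {1..k} (\<lambda>_. \<mu>)
      in measure P {z \<in> space P. is_sample k z \<pi>})"


section \<open>Decorated increasing binary trees\<close>

text \<open>
  The constructor \<^term>\<open>Node\<close> stands for internal nodes, which carry a label and a decoration, and
  \<^term>\<open>Leaf\<close> for the leaves; \<^term>\<open>size T\<close> is the number of internal nodes.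
\<close>

type_synonym dtree = "(nat \<times> sign) tree"

definition well_labeled :: "dtree \<Rightarrow> bool" where
  "well_labeled T \<longleftrightarrow> map fst (inorder T) \<in> permutations_of_set {1..size T}"

fun root_paths :: "'a tree \<Rightarrow> 'a list set" where
  "root_paths Leaf = {[]}"
| "root_paths (Node l a r) = (\<lambda>xs. a # xs) ` (root_paths l \<union> root_paths r)"

definition increasing :: "dtree \<Rightarrow> bool" where
  "increasing T \<longleftrightarrow> (\<forall>xs\<in>root_paths T. sorted_wrt (<) (map fst xs))"

fun Perm :: "dtree \<Rightarrow> nat list" where
  "Perm Leaf = [1]"
| "Perm (Node l (_, d) r) =
     (case d of Plus \<Rightarrow> dsum (Perm l) (Perm r) | Minus \<Rightarrow> ssum (Perm l) (Perm r))"

definition N_inc :: "nat list \<Rightarrow> nat" where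
  "N_inc \<pi> = card {T. well_labeled T \<and> increasing T \<and> Perm T = \<pi>}"

end

theory Submission
  imports Defs
begin

text \<open>
  All three quantities count the ways to cut a row of \<open>n\<close> items at its \<open>n - 1\<close> gaps, one gap after the
  other, each cut with a sign. Two items are compared by the sign of the cut that separates them first
  (\<open>earliest_plus\<close>), and \<open>\<pi>\<close> arises from those signed cutting orders that
  reproduce its comparisons. Neighbours are separated by a single cut, so \<open>\<pi>\<close> determines the signs, and
  \<open>des \<pi>\<close> of them are \<open>Minus\<close>. What remains to be counted is the set \<open>cut_orders \<pi>\<close> of orders of the gaps.

  An increasing tree is such a signed order: its nodes in symmetric order are the gaps, its labels are the
  times of the cuts, and the last common ancestor of two leaves is the cut that separates them first. Hence
  \<open>N_inc \<pi>\<close> is the size of \<open>cut_orders \<pi>\<close> (\<open>N_inc_eq_card_cut_orders\<close>).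

  In the growing permutation, a step splits a uniformly chosen item, which inserts the latest cut at a
  uniform place. So all \<open>(n - 1)!\<close> orders are equally likely and independent of the signs
  (\<open>pmf_cuts\<close>, \<open>prob_rec_sep_perm\<close>).

  For the permuton, let \<open>n\<close> uniform points be given. A gap between neighbouring points is cut at the first
  index \<open>j\<close> for which \<open>U\<^sub>j\<close> falls into it, and \<open>S\<^sub>j\<close> is the sign of the cut. The heights \<open>\<phi>(x)\<close>
  are ordered like the points themselves by \<open>\<prec>\<close>, because the level sets of \<open>\<phi>\<close> are null
  (\<open>level_set_null\<close>, \<open>dens_eq_prec_pattern\<close>). For fixed points a long gap tends to be cut early, but the law
  of the cutting times depends on the lengths of the gaps in a symmetric way (\<open>cut_mass_permute\<close>), and
  the spacings of uniform points are exchangeable: two adjacent gaps are swapped by reflecting the point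
  between them (\<open>mean_cut_mass_adjacent_swap\<close>). On average over the points, all orders of the gaps are
  therefore equally likely (\<open>mean_cut_mass_orders\<close>, \<open>common_order_mass\<close>), and the expected density is
  \<open>card (cut_orders \<pi>) / (n - 1)!\<close> times the probability of the signs (\<open>integral_dens\<close>).
\<close>

section \<open>Permutations read off from times and signs\<close>

text \<open>
  Cut a row of items \<open>0, 1, 2, \<dots>\<close> at the gaps between neighbours, where gap \<open>l\<close>, between the items
  \<open>l\<close> and \<open>l + 1\<close>, is cut at time \<open>t l\<close> and carries the sign \<open>s l\<close>. Two items \<open>i < j\<close> are compared by the
  sign of the cut that separates them first. Times may be labels of tree nodes, steps of
  the growing permutation, or indices \<open>j\<close> of the points \<open>U\<^sub>j\<close>.
\<close>

definition earliest_plus :: "(nat \<Rightarrow> nat) \<Rightarrow> (nat \<Rightarrow> sign) \<Rightarrow> nat \<Rightarrow> nat \<Rightarrow> bool" where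
  "earliest_plus t s i j \<longleftrightarrow> (\<exists>k\<in>{i..<j}. s k = Plus \<and> (\<forall>l\<in>{i..<j}. t k \<le> t l))"

definition realizes :: "(nat \<Rightarrow> nat) \<Rightarrow> (nat \<Rightarrow> sign) \<Rightarrow> nat list \<Rightarrow> bool" where
  "realizes t s \<pi> \<longleftrightarrow>
     (\<forall>i j. i < j \<longrightarrow> j < length \<pi> \<longrightarrow> (\<pi> ! i < \<pi> ! j \<longleftrightarrow> earliest_plus t s i j))"

definition step_sign :: "nat list \<Rightarrow> nat \<Rightarrow> sign" where
  "step_sign \<pi> i = (if \<pi> ! i < \<pi> ! Suc i then Plus else Minus)"

text \<open>
  The orders of the \<open>n - 1\<close> gaps that yield \<open>\<pi>\<close>, written as lists of ranks: gap \<open>l\<close> is the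
  \<open>g ! l\<close>-th one to be cut.
\<close>

definition cut_orders :: "nat list \<Rightarrow> nat list set" where
  "cut_orders \<pi> =
     {g \<in> permutations_of_set {1..length \<pi> - 1}. realizes ((!) g) (step_sign \<pi>) \<pi>}"

lemma length_permutations_of_set_upto:
  "\<pi> \<in> permutations_of_set {1..n} \<Longrightarrow> length \<pi> = n"
  by (metis length_finite_permutations_of_set card_atLeastAtMost diff_Suc_1)

lemma bij_betw_nth_permutation:
  assumes "\<pi> \<in> permutations_of_set {1..n}"
  shows "bij_betw (\<lambda>i. \<pi> ! i) {..<n} {1..n}"
  using assms length_permutations_of_set_upto[OF assms]
  by (auto simp: permutations_of_set_def intro!: bij_betw_nth)

lemma permutation_eqI:
  assumes "\<pi> \<in> permutations_of_set {1..n}" "\<sigma> \<in> permutations_of_set {1..n}"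
    and cmp: "\<And>i j. i < j \<Longrightarrow> j < n \<Longrightarrow> \<pi> ! i < \<pi> ! j \<longleftrightarrow> \<sigma> ! i < \<sigma> ! j"
  shows "\<pi> = \<sigma>"
proof -
  \<comment> \<open>An entry of a permutation is the number of entries below it or equal to it.\<close>
  have rank: "\<tau> ! i = card {j. j < n \<and> \<tau> ! j \<le> \<tau> ! i}"
    if "\<tau> \<in> permutations_of_set {1..n}" "i < n" for \<tau> i
  proof -
    have bij: "bij_betw ((!) \<tau>) {..<n} {1..n}" using bij_betw_nth_permutation[OF that(1)] .
    have i: "\<tau> ! i \<in> {1..n}" using bij_betw_apply[OF bij] that(2) by blast
    have img: "(!) \<tau> ` {j. j < n \<and> \<tau> ! j \<le> \<tau> ! i} = {1..\<tau> ! i}"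
    proof
      show "(!) \<tau> ` {j. j < n \<and> \<tau> ! j \<le> \<tau> ! i} \<subseteq> {1..\<tau> ! i}"
        using bij_betw_apply[OF bij] by auto
      show "{1..\<tau> ! i} \<subseteq> (!) \<tau> ` {j. j < n \<and> \<tau> ! j \<le> \<tau> ! i}"
      proof
        fix v assume v: "v \<in> {1..\<tau> ! i}"
        then have "v \<in> {1..n}" using i by auto
        then have "v \<in> (!) \<tau> ` {..<n}" using bij unfolding bij_betw_def by blast
        then obtain j where "j < n" "\<tau> ! j = v" by blast
        then show "v \<in> (!) \<tau> ` {j. j < n \<and> \<tau> ! j \<le> \<tau> ! i}" using v by auto
      qed
    qed
    have "inj_on ((!) \<tau>) {j. j < n \<and> \<tau> ! j \<le> \<tau> ! i}"
      by (rule inj_on_subset[OF bij_betw_imp_inj_on[OF bij]]) auto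
    from card_image[OF this] img show ?thesis by simp
  qed
  have ne: "\<tau> ! i \<noteq> \<tau> ! j" if "\<tau> \<in> permutations_of_set {1..n}" "i < n" "j < n" "i \<noteq> j" for \<tau> i j
    using that bij_betw_nth_permutation[OF that(1)] by (auto simp: bij_betw_def inj_on_def)
  show ?thesis
  proof (rule nth_equalityI)
    show "length \<pi> = length \<sigma>" using assms length_permutations_of_set_upto by metis
    fix i assume "i < length \<pi>"
    then have i: "i < n" using length_permutations_of_set_upto[OF assms(1)] by simp
    have "\<pi> ! j \<le> \<pi> ! i \<longleftrightarrow> \<sigma> ! j \<le> \<sigma> ! i" if "j < n" for j
    proof (cases i j rule: linorder_cases)
      case less
      then show ?thesis
        using cmp[OF less that] ne[OF assms(1) i that] ne[OF assms(2) i that] by linarith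
    next
      case greater
      then show ?thesis
        using cmp[OF greater i] ne[OF assms(1) that i] ne[OF assms(2) that i] by linarith
    qed auto
    then have "{j. j < n \<and> \<pi> ! j \<le> \<pi> ! i} = {j. j < n \<and> \<sigma> ! j \<le> \<sigma> ! i}" by auto
    then show "\<pi> ! i = \<sigma> ! i"
      using rank[OF assms(1) i] rank[OF assms(2) i] by simp
  qed
qed

lemma realizes_unique:
  assumes "\<pi> \<in> permutations_of_set {1..n}" "\<sigma> \<in> permutations_of_set {1..n}"
    and "realizes t s \<pi>" "realizes t s \<sigma>"
  shows "\<pi> = \<sigma>"
  using assms(3,4) unfolding realizes_def
    length_permutations_of_set_upto[OF assms(1)] length_permutations_of_set_upto[OF assms(2)]
  by (intro permutation_eqI[OF assms(1,2)]) auto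

lemma earliest_plus_cong:
  assumes "\<And>k. k \<in> {i..<j} \<Longrightarrow> s k = s' k"
    and "\<And>k l. k \<in> {i..<j} \<Longrightarrow> l \<in> {i..<j} \<Longrightarrow> t k \<le> t l \<longleftrightarrow> t' k \<le> t' l"
  shows "earliest_plus t s i j \<longleftrightarrow> earliest_plus t' s' i j"
proof -
  have "(s k = Plus \<and> (\<forall>l\<in>{i..<j}. t k \<le> t l)) \<longleftrightarrow> (s' k = Plus \<and> (\<forall>l\<in>{i..<j}. t' k \<le> t' l))"
    if "k \<in> {i..<j}" for k
    using assms(1)[OF that] assms(2)[OF that] by simp
  then show ?thesis unfolding earliest_plus_def by simp
qed

text \<open>
  Only the relative order of the times matters, so tree labels, ranks and hitting times are interchangeable.
\<close>

lemma realizes_cong: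
  assumes "\<And>k. Suc k < length \<pi> \<Longrightarrow> s k = s' k"
    and "\<And>k l. Suc k < length \<pi> \<Longrightarrow> Suc l < length \<pi> \<Longrightarrow> t k \<le> t l \<longleftrightarrow> t' k \<le> t' l"
  shows "realizes t s \<pi> \<longleftrightarrow> realizes t' s' \<pi>"
proof -
  have "earliest_plus t s i j \<longleftrightarrow> earliest_plus t' s' i j" if "i < j" "j < length \<pi>" for i j
    using that by (intro earliest_plus_cong assms) auto
  then show ?thesis unfolding realizes_def by auto
qed

text \<open>Neighbouring items are separated by a single cut, so the permutation determines the signs.\<close>

lemma realizes_step_sign:
  assumes "realizes t s \<pi>" "Suc i < length \<pi>"
  shows "s i = step_sign \<pi> i"
  using assms(1)[unfolded realizes_def, rule_format, of i "Suc i"] assms(2)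
  by (cases "s i") (auto simp: step_sign_def earliest_plus_def)

lemma card_step_sign_Minus:
  assumes "\<pi> \<in> permutations_of_set {1..n}"
  shows "card {i. i < n - 1 \<and> step_sign \<pi> i = Minus} = des \<pi>"
proof -
  have "\<pi> ! i \<noteq> \<pi> ! Suc i" if "Suc i < n" for i
    using assms that length_permutations_of_set_upto[OF assms]
    by (auto simp: permutations_of_set_def nth_eq_iff_index_eq)
  then have "step_sign \<pi> i = Minus \<longleftrightarrow> \<pi> ! i > \<pi> ! Suc i" if "Suc i < n" for i
    using that by (force simp: step_sign_def)
  then have "{i. i < n - 1 \<and> step_sign \<pi> i = Minus} = {i. Suc i < n \<and> \<pi> ! i > \<pi> ! Suc i}"
    by auto
  then show ?thesis unfolding des_def length_permutations_of_set_upto[OF assms] by simp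
qed

section \<open>Increasing trees\<close>

lemma increasing_Leaf [simp]: "increasing Leaf"
  by (simp add: increasing_def)

lemma root_paths_nonempty: "root_paths T \<noteq> {}"
  by (induction T) auto

lemma set_tree_root_paths: "\<Union>(set ` root_paths T) = set_tree T"
proof (induction T)
  case (Node l a r)
  have "root_paths l \<union> root_paths r \<noteq> {}" using root_paths_nonempty[of l] by blast
  then have "\<Union>(set ` root_paths (Node l a r)) = insert a (\<Union>(set ` root_paths l) \<union> \<Union>(set ` root_paths r))"
    by auto
  then show ?case using Node by simp
qed simp



lemma increasing_Node [simp]:
  "increasing (Node l a r) \<longleftrightarrow>
     increasing l \<and> increasing r \<and> (\<forall>b\<in>set_tree l \<union> set_tree r. fst a < fst b)"
proof -
  have "increasing (Node l a r) \<longleftrightarrow>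
      (\<forall>xs\<in>root_paths l \<union> root_paths r. sorted_wrt (<) (map fst xs) \<and> (\<forall>b\<in>set xs. fst a < fst b))"
    by (auto simp: increasing_def)
  also have "\<dots> \<longleftrightarrow> increasing l \<and> increasing r \<and>
      (\<forall>b\<in>\<Union>(set ` root_paths l) \<union> \<Union>(set ` root_paths r). fst a < fst b)"
    by (auto simp: increasing_def)
  finally show ?thesis by (simp add: set_tree_root_paths)
qed

lemma length_Perm: "length (Perm T) = Suc (size T)"
  by (induction T rule: Perm.induct) (auto simp: dsum_def ssum_def split: sign.split)

lemma Perm_permutation: "Perm T \<in> permutations_of_set {1..Suc (size T)}"
proof (induction T)
  case Leaf
  then show ?case by (auto simp: permutations_of_set_def)
next
  case (Node l x r)
  obtain a d where x: "x = (a, d)" by fastforce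
  let ?m = "Suc (size l)" and ?n = "Suc (size r)"
  have shift: "(\<lambda>v. v + k) ` {Suc 0..m} = {Suc k..k + m}" for k m :: nat
    using image_add_atLeastAtMost[of k "Suc 0" m] by (simp add: add.commute)
  have shift': "(\<lambda>v. Suc (v + k)) ` {Suc 0..m} = {Suc (Suc k)..Suc (k + m)}" for k m :: nat
    using shift[of "Suc k" m] by simp
  have "set (Perm l) = {1..?m}" "distinct (Perm l)" "set (Perm r) = {1..?n}" "distinct (Perm r)"
    using Node by (auto simp: permutations_of_set_def)
  then show ?case
    by (auto simp: permutations_of_set_def dsum_def ssum_def length_Perm distinct_map inj_on_def
          shift shift' x split: sign.split)
qed

abbreviation labels :: "(nat \<times> sign) list \<Rightarrow> nat \<Rightarrow> nat" where
  "labels w \<equiv> \<lambda>i. fst (w ! i)"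

abbreviation decorations :: "(nat \<times> sign) list \<Rightarrow> nat \<Rightarrow> sign" where
  "decorations w \<equiv> \<lambda>i. snd (w ! i)"

lemma earliest_plus_shift:
  "earliest_plus t s (i + m) (j + m) \<longleftrightarrow> earliest_plus (\<lambda>k. t (k + m)) (\<lambda>k. s (k + m)) i j"
proof -
  have "{i + m..<j + m} = (\<lambda>k. k + m) ` {i..<j}" by simp
  then show ?thesis unfolding earliest_plus_def by (simp del: image_add_atLeastLessThan')
qed

text \<open>
  The leaves of a tree are the items and its nodes, listed in order, are the gaps between them. In
  an increasing tree the last common ancestor of two leaves has the smallest label among the nodes
  between them, so it is the cut that separates them first.
\<close>

lemma realizes_Perm:
  assumes "increasing T"
  shows "realizes (labels (inorder T)) (decorations (inorder T)) (Perm T)"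
  using assms
proof (induction T)
  case Leaf
  then show ?case by (auto simp: realizes_def)
next
  case (Node l x r)
  obtain a d where x: "x = (a, d)" by fastforce
  let ?m = "size l" and ?w = "inorder \<langle>l, (a, d), r\<rangle>"
  let ?P = "Perm \<langle>l, (a, d), r\<rangle>"
  have low: "fst (?w ! ?m) < fst (?w ! k)" if "k \<noteq> ?m" "k < length ?w" for k
  proof -
    have small: "fst (a, d) < fst b" if "b \<in> set (inorder l) \<union> set (inorder r)" for b
      using that Node.prems x by (simp del: fst_conv)
    have "?w ! k \<in> set (inorder l) \<union> set (inorder r)"
    proof (cases "k < ?m")
      case False
      then have "?w ! k = inorder r ! (k - Suc ?m)" "k - Suc ?m < length (inorder r)"
        using that by (auto simp: nth_append nth_Cons')
      then show ?thesis by (metis UnCI nth_mem)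
    qed (simp add: nth_append flip: set_inorder)
    from small[OF this] show ?thesis by (simp add: nth_append)
  qed
  have Pl: "?P ! i < ?P ! j \<longleftrightarrow> Perm l ! i < Perm l ! j" if "i \<le> ?m" "j \<le> ?m" for i j
    using that by (auto simp: dsum_def ssum_def length_Perm nth_append split: sign.split)
  have Pr: "?P ! (i + Suc ?m) < ?P ! (j + Suc ?m) \<longleftrightarrow> Perm r ! i < Perm r ! j"
    if "i \<le> size r" "j \<le> size r" for i j
    using that by (auto simp: dsum_def ssum_def length_Perm nth_append split: sign.split)
  have Pm: "?P ! i < ?P ! j \<longleftrightarrow> d = Plus" if "i \<le> ?m" "?m < j" "j \<le> Suc (size l + size r)" for i j
  proof -
    have "Perm l ! i \<in> set (Perm l)" "Perm r ! (j - Suc ?m) \<in> set (Perm r)"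
      using that by (auto simp: length_Perm)
    then have "Perm l ! i \<in> {1..Suc ?m}" "Perm r ! (j - Suc ?m) \<in> {1..Suc (size r)}"
      using Perm_permutation[of l] Perm_permutation[of r] by (auto simp: permutations_of_set_def)
    then show ?thesis
      using that by (auto simp: dsum_def ssum_def length_Perm nth_append split: sign.split)
  qed
  have wl: "?w ! k = inorder l ! k" if "k < ?m" for k
    using that by (simp add: nth_append)
  have wr: "?w ! (k + Suc ?m) = inorder r ! k" for k
    by (simp add: nth_append)
  show ?case
    unfolding realizes_def x
  proof (intro allI impI)
    fix i j assume ij: "i < j" "j < length ?P"
    then have j: "j \<le> Suc (size l + size r)" by (simp only: length_Perm) simp
    consider "j \<le> ?m" | "i \<le> ?m" "?m < j" | "?m < i" by linarith
    then show "?P ! i < ?P ! j \<longleftrightarrow> earliest_plus (labels ?w) (decorations ?w) i j"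
    proof cases
      case 1
      have "earliest_plus (labels ?w) (decorations ?w) i j \<longleftrightarrow>
          earliest_plus (labels (inorder l)) (decorations (inorder l)) i j"
        using 1 wl by (intro earliest_plus_cong) auto
      moreover have "Perm l ! i < Perm l ! j \<longleftrightarrow>
          earliest_plus (labels (inorder l)) (decorations (inorder l)) i j"
        using Node.IH(1) Node.prems ij 1 by (auto simp: realizes_def length_Perm)
      ultimately show ?thesis using Pl ij 1 by simp
    next
      case 2
      have "earliest_plus (labels ?w) (decorations ?w) i j \<longleftrightarrow> snd (?w ! ?m) = Plus"
      proof
        assume "earliest_plus (labels ?w) (decorations ?w) i j"
        then obtain k where k: "k \<in> {i..<j}" "snd (?w ! k) = Plus" "fst (?w ! k) \<le> fst (?w ! ?m)"
          using 2 by (auto simp: earliest_plus_def)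
        then have "k = ?m" using low[of k] j by force
        then show "snd (?w ! ?m) = Plus" using k by simp
      next
        assume "snd (?w ! ?m) = Plus"
        moreover have "fst (?w ! ?m) \<le> fst (?w ! k)" if "k \<in> {i..<j}" for k
          using low[of k] that j by (cases "k = ?m") auto
        ultimately show "earliest_plus (labels ?w) (decorations ?w) i j"
          using 2 unfolding earliest_plus_def by force
      qed
      moreover have "snd (?w ! ?m) = d" by (simp add: nth_append)
      ultimately show ?thesis using Pm 2 j by simp
    next
      case 3
      define i' j' where "i' = i - Suc ?m" and "j' = j - Suc ?m"
      have i: "i = i' + Suc ?m" and jj: "j = j' + Suc ?m" using 3 ij by (auto simp: i'_def j'_def)
      have "earliest_plus (labels ?w) (decorations ?w) i j \<longleftrightarrow>
          earliest_plus (labels (inorder r)) (decorations (inorder r)) i' j'"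
        unfolding i jj earliest_plus_shift by (simp only: wr)
      moreover have "Perm r ! i' < Perm r ! j' \<longleftrightarrow>
          earliest_plus (labels (inorder r)) (decorations (inorder r)) i' j'"
        using Node.IH(2) Node.prems ij j i jj by (auto simp: realizes_def length_Perm)
      moreover have "i' \<le> size r" "j' \<le> size r" using ij j i jj by auto
      ultimately show ?thesis using Pr i jj by simp
    qed
  qed
qed

text \<open>
  The root carries the smallest label, so the word of its nodes in symmetric order determines an
  increasing tree recursively; conversely, every word with distinct labels can be split at its smallest label.
\<close>

lemma increasing_inorder_inj:
  assumes "increasing T" "increasing T'" "inorder T = inorder T'" "distinct (map fst (inorder T))"
  shows "T = T'"
  using assms
proof (induction T arbitrary: T')
  case Leaf
  then show ?case by (cases T') auto
next
  case (Node l a r)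
  obtain l' a' r' where T': "T' = Node l' a' r'" using Node.prems by (cases T') auto
  let ?w = "inorder l @ a # inorder r"
  have w: "?w = inorder l' @ a' # inorder r'" using Node.prems T' by simp
  have "fst a \<le> fst b" if "b \<in> set ?w" for b using that Node.prems(1) by (auto simp: less_imp_le)
  moreover have "fst a' \<le> fst b" if "b \<in> set (inorder l' @ a' # inorder r')" for b
    using that Node.prems(2) T' by (auto simp: less_imp_le)
  moreover have "a \<in> set ?w" "a' \<in> set (inorder l' @ a' # inorder r')" by auto
  ultimately have feq: "fst a = fst a'" using w by (metis order_antisym)
  have dm: "distinct (map fst ?w)" using Node.prems(4) by simp
  have "a' \<in> set ?w" unfolding w by simp
  then have "a' = a" using dm feq by (auto simp: distinct_map dest: inj_onD)
  have d: "distinct ?w" using dm by (metis distinct_map)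
  then have "a \<notin> set (inorder l)" "a \<notin> set (inorder r)" by auto
  then have "inorder l = inorder l' \<and> inorder r = inorder r'"
    using w unfolding \<open>a' = a\<close> by (subst (asm) append_Cons_eq_iff) auto
  then show ?case using Node.prems T' \<open>a' = a\<close> Node.IH(1)[of l'] Node.IH(2)[of r'] by simp
qed

lemma increasing_inorder_surj:
  fixes w :: "(nat \<times> sign) list"
  assumes "distinct (map fst w)"
  shows "\<exists>T. increasing T \<and> inorder T = w"
  using assms
proof (induction "length w" arbitrary: w rule: less_induct)
  case less
  show ?case
  proof (cases "w = []")
    case True
    then show ?thesis by (intro exI[of _ Leaf]) simp
  next
    case False
    define m where "m = Min (fst ` set w)"
    have "m \<in> fst ` set w" unfolding m_def using False by (intro Min_in) auto
    then obtain a where a: "a \<in> set w" "fst a = m" by auto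
    then obtain u v where w: "w = u @ a # v" by (meson split_list)
    have min: "fst a \<le> fst b" if "b \<in> set w" for b using that a unfolding m_def by simp
    have "length u < length w" "length v < length w" using w by auto
    moreover have "distinct (map fst u)" "distinct (map fst v)" using less.prems w by auto
    ultimately obtain l r where lr: "increasing l" "inorder l = u" "increasing r" "inorder r = v"
      using less.hyps by meson
    have "fst a < fst b" if "b \<in> set u \<union> set v" for b
    proof -
      have "fst b \<noteq> fst a" using less.prems w that by (auto simp: rev_image_eqI)
      then show ?thesis using min[of b] that w by force
    qed
    then have "increasing (Node l a r)" using lr by (auto simp flip: set_inorder)
    moreover have "inorder (Node l a r) = w" using lr w by simp
    ultimately show ?thesis by blast
  qed
qed

text \<open>
  Reading the labels in symmetric order is a bijection: the signs are forced by \<open>\<pi>\<close>, and the tree can be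
  recovered from labels and signs.
\<close>

lemma N_inc_eq_card_cut_orders:
  assumes \<pi>: "\<pi> \<in> permutations_of_set {1..n}" and n: "n \<ge> 1"
  shows "N_inc \<pi> = card (cut_orders \<pi>)"
proof -
  let ?X = "{T. well_labeled T \<and> increasing T \<and> Perm T = \<pi>}"
  let ?N = "n - 1"
  have len: "length \<pi> = n" using length_permutations_of_set_upto[OF \<pi>] .
  have size: "size T = ?N" if "T \<in> ?X" for T using that len length_Perm[of T] by auto
  have deco: "map snd (inorder T) = map (step_sign \<pi>) [0..<?N]" if "T \<in> ?X" for T
    using that size[OF that] realizes_step_sign[OF realizes_Perm, of T] len
    by (intro nth_equalityI) auto
  have "bij_betw (\<lambda>T. map fst (inorder T)) ?X (cut_orders \<pi>)"
    unfolding bij_betw_def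
  proof
    show "inj_on (\<lambda>T. map fst (inorder T)) ?X"
    proof (rule inj_onI)
      fix T T' assume T: "T \<in> ?X" "T' \<in> ?X" "map fst (inorder T) = map fst (inorder T')"
      then have "inorder T = inorder T'" using deco[of T] deco[of T'] by (metis zip_map_fst_snd)
      then show "T = T'"
        using T by (intro increasing_inorder_inj) (auto simp: well_labeled_def permutations_of_set_def)
    qed
    show "(\<lambda>T. map fst (inorder T)) ` ?X = cut_orders \<pi>"
    proof
      show "(\<lambda>T. map fst (inorder T)) ` ?X \<subseteq> cut_orders \<pi>"
      proof safe
        fix T assume T: "well_labeled T" "increasing T" "\<pi> = Perm T"
        then have sz: "size T = ?N" using size by auto
        have "realizes ((!) (map fst (inorder T))) (step_sign \<pi>) \<pi> \<longleftrightarrow>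
           realizes (labels (inorder T)) (decorations (inorder T)) \<pi>"
          using realizes_step_sign[OF realizes_Perm, of T] T len sz by (intro realizes_cong) auto
        then show "map fst (inorder T) \<in> cut_orders (Perm T)"
          using T sz realizes_Perm[of T] len by (auto simp: cut_orders_def well_labeled_def)
      qed
      show "cut_orders \<pi> \<subseteq> (\<lambda>T. map fst (inorder T)) ` ?X"
      proof
        fix g assume g: "g \<in> cut_orders \<pi>"
        then have gp: "g \<in> permutations_of_set {1..?N}" by (simp add: cut_orders_def len)
        have lg: "length g = ?N" using length_permutations_of_set_upto[OF gp] .
        define w where "w = zip g (map (step_sign \<pi>) [0..<?N])"
        have fw: "map fst w = g" using lg by (simp add: w_def)
        have "distinct (map fst w)" using gp fw by (simp add: permutations_of_set_def)
        then obtain T where T: "increasing T" "inorder T = w" using increasing_inorder_surj by blast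
        have sz: "size T = ?N" using T lg fw by (metis length_inorder length_map)
        have "realizes (labels w) (decorations w) \<pi> \<longleftrightarrow> realizes ((!) g) (step_sign \<pi>) \<pi>"
          using len lg by (intro realizes_cong) (auto simp: w_def)
        then have "realizes (labels w) (decorations w) \<pi>" using g by (simp add: cut_orders_def)
        moreover have "Perm T \<in> permutations_of_set {1..n}"
          using Perm_permutation[of T] sz n by simp
        ultimately have "Perm T = \<pi>"
          using realizes_Perm[OF T(1)] T(2) \<pi> by (metis realizes_unique)
        moreover have "well_labeled T" using gp sz fw T by (simp add: well_labeled_def)
        ultimately show "g \<in> (\<lambda>T. map fst (inorder T)) ` ?X" using T fw by (intro image_eqI[of _ _ T]) auto
      qed
    qed
  qed
  then show ?thesis unfolding N_inc_def by (rule bij_betw_same_card)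
qed

section \<open>The law of the recursive separable permutation\<close>

definition insert_at :: "nat \<Rightarrow> 'b \<Rightarrow> 'b list \<Rightarrow> 'b list" where
  "insert_at i x w = take i w @ x # drop i w"

lemma length_insert_at [simp]: "length (insert_at i x w) = Suc (length w)"
  by (simp add: insert_at_def)

lemma nth_insert_at:
  "i \<le> length w \<Longrightarrow>
     insert_at i x w ! k = (if k < i then w ! k else if k = i then x else w ! (k - 1))"
  by (auto simp: insert_at_def nth_append min_def nth_Cons' less_imp_diff_less)

lemma mset_insert_at: "mset (insert_at i x w) = add_mset x (mset w)"
  by (metis insert_at_def append_take_drop_id mset.simps(2) mset_append union_mset_add_mset_right)

text \<open>
  Item \<open>c\<close> of the old row is the one that contains item \<open>k\<close> of the new row.
\<close>

lemma split_value_nth: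
  assumes \<sigma>: "distinct \<sigma>" and i: "i < length \<sigma>"
  shows "length (split_value (\<sigma> ! i) b \<sigma>) = Suc (length \<sigma>)"
    and "k \<le> length \<sigma> \<Longrightarrow> split_value (\<sigma> ! i) b \<sigma> ! k =
      (let c = (if k \<le> i then k else k - 1)
       in if c = i then \<sigma> ! i + (if (k = i) = b then 0 else 1)
          else if \<sigma> ! c > \<sigma> ! i then \<sigma> ! c + 1 else \<sigma> ! c)"
proof -
  let ?f = "\<lambda>v. if v > \<sigma> ! i then v + 1 else v"
  let ?g = "\<lambda>v. if v = \<sigma> ! i then (if b then [\<sigma> ! i, \<sigma> ! i + 1] else [\<sigma> ! i + 1, \<sigma> ! i])
                      else if v > \<sigma> ! i then [v + 1] else [v]"
  have single: "concat (map ?g xs) = map ?f xs" if "\<sigma> ! i \<notin> set xs" for xs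
    using that by (induction xs) auto
  have dec: "\<sigma> = take i \<sigma> @ \<sigma> ! i # drop (Suc i) \<sigma>" using i by (simp add: id_take_nth_drop)
  have "distinct (take i \<sigma> @ \<sigma> ! i # drop (Suc i) \<sigma>)" using \<sigma> dec by simp
  then have "\<sigma> ! i \<notin> set (take i \<sigma>)" "\<sigma> ! i \<notin> set (drop (Suc i) \<sigma>)" by auto
  then have c: "concat (map ?g (take i \<sigma> @ \<sigma> ! i # drop (Suc i) \<sigma>)) = map ?f (take i \<sigma>) @
      (if b then [\<sigma> ! i, \<sigma> ! i + 1] else [\<sigma> ! i + 1, \<sigma> ! i]) @ map ?f (drop (Suc i) \<sigma>)"
    by (simp add: single)
  have eq: "split_value (\<sigma> ! i) b \<sigma> = map ?f (take i \<sigma>) @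
      (if b then [\<sigma> ! i, \<sigma> ! i + 1] else [\<sigma> ! i + 1, \<sigma> ! i]) @ map ?f (drop (Suc i) \<sigma>)"
    unfolding split_value_def using c dec by simp
  show "length (split_value (\<sigma> ! i) b \<sigma>) = Suc (length \<sigma>)"
    unfolding eq using i by auto
  assume k: "k \<le> length \<sigma>"
  consider "k < i" | "k = i" | "k = Suc i" | "k > Suc i" by linarith
  then show "split_value (\<sigma> ! i) b \<sigma> ! k =
      (let c = (if k \<le> i then k else k - 1)
       in if c = i then \<sigma> ! i + (if (k = i) = b then 0 else 1)
          else if \<sigma> ! c > \<sigma> ! i then \<sigma> ! c + 1 else \<sigma> ! c)"
  proof cases
    case 4
    define m where "m = k - Suc (Suc i)"
    have k': "k = Suc (Suc i) + m" using 4 by (simp add: m_def)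
    show ?thesis unfolding eq k' Let_def using i k k' by (auto simp: nth_append)
  qed (use i in \<open>auto simp: eq Let_def nth_append\<close>)
qed

text \<open>
  Splitting the entry at position \<open>i\<close> cuts item \<open>i\<close> in two, later than all the earlier cuts. The map
  \<open>c\<close> in the proof sends an item of the new row to the old item that contains it.
\<close>

lemma realizes_split_value:
  assumes \<sigma>: "distinct \<sigma>" "length \<sigma> = Suc (length w)" and i: "i \<le> length w"
    and r: "realizes (labels w) (decorations w) \<sigma>"
    and late: "\<And>x. x \<in> set w \<Longrightarrow> fst x < B"
  shows "realizes (labels (insert_at i (B, if b then Plus else Minus) w))
      (decorations (insert_at i (B, if b then Plus else Minus) w)) (split_value (\<sigma> ! i) b \<sigma>)"
proof -
  let ?w = "insert_at i (B, if b then Plus else Minus) w"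
  let ?\<sigma> = "split_value (\<sigma> ! i) b \<sigma>"
  define c where "c k = (if k \<le> i then k else k - 1)" for k
  have i': "i < length \<sigma>" using i \<sigma> by simp
  have nth: "?\<sigma> ! k = (if c k = i then \<sigma> ! i + (if (k = i) = b then 0 else 1)
      else if \<sigma> ! c k > \<sigma> ! i then \<sigma> ! c k + 1 else \<sigma> ! c k)" if "k \<le> length \<sigma>" for k
    using split_value_nth(2)[OF \<sigma>(1) i' that] by (simp add: Let_def c_def)
  have wn: "?w ! m = (if m < i then w ! m else if m = i then (B, if b then Plus else Minus) else w ! (m - 1))" for m
    by (rule nth_insert_at[OF i])
  show ?thesis
    unfolding realizes_def
  proof (intro allI impI)
    fix k l assume kl: "k < l" "l < length ?\<sigma>"
    have l: "l \<le> length \<sigma>" using kl split_value_nth(1)[OF \<sigma>(1) i'] by simp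
    show "?\<sigma> ! k < ?\<sigma> ! l \<longleftrightarrow> earliest_plus (labels ?w) (decorations ?w) k l"
    proof (cases "c k = c l")
      case True
      then have eq: "k = i" "l = Suc i" using kl by (auto simp: c_def split: if_splits)
      have "earliest_plus (labels ?w) (decorations ?w) i (Suc i) \<longleftrightarrow> b"
        by (auto simp: earliest_plus_def wn)
      moreover have "?\<sigma> ! i < ?\<sigma> ! Suc i \<longleftrightarrow> b"
        using l eq by (simp add: nth c_def)
      ultimately show ?thesis using eq by simp
    next
      case False
      then have ckl: "c k < c l" "c l < length \<sigma>" using kl l i' by (auto simp: c_def split: if_splits)
      have ne: "\<sigma> ! c k \<noteq> \<sigma> ! c l" using ckl \<sigma>(1) by (simp add: nth_eq_iff_index_eq)
      have "?\<sigma> ! k < ?\<sigma> ! l \<longleftrightarrow> \<sigma> ! c k < \<sigma> ! c l"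
        using nth[of k] nth[of l] kl l ne False by (auto split: if_splits)
      moreover have "earliest_plus (labels ?w) (decorations ?w) k l \<longleftrightarrow>
          earliest_plus (labels w) (decorations w) (c k) (c l)"
      proof -
        define e where "e m = (if m < i then m else Suc m)" for m
        have we: "?w ! e m = w ! m" for m by (simp add: wn e_def)
        have small: "fst (w ! m) < B" if "m \<in> {c k..<c l}" for m
          using that ckl \<sigma>(2) late by (intro late nth_mem) auto
        have sub: "e m \<in> {k..<l}" if "m \<in> {c k..<c l}" for m
          using that kl by (auto simp: c_def e_def split: if_splits)
        have sur: "\<exists>m'\<in>{c k..<c l}. m = e m'" if "m \<in> {k..<l}" "m \<noteq> i" for m
          using that kl by (intro bexI[of _ "if m < i then m else m - 1"]) (auto simp: c_def e_def split: if_splits)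
        show ?thesis
        proof
          assume "earliest_plus (labels ?w) (decorations ?w) k l"
          then obtain m where m: "m \<in> {k..<l}" "snd (?w ! m) = Plus"
              "\<forall>m'\<in>{k..<l}. fst (?w ! m) \<le> fst (?w ! m')"
            unfolding earliest_plus_def by blast
          \<comment> \<open>The new cut is the latest one, so it is not the earliest of several.\<close>
          have "m \<noteq> i"
          proof
            assume "m = i"
            moreover have "c k \<in> {c k..<c l}" using ckl by simp
            ultimately show False using m(3) sub[of "c k"] we[of "c k"] small[of "c k"] wn[of i] by fastforce
          qed
          then obtain m' where m': "m' \<in> {c k..<c l}" "m = e m'" using sur m(1) by blast
          have "fst (w ! m') \<le> fst (w ! q)" if "q \<in> {c k..<c l}" for q
            using m(3) sub[OF that] m'(2) we by metis
          then show "earliest_plus (labels w) (decorations w) (c k) (c l)"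
            using m' m(2) we unfolding earliest_plus_def by metis
        next
          assume "earliest_plus (labels w) (decorations w) (c k) (c l)"
          then obtain m where m: "m \<in> {c k..<c l}" "snd (w ! m) = Plus"
              "\<forall>m'\<in>{c k..<c l}. fst (w ! m) \<le> fst (w ! m')"
            unfolding earliest_plus_def by blast
          have "fst (?w ! e m) \<le> fst (?w ! q)" if q: "q \<in> {k..<l}" for q
          proof (cases "q = i")
            case True
            then show ?thesis using we small[OF m(1)] wn[of i] by simp
          next
            case False
            then show ?thesis using sur[OF q] m(3) we by metis
          qed
          then show "earliest_plus (labels ?w) (decorations ?w) k l"
            using sub[OF m(1)] m(2) we unfolding earliest_plus_def by metis
        qed
      qed
      moreover have "\<sigma> ! c k < \<sigma> ! c l \<longleftrightarrow> earliest_plus (labels w) (decorations w) (c k) (c l)"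
        using r ckl unfolding realizes_def by blast
      ultimately show ?thesis by simp
    qed
  qed
qed

lemma split_value_permutation:
  assumes \<sigma>: "\<sigma> \<in> permutations_of_set {1..n}" and v: "v \<in> {1..n}"
  shows "split_value v b \<sigma> \<in> permutations_of_set {1..Suc n}"
proof -
  have d: "distinct \<sigma>" and s: "set \<sigma> = {1..n}" using \<sigma> by (auto simp: permutations_of_set_def)
  obtain i where i: "i < length \<sigma>" "v = \<sigma> ! i" using s v by (metis in_set_conv_nth)
  have len: "length (split_value v b \<sigma>) = Suc n"
    using split_value_nth(1)[OF d i(1)] i length_permutations_of_set_upto[OF \<sigma>] by simp
  have set: "set (split_value v b \<sigma>) = {1..Suc n}"
  proof
    show "set (split_value v b \<sigma>) \<subseteq> {1..Suc n}"
      using s v by (auto simp: split_value_def split: if_splits)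
    show "{1..Suc n} \<subseteq> set (split_value v b \<sigma>)"
    proof
      fix x assume x: "x \<in> {1..Suc n}"
      consider "x < v" | "x = v" | "x = Suc v" | "x > Suc v" by linarith
      then show "x \<in> set (split_value v b \<sigma>)"
      proof cases
        case 1
        then have "x \<in> set \<sigma>" using s v x by auto
        then show ?thesis using 1 by (force simp: split_value_def)
      next
        case 4
        then have "x - 1 \<in> set \<sigma>" using s v x by auto
        then show ?thesis using 4 by (force simp: split_value_def)
      qed (use s v in \<open>force simp: split_value_def\<close>)+
    qed
  qed
  have "distinct (split_value v b \<sigma>)"
    by (rule card_distinct) (unfold set len, simp)
  then show ?thesis using set by (simp add: permutations_of_set_def)
qed

text \<open>
  The growing permutation together with the word of its cuts: the \<open>n\<close>-th cut carries the label \<open>n\<close>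
  and leaves \<open>n + 1\<close> items.
  Since the permutation is a function of the word, its law can be found by counting words, and all
  label sequences turn out to be equally likely.
\<close>

fun rec_with_cuts :: "real \<Rightarrow> nat \<Rightarrow> (nat list \<times> (nat \<times> sign) list) pmf" where
  "rec_with_cuts p 0 = return_pmf ([1], [])"
| "rec_with_cuts p (Suc n) =
     map_pmf (\<lambda>((\<sigma>, w), (i, b)).
         (split_value (\<sigma> ! i) b \<sigma>, insert_at i (Suc n, if b then Plus else Minus) w))
       (pair_pmf (rec_with_cuts p n) (pair_pmf (pmf_of_set {..<Suc n}) (bernoulli_pmf p)))"

lemma rec_with_cuts_support:
  assumes "(\<sigma>, w) \<in> set_pmf (rec_with_cuts p n)"
  shows "\<sigma> \<in> permutations_of_set {1..Suc n}" "map fst w \<in> permutations_of_set {1..n}"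
    and "realizes (labels w) (decorations w) \<sigma>"
proof -
  have "\<sigma> \<in> permutations_of_set {1..Suc n} \<and> map fst w \<in> permutations_of_set {1..n} \<and>
      realizes (labels w) (decorations w) \<sigma>"
    using assms
  proof (induction n arbitrary: \<sigma> w)
    case 0
    then show ?case by (auto simp: permutations_of_set_def realizes_def)
  next
    case (Suc n)
    obtain \<sigma>' w' i b where sw: "(\<sigma>', w') \<in> set_pmf (rec_with_cuts p n)" "i < Suc n"
      "\<sigma> = split_value (\<sigma>' ! i) b \<sigma>'" "w = insert_at i (Suc n, if b then Plus else Minus) w'"
      using Suc.prems by (auto simp: set_pmf_of_set lessThan_empty_iff)
    note IH = Suc.IH[OF sw(1)]
    have len: "length \<sigma>' = Suc n" "length w' = n"
      using IH length_permutations_of_set_upto by (metis, metis length_map)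
    have d: "distinct \<sigma>'" using IH by (simp add: permutations_of_set_def)
    have "\<sigma>' ! i \<in> set \<sigma>'" using sw(2) len by simp
    then have "\<sigma>' ! i \<in> {1..Suc n}" using IH by (simp add: permutations_of_set_def)
    moreover have lab: "set (map fst w') = {1..n}" "distinct (map fst w')"
      using IH by (auto simp: permutations_of_set_def)
    have "mset (map fst w) = add_mset (Suc n) (mset (map fst w'))"
      by (simp add: sw(4) mset_insert_at)
    then have "set (map fst w) = insert (Suc n) (set (map fst w'))" "distinct (map fst w)"
      using lab by (metis set_mset_mset set_mset_add_mset_insert,
          metis atLeastAtMost_iff distinct.simps(2) mset.simps(2) mset_eq_imp_distinct_iff not_less_eq_eq order_refl)
    then have "map fst w \<in> permutations_of_set {1..Suc n}"
      using lab by (auto simp: permutations_of_set_def)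
    moreover have "realizes (labels w) (decorations w) \<sigma>"
      unfolding sw(3,4)
    proof (rule realizes_split_value)
      fix x assume "x \<in> set w'"
      then have "fst x \<in> set (map fst w')" by simp
      then show "fst x < Suc n" using lab by simp
    qed (use IH len d sw(2) in auto)
    ultimately show ?case using IH split_value_permutation sw(3) by blast
  qed
  then show "\<sigma> \<in> permutations_of_set {1..Suc n}" "map fst w \<in> permutations_of_set {1..n}"
    "realizes (labels w) (decorations w) \<sigma>" by auto
qed

lemma map_fst_rec_with_cuts: "map_pmf fst (rec_with_cuts p n) = rec_sep_perm p (Suc n)"
proof (induction n)
  case 0
  then show ?case by simp
next
  case (Suc n)
  have "rec_sep_perm p (Suc (Suc n)) =
      bind_pmf (rec_with_cuts p n) (\<lambda>x. bind_pmf (pmf_of_set {1..Suc n}) (\<lambda>j.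
        map_pmf (\<lambda>up. split_value j up (fst x)) (bernoulli_pmf p)))"
    by (simp add: Suc[symmetric] bind_map_pmf map_pmf_def bind_assoc_pmf bind_return_pmf)
  also have "\<dots> = bind_pmf (rec_with_cuts p n) (\<lambda>x. bind_pmf (pmf_of_set {..<Suc n}) (\<lambda>i.
        map_pmf (\<lambda>up. split_value (fst x ! i) up (fst x)) (bernoulli_pmf p)))"
  proof (rule bind_pmf_cong[OF refl])
    fix x assume "x \<in> set_pmf (rec_with_cuts p n)"
    then have "fst x \<in> permutations_of_set {1..Suc n}"
      using rec_with_cuts_support[of "fst x" "snd x"] by simp
    \<comment> \<open>A uniform value sits at a uniform position.\<close>
    from map_pmf_of_set_bij_betw[OF bij_betw_nth_permutation[OF this]]
    have "pmf_of_set {1..Suc n} = map_pmf ((!) (fst x)) (pmf_of_set {..<Suc n})"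
      by (auto simp: lessThan_empty_iff)
    then show "bind_pmf (pmf_of_set {1..Suc n}) (\<lambda>j. map_pmf (\<lambda>up. split_value j up (fst x)) (bernoulli_pmf p)) =
        bind_pmf (pmf_of_set {..<Suc n}) (\<lambda>i. map_pmf (\<lambda>up. split_value (fst x ! i) up (fst x)) (bernoulli_pmf p))"
      by (simp add: bind_map_pmf)
  qed
  also have "\<dots> = map_pmf fst (rec_with_cuts p (Suc n))"
    by (simp add: pair_pmf_def map_bind_pmf bind_return_pmf map_pmf_def bind_assoc_pmf split_beta)
  finally show ?case by simp
qed

definition sign_weight :: "real \<Rightarrow> sign \<Rightarrow> real" where
  "sign_weight p s = (case s of Plus \<Rightarrow> p | Minus \<Rightarrow> 1 - p)"

lemma append_Cons_eq_first:
  assumes eq: "xs @ x # ys = xs' @ x' # ys'"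
    and "P x" "P x'" "\<And>z. z \<in> set xs \<Longrightarrow> \<not> P z" "\<And>z. z \<in> set xs' \<Longrightarrow> \<not> P z"
  shows "xs = xs' \<and> x = x' \<and> ys = ys'"
proof -
  have "takeWhile (\<lambda>z. \<not> P z) (xs @ x # ys) = xs" using assms(2,4) by simp
  moreover have "takeWhile (\<lambda>z. \<not> P z) (xs' @ x' # ys') = xs'" using assms(3,5) by simp
  ultimately have "xs = xs'" using eq by simp
  then show ?thesis using eq by simp
qed

text \<open>
  Each word arises in exactly one way, by inserting its largest label last, and the place of the \<open>n\<close>-th
  insertion is uniform among \<open>n\<close> places.
\<close>

lemma pmf_cuts:
  assumes p: "0 \<le> p" "p \<le> 1" and w: "map fst w \<in> permutations_of_set {1..n}"
  shows "pmf (map_pmf snd (rec_with_cuts p n)) w = (\<Prod>x\<leftarrow>w. sign_weight p (snd x)) / fact n"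
  using w
proof (induction n arbitrary: w)
  case 0
  then show ?case by (simp add: permutations_of_set_def)
next
  case (Suc n)
  define C where "C = map_pmf snd (rec_with_cuts p n)"
  define I where "I = pair_pmf (pmf_of_set {..<Suc n}) (bernoulli_pmf p)"
  define f where "f = (\<lambda>(w, i, b). insert_at i (Suc n, if b then Plus else Minus) w)"
  define D where "D = {w :: (nat \<times> sign) list. map fst w \<in> permutations_of_set {1..n}}
      \<times> {..<Suc n} \<times> (UNIV :: bool set)"
  have split: "map_pmf snd (rec_with_cuts p (Suc n)) = map_pmf f (pair_pmf C I)"
    unfolding C_def I_def f_def
    by (simp add: pair_map_pmf1 map_pmf_comp split_beta)
  have DC: "set_pmf (pair_pmf C I) \<subseteq> D"
    using rec_with_cuts_support(2) by (auto simp: C_def I_def D_def lessThan_empty_iff set_pmf_of_set)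
  \<comment> \<open>The largest label marks the place of the last insertion.\<close>
  have inj: "inj_on f D"
  proof (rule inj_onI)
    fix x y
    assume xy: "x \<in> D" "y \<in> D" "f x = f y"
    obtain w i b w' i' b' where tuples: "x = (w, i, b)" "y = (w', i', b')" by (metis prod_cases3)
    have D: "(w, i, b) \<in> D" "(w', i', b') \<in> D" and eq: "f (w, i, b) = f (w', i', b')"
      using xy by (auto simp: tuples)
    have len: "length w = n" "length w' = n"
      using D length_permutations_of_set_upto by (auto simp: D_def) (metis length_map)+
    have max: "fst x \<noteq> Suc n" if "x \<in> set w \<or> x \<in> set w'" for x
    proof -
      have "fst x \<in> set (map fst w) \<or> fst x \<in> set (map fst w')" using that by auto
      then show ?thesis using D by (auto simp: D_def permutations_of_set_def)
    qed
    have "take i w @ (Suc n, if b then Plus else Minus) # drop i w =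
        take i' w' @ (Suc n, if b' then Plus else Minus) # drop i' w'"
      using eq by (simp add: f_def insert_at_def)
    then have "take i w = take i' w' \<and> (Suc n, if b then Plus else Minus) = (Suc n, if b' then Plus else Minus)
        \<and> drop i w = drop i' w'"
      using max by (intro append_Cons_eq_first[where P = "\<lambda>x. fst x = Suc n"])
        (auto dest: in_set_takeD)
    moreover from this have "i = i'"
      using D len by (auto simp: D_def dest!: arg_cong[where f = length] split: if_splits)
    ultimately show "x = y"
      unfolding tuples by (metis append_take_drop_id prod.inject sign.distinct(1))
  qed
  have "Suc n \<in> set (map fst w)" using Suc.prems by (simp add: permutations_of_set_def)
  then obtain s where "(Suc n, s) \<in> set w" by auto
  then obtain u v where w: "w = u @ (Suc n, s) # v" by (meson split_list)
  define i b where "i = length u" and "b = (s = Plus)"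
  have fx: "f (u @ v, i, b) = w"
    by (cases s) (auto simp: f_def w i_def b_def insert_at_def)
  have uv: "map fst (u @ v) \<in> permutations_of_set {1..n}"
  proof -
    have d: "distinct (map fst w)" and s: "set (map fst w) = {1..Suc n}"
      using Suc.prems by (auto simp: permutations_of_set_def)
    have "set (map fst w) = insert (Suc n) (set (map fst (u @ v)))"
      "Suc n \<notin> set (map fst (u @ v))" "distinct (map fst (u @ v))"
      using d by (auto simp: w)
    then have "set (map fst (u @ v)) = {1..Suc n} - {Suc n}" using s by blast
    then show ?thesis using \<open>distinct (map fst (u @ v))\<close>
      by (simp add: permutations_of_set_def atLeastAtMostSuc_conv)
  qed
  then have "length (u @ v) = n" using length_permutations_of_set_upto by (metis length_map)
  then have xD: "(u @ v, i, b) \<in> D" using uv by (auto simp: D_def i_def)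
  have "pmf (map_pmf f (pair_pmf C I)) (f (u @ v, i, b)) = pmf (pair_pmf C I) (u @ v, i, b)"
  proof (cases "(u @ v, i, b) \<in> set_pmf (pair_pmf C I)")
    case True
    then show ?thesis by (intro pmf_map_inj inj_on_subset[OF inj DC])
  next
    case False
    then have "f (u @ v, i, b) \<notin> f ` set_pmf (pair_pmf C I)"
      using DC xD inj by (auto dest: inj_onD)
    then show ?thesis using False by (metis pmf_eq_0_set_pmf set_map_pmf)
  qed
  also have "\<dots> = pmf C (u @ v) * (1 / Suc n * sign_weight p s)"
    using xD p by (cases s) (auto simp: I_def pmf_pair D_def sign_weight_def b_def lessThan_empty_iff)
  also have "pmf C (u @ v) = (\<Prod>x\<leftarrow>u @ v. sign_weight p (snd x)) / fact n"
    using Suc.IH[OF uv] by (simp add: C_def)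
  finally show ?case unfolding split fx by (simp add: w field_simps)
qed

lemma prod_sign_weight_step_sign:
  assumes "\<pi> \<in> permutations_of_set {1..n}"
  shows "(\<Prod>i<n - 1. sign_weight p (step_sign \<pi> i)) = (1 - p) ^ des \<pi> * p ^ (n - 1 - des \<pi>)"
proof -
  let ?M = "{i. i < n - 1 \<and> step_sign \<pi> i = Minus}"
  have cd: "card ({..<n - 1} - ?M) = n - 1 - card ?M"
    by (subst card_Diff_subset) auto
  have "(\<Prod>i<n - 1. sign_weight p (step_sign \<pi> i)) =
      (\<Prod>i\<in>?M. sign_weight p (step_sign \<pi> i)) * (\<Prod>i\<in>{..<n - 1} - ?M. sign_weight p (step_sign \<pi> i))"
    by (subst prod.union_disjoint[symmetric]) (auto intro!: prod.cong)
  also have "(\<Prod>i\<in>?M. sign_weight p (step_sign \<pi> i)) = (\<Prod>i\<in>?M. 1 - p)"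
    by (intro prod.cong) (auto simp: sign_weight_def)
  also have "(\<Prod>i\<in>{..<n - 1} - ?M. sign_weight p (step_sign \<pi> i)) = (\<Prod>i\<in>{..<n - 1} - ?M. p)"
    by (intro prod.cong) (auto simp: sign_weight_def split: sign.split)
  finally show ?thesis by (simp only: prod_constant cd card_step_sign_Minus[OF assms])
qed

text \<open>
  The permutation is \<open>\<pi>\<close> exactly for the words that combine an order in \<open>cut_orders \<pi>\<close> with the signs
  forced by \<open>\<pi>\<close>.
\<close>

lemma prob_rec_sep_perm:
  assumes p: "0 \<le> p" "p \<le> 1" and n: "n \<ge> 1" and \<pi>: "\<pi> \<in> permutations_of_set {1..n}"
  shows "measure_pmf.prob (rec_sep_perm p n) {\<pi>} =
    real (card (cut_orders \<pi>)) / fact (n - 1) * ((1 - p) ^ des \<pi> * p ^ (n - 1 - des \<pi>))"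
proof -
  let ?N = "n - 1"
  have len: "length \<pi> = n" using length_permutations_of_set_upto[OF \<pi>] .
  define deco where "deco g = zip g (map (step_sign \<pi>) [0..<?N])" for g :: "nat list"
  have lg: "length g = ?N" if "g \<in> cut_orders \<pi>" for g
    using that length_permutations_of_set_upto[of g ?N] by (simp add: cut_orders_def len)
  have fin: "finite (cut_orders \<pi>)" by (simp add: cut_orders_def)
  have fstd: "map fst (deco g) = g" if "g \<in> cut_orders \<pi>" for g
    using lg[OF that] by (simp add: deco_def)
  have *: "\<sigma> = \<pi> \<longleftrightarrow> w \<in> deco ` cut_orders \<pi>" if "(\<sigma>, w) \<in> set_pmf (rec_with_cuts p ?N)" for \<sigma> w
  proof
    note sup = rec_with_cuts_support[OF that]
    have lw: "length w = ?N" using length_permutations_of_set_upto[OF sup(2)] by simp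
    assume eq: "\<sigma> = \<pi>"
    have s: "snd (w ! k) = step_sign \<pi> k" if "k < ?N" for k
      using realizes_step_sign[OF sup(3), of k] that len eq by simp
    have "w = deco (map fst w)"
      by (rule nth_equalityI) (auto simp: deco_def lw s prod_eq_iff)
    moreover have "realizes ((!) (map fst w)) (step_sign \<pi>) \<pi> \<longleftrightarrow> realizes (labels w) (decorations w) \<pi>"
      using lw len s by (intro realizes_cong) auto
    then have "map fst w \<in> cut_orders \<pi>" using sup eq by (simp add: cut_orders_def len)
    ultimately show "w \<in> deco ` cut_orders \<pi>" by blast
  next
    note sup = rec_with_cuts_support[OF that]
    assume "w \<in> deco ` cut_orders \<pi>"
    then obtain g where g: "g \<in> cut_orders \<pi>" "w = deco g" by auto
    have "realizes (labels w) (decorations w) \<pi> \<longleftrightarrow> realizes ((!) g) (step_sign \<pi>) \<pi>"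
      using lg[OF g(1)] len by (intro realizes_cong) (auto simp: g(2) deco_def)
    then have "realizes (labels w) (decorations w) \<pi>" using g(1) by (simp add: cut_orders_def)
    moreover have "\<pi> \<in> permutations_of_set {1..Suc ?N}" using \<pi> n by simp
    ultimately show "\<sigma> = \<pi>" using realizes_unique[OF sup(1) _ sup(3)] by blast
  qed
  have "rec_sep_perm p n = map_pmf fst (rec_with_cuts p ?N)" using map_fst_rec_with_cuts[of p ?N] n by simp
  then have "measure_pmf.prob (rec_sep_perm p n) {\<pi>} =
      measure_pmf.prob (rec_with_cuts p ?N) (fst -` {\<pi>})" by simp
  also have "\<dots> = measure_pmf.prob (rec_with_cuts p ?N) (snd -` (deco ` cut_orders \<pi>))"
    using * by (intro measure_pmf.finite_measure_eq_AE) (auto simp: AE_measure_pmf_iff)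
  also have "\<dots> = measure_pmf.prob (map_pmf snd (rec_with_cuts p ?N)) (deco ` cut_orders \<pi>)"
    by simp
  also have "\<dots> = (\<Sum>w\<in>deco ` cut_orders \<pi>. pmf (map_pmf snd (rec_with_cuts p ?N)) w)"
    using fin by (intro measure_measure_pmf_finite) auto
  also have "\<dots> = (\<Sum>g\<in>cut_orders \<pi>. pmf (map_pmf snd (rec_with_cuts p ?N)) (deco g))"
    using fstd by (intro sum.reindex_cong[where l = deco]) (auto intro: inj_on_inverseI[where g = "map fst"])
  also have "\<dots> = (\<Sum>g\<in>cut_orders \<pi>. (1 - p) ^ des \<pi> * p ^ (?N - des \<pi>) / fact ?N)"
  proof (rule sum.cong[OF refl])
    fix g assume g: "g \<in> cut_orders \<pi>"
    have "map (\<lambda>x. sign_weight p (snd x)) (deco g) = map (\<lambda>i. sign_weight p (step_sign \<pi> i)) [0..<?N]"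
      using lg[OF g] by (intro nth_equalityI) (auto simp: deco_def)
    then have "(\<Prod>x\<leftarrow>deco g. sign_weight p (snd x)) = (\<Prod>i<?N. sign_weight p (step_sign \<pi> i))"
      by (simp add: prod.list_conv_set_nth interv_sum_list_conv_sum_set_nat flip: lessThan_atLeast0)
    then show "pmf (map_pmf snd (rec_with_cuts p ?N)) (deco g) = (1 - p) ^ des \<pi> * p ^ (?N - des \<pi>) / fact ?N"
      using pmf_cuts[OF p, of "deco g" ?N] fstd[OF g] g prod_sign_weight_step_sign[OF \<pi>]
      by (simp add: cut_orders_def len)
  qed
  finally show ?thesis by simp
qed

section \<open>Uniform points and measurability\<close>

lemma sets_Leb [simp, measurable_cong]: "sets Leb = sets borel"
  by (simp add: Leb_def)

lemma space_Leb [simp]: "space Leb = UNIV"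
  by (simp add: Leb_def)

interpretation Leb: prob_space Leb
  unfolding Leb_def by (rule prob_space_uniform_measure) auto

interpretation Leb_pair: pair_prob_space Leb Leb ..

interpretation Leb_prod: product_prob_space "\<lambda>_. Leb" I for I :: "nat set" ..

lemma emeasure_Leb:
  "A \<in> sets borel \<Longrightarrow> emeasure Leb A = emeasure lborel ({0..1} \<inter> A)"
  unfolding Leb_def by (subst emeasure_uniform_measure) (auto simp: divide_ennreal_def)

lemma AE_Leb: "AE x in Leb. x \<in> {0..1}"
  unfolding Leb_def by (rule AE_uniform_measureI) auto

lemma emeasure_Leb_singleton: "emeasure Leb {x} = 0"
  by (subst emeasure_Leb) (auto simp: Int_insert_right)

lemma first_sep_eqI:
  assumes "j \<ge> 1" "u j \<in> {x<..y}" "\<And>i. 1 \<le> i \<Longrightarrow> i < j \<Longrightarrow> u i \<notin> {x<..y}"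
  shows "first_sep u x y = j"
  unfolding first_sep_def using assms by (intro Least_equality) (auto simp: not_less[symmetric])

lemma first_sep:
  assumes "separated u x y"
  shows "first_sep u x y \<ge> 1" "u (first_sep u x y) \<in> {x<..y}"
    and "1 \<le> i \<Longrightarrow> i < first_sep u x y \<Longrightarrow> u i \<notin> {x<..y}"
proof -
  obtain j where "1 \<le> j \<and> u j \<in> {x<..y}" using assms by (auto simp: separated_def)
  from LeastI[where P = "\<lambda>j. 1 \<le> j \<and> u j \<in> {x<..y}", OF this]
  show "first_sep u x y \<ge> 1" "u (first_sep u x y) \<in> {x<..y}"
    by (auto simp: first_sep_def)
  show "1 \<le> i \<Longrightarrow> i < first_sep u x y \<Longrightarrow> u i \<notin> {x<..y}"
    using not_less_Least[of i "\<lambda>j. 1 \<le> j \<and> u j \<in> {x<..y}"] by (simp add: first_sep_def)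
qed

text \<open>
  Only indices \<open>j \<ge> 1\<close> carry random variables; writing them as successors turns \<^const>\<open>prec\<close> into a
  countable combination of measurable conditions.
\<close>

lemma separated_with_sign:
  "separated u x y \<and> s (first_sep u x y) = a \<longleftrightarrow>
     (\<exists>j. u (Suc j) \<in> {x<..y} \<and> s (Suc j) = a \<and> (\<forall>i<j. u (Suc i) \<notin> {x<..y}))"
proof
  assume sep: "separated u x y \<and> s (first_sep u x y) = a"
  define j where "j = first_sep u x y - 1"
  have j: "first_sep u x y = Suc j" using first_sep(1)[of u x y] sep by (simp add: j_def)
  then have "\<forall>i<j. u (Suc i) \<notin> {x<..y}" using first_sep(3)[of u x y] sep by simp
  then show "\<exists>j. u (Suc j) \<in> {x<..y} \<and> s (Suc j) = a \<and> (\<forall>i<j. u (Suc i) \<notin> {x<..y})"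
    using first_sep(2)[of u x y] sep j by metis
next
  assume "\<exists>j. u (Suc j) \<in> {x<..y} \<and> s (Suc j) = a \<and> (\<forall>i<j. u (Suc i) \<notin> {x<..y})"
  then obtain j where j: "u (Suc j) \<in> {x<..y}" "s (Suc j) = a" "\<And>i. i < j \<Longrightarrow> u (Suc i) \<notin> {x<..y}"
    by blast
  have "first_sep u x y = Suc j"
  proof (rule first_sep_eqI)
    fix i assume "1 \<le> i" "i < Suc j"
    then show "u i \<notin> {x<..y}" using j(3)[of "i - 1"] by simp
  qed (use j in auto)
  then show "separated u x y \<and> s (first_sep u x y) = a" using j by (auto simp: separated_def)
qed

lemma prec_iff_first_point:
  "prec u s x y \<longleftrightarrow>
     (x < y \<and> (\<exists>j. u (Suc j) \<in> {x<..y} \<and> s (Suc j) = Plus \<and> (\<forall>i<j. u (Suc i) \<notin> {x<..y}))) \<or>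
     (y < x \<and> (\<exists>j. u (Suc j) \<in> {y<..x} \<and> s (Suc j) = Minus \<and> (\<forall>i<j. u (Suc i) \<notin> {y<..x})))"
  unfolding prec_def by (simp only: separated_with_sign[where s = s])

lemma prec_measurable:
  assumes U: "\<And>j. j \<ge> 1 \<Longrightarrow> U j \<in> borel_measurable M"
    and S: "\<And>j. j \<ge> 1 \<Longrightarrow> S j \<in> M \<rightarrow>\<^sub>M count_space UNIV"
    and [measurable]: "h \<in> N \<rightarrow>\<^sub>M M" "f \<in> borel_measurable N" "g \<in> borel_measurable N"
  shows "Measurable.pred N (\<lambda>z. prec (\<lambda>j. U j (h z)) (\<lambda>j. S j (h z)) (f z) (g z))"
proof -
  have [measurable]: "U (Suc j) \<in> borel_measurable M" "S (Suc j) \<in> M \<rightarrow>\<^sub>M count_space UNIV" for j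
    using U S by auto
  show ?thesis unfolding prec_iff_first_point greaterThanAtMost_iff by measurable
qed

text \<open>
  Joint measurability in the randomness and in the point, by Fubini: the height is the measure of a section.
\<close>

lemma rec_phi_measurable:
  assumes U: "\<And>j. j \<ge> 1 \<Longrightarrow> U j \<in> borel_measurable M"
    and S: "\<And>j. j \<ge> 1 \<Longrightarrow> S j \<in> M \<rightarrow>\<^sub>M count_space UNIV"
    and h[measurable]: "h \<in> N \<rightarrow>\<^sub>M M" and f[measurable]: "f \<in> borel_measurable N"
  shows "(\<lambda>z. rec_phi (\<lambda>j. U j (h z)) (\<lambda>j. S j (h z)) (f z)) \<in> borel_measurable N"
proof -
  define Q where "Q = {w \<in> space (N \<Otimes>\<^sub>M Leb).
      snd w \<in> {0..1} \<and> prec (\<lambda>j. U j (h (fst w))) (\<lambda>j. S j (h (fst w))) (snd w) (f (fst w))}"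
  have "Measurable.pred (N \<Otimes>\<^sub>M Leb)
      (\<lambda>w. prec (\<lambda>j. U j (h (fst w))) (\<lambda>j. S j (h (fst w))) (snd w) (f (fst w)))"
    by (rule prec_measurable[OF U S]) measurable
  then have "Q \<in> sets (N \<Otimes>\<^sub>M Leb)"
    unfolding Q_def by measurable
  from Leb.measurable_emeasure_Pair[OF this]
  have "(\<lambda>z. enn2real (emeasure Leb (Pair z -` Q))) \<in> borel_measurable N" by measurable
  moreover have "rec_phi (\<lambda>j. U j (h z)) (\<lambda>j. S j (h z)) (f z) = enn2real (emeasure Leb (Pair z -` Q))"
    if "z \<in> space N" for z
    using that unfolding rec_phi_def measure_def Q_def by (simp add: space_pair_measure vimage_def)
  ultimately show ?thesis by (simp cong: measurable_cong)
qed

lemma prec_measurable_points: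
  fixes f g :: "'c \<Rightarrow> real"
  assumes "f \<in> borel_measurable N" "g \<in> borel_measurable N"
  shows "Measurable.pred N (\<lambda>z. prec u s (f z) (g z))"
  using assms by (intro prec_measurable[where M = "count_space UNIV" and h = "\<lambda>_. ()"]) auto

lemma rec_phi_measurable_point: "rec_phi u s \<in> borel_measurable borel"
  using rec_phi_measurable[where M = "count_space UNIV" and h = "\<lambda>_. ()" and U = "\<lambda>j _. u j"
      and S = "\<lambda>j _. s j" and f = "\<lambda>x. x" and N = borel] by simp

lemma is_sample_measurable:
  assumes "\<And>i. i \<in> {1..k} \<Longrightarrow> X i \<in> borel_measurable N" "\<And>i. i \<in> {1..k} \<Longrightarrow> Y i \<in> borel_measurable N"
  shows "Measurable.pred N (\<lambda>z. is_sample k (\<lambda>i. (X i z, Y i z)) \<tau>)"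
proof (cases "\<tau> \<in> permutations_of_set {1..k}")
  case True
  have \<tau>: "\<tau> ! (i - 1) \<in> {1..k}" if "i \<in> {1..k}" for i
    using bij_betw_apply[OF bij_betw_nth_permutation[OF True], of "i - 1"] that by auto
  have fin: "finite {\<rho>. \<rho> permutes {1..k}}" by (rule finite_permutations) simp
  have eq: "is_sample k (\<lambda>i. (X i z, Y i z)) \<tau> \<longleftrightarrow> (\<exists>\<rho>\<in>{\<rho>. \<rho> permutes {1..k}}.
        (\<forall>i\<in>{1..k}. \<forall>j\<in>{1..k}. i < j \<longrightarrow> Y (\<rho> i) z < Y (\<rho> j) z) \<and>
        (\<forall>i\<in>{1..k}. \<forall>j\<in>{1..k}. i < j \<longrightarrow> X (\<rho> (\<tau> ! (i - 1))) z < X (\<rho> (\<tau> ! (j - 1))) z))" for z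
    using True by (simp add: is_sample_def)
  show ?thesis unfolding eq
  proof (intro pred_intros_finite pred_intros_logic fin finite_atLeastAtMost)
    fix \<rho> i j assume \<rho>: "\<rho> \<in> {\<rho>. \<rho> permutes {1..k}}" and ij: "i \<in> {1..k}" "j \<in> {1..k}"
    have r: "\<rho> m \<in> {1..k}" if "m \<in> {1..k}" for m using \<rho> that permutes_in_image by fastforce
    show "Measurable.pred N (\<lambda>z. Y (\<rho> i) z < Y (\<rho> j) z)"
      using assms(2)[OF r[OF ij(1)]] assms(2)[OF r[OF ij(2)]] by measurable
    show "Measurable.pred N (\<lambda>z. X (\<rho> (\<tau> ! (i - 1))) z < X (\<rho> (\<tau> ! (j - 1))) z)"
      using assms(1)[OF r[OF \<tau>[OF ij(1)]]] assms(1)[OF r[OF \<tau>[OF ij(2)]]] by measurable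
  qed auto
qed (simp add: is_sample_def)

lemma is_sample_cong:
  assumes "\<And>i. i \<in> {1..k} \<Longrightarrow> z i = z' i"
  shows "is_sample k z \<tau> \<longleftrightarrow> is_sample k z' \<tau>"
proof -
  have "is_sample k z' \<tau>" if smp: "is_sample k z \<tau>" and eq: "\<And>i. i \<in> {1..k} \<Longrightarrow> z i = z' i" for z z'
  proof -
    obtain \<rho> where \<rho>: "\<tau> \<in> permutations_of_set {1..k}" "\<rho> permutes {1..k}"
        "\<forall>i\<in>{1..k}. \<forall>j\<in>{1..k}. i < j \<longrightarrow> snd (z (\<rho> i)) < snd (z (\<rho> j))"
        "\<forall>i\<in>{1..k}. \<forall>j\<in>{1..k}. i < j \<longrightarrow> fst (z (\<rho> (\<tau> ! (i - 1)))) < fst (z (\<rho> (\<tau> ! (j - 1))))"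
      using smp unfolding is_sample_def by blast
    have r: "\<rho> m \<in> {1..k}" if "m \<in> {1..k}" for m using \<rho> that permutes_in_image by fastforce
    have \<tau>: "\<tau> ! (i - 1) \<in> {1..k}" if "i \<in> {1..k}" for i
      using bij_betw_apply[OF bij_betw_nth_permutation[OF \<rho>(1)], of "i - 1"] that by auto
    show ?thesis unfolding is_sample_def
      using \<rho>(1,2)
    proof (intro conjI exI[of _ \<rho>] ballI impI)
      fix i j assume ij: "i \<in> {1..k}" "j \<in> {1..k}" "i < j"
      show "snd (z' (\<rho> i)) < snd (z' (\<rho> j))"
        using \<rho>(3)[rule_format, OF ij] eq[OF r[OF ij(1)]] eq[OF r[OF ij(2)]] by simp
      show "fst (z' (\<rho> (\<tau> ! (i - 1)))) < fst (z' (\<rho> (\<tau> ! (j - 1))))"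
        using \<rho>(4)[rule_format, OF ij] eq[OF r[OF \<tau>[OF ij(1)]]] eq[OF r[OF \<tau>[OF ij(2)]]] by simp
    qed
  qed
  from this[of z z'] this[of z' z] assms show ?thesis by auto
qed

text \<open>
  A point of the permuton is the image of a uniform \<open>x\<close>, so independent points of the permuton are images of
  independent uniform ones.
\<close>

lemma dens_rec_sep_permuton_eq:
  "dens \<pi> (rec_sep_permuton u s) =
     measure (PiM {1..length \<pi>} (\<lambda>_. Leb))
       {x \<in> space (PiM {1..length \<pi>} (\<lambda>_. Leb)).
          is_sample (length \<pi>) (\<lambda>i. (x i, rec_phi u s (x i))) \<pi>}"
proof -
  let ?I = "{1..length \<pi>}" and ?f = "\<lambda>x. (x, rec_phi u s x)"
  have f[measurable]: "?f \<in> Leb \<rightarrow>\<^sub>M borel"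
    using rec_phi_measurable_point[of u s] by measurable
  have pf: "prob_space (rec_sep_permuton u s)"
    unfolding rec_sep_permuton_def by (rule Leb.prob_space_distr[OF f])
  have "distr (PiM ?I (\<lambda>_. Leb)) (PiM ?I (\<lambda>_. rec_sep_permuton u s)) (compose ?I ?f) =
      PiM ?I (\<lambda>i. distr Leb (rec_sep_permuton u s) ?f)"
    using Leb.prob_space_axioms pf f
    by (intro distr_PiM_finite_prob_space') (auto simp: rec_sep_permuton_def)
  also have "distr Leb (rec_sep_permuton u s) ?f = rec_sep_permuton u s"
    unfolding rec_sep_permuton_def by (rule distr_cong) auto
  finally have eq: "PiM ?I (\<lambda>i. rec_sep_permuton u s) =
      distr (PiM ?I (\<lambda>_. Leb)) (PiM ?I (\<lambda>_. rec_sep_permuton u s)) (compose ?I ?f)" ..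
  have c[measurable]: "compose ?I ?f \<in> PiM ?I (\<lambda>_. Leb) \<rightarrow>\<^sub>M PiM ?I (\<lambda>_. rec_sep_permuton u s)"
    unfolding compose_def using f by (intro measurable_restrict) (auto simp: rec_sep_permuton_def)
  let ?P = "PiM ?I (\<lambda>i. rec_sep_permuton u s)"
  have "Measurable.pred ?P (\<lambda>z. is_sample (length \<pi>) (\<lambda>i. (fst (z i), snd (z i))) \<pi>)"
  proof (rule is_sample_measurable)
    fix i assume "i \<in> ?I"
    then have "(\<lambda>z. z i) \<in> ?P \<rightarrow>\<^sub>M (borel :: (real \<times> real) measure)"
      using measurable_component_singleton[of i ?I "\<lambda>_. rec_sep_permuton u s"]
      by (simp add: rec_sep_permuton_def)
    then have [measurable]: "(\<lambda>z. z i) \<in> ?P \<rightarrow>\<^sub>M (borel :: real measure) \<Otimes>\<^sub>M (borel :: real measure)"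
      by (simp add: borel_prod)
    show "(\<lambda>z. fst (z i)) \<in> borel_measurable ?P" "(\<lambda>z. snd (z i)) \<in> borel_measurable ?P"
      by measurable
  qed
  then have m: "{z \<in> space ?P. is_sample (length \<pi>) z \<pi>} \<in> sets ?P" by simp
  have "dens \<pi> (rec_sep_permuton u s) = measure ?P {z \<in> space ?P. is_sample (length \<pi>) z \<pi>}"
    by (simp add: dens_def Let_def)
  also have "\<dots> = measure (PiM ?I (\<lambda>_. Leb))
      (compose ?I ?f -` {z \<in> space ?P. is_sample (length \<pi>) z \<pi>} \<inter> space (PiM ?I (\<lambda>_. Leb)))"
    by (subst eq, subst measure_distr[OF c m]) simp
  also have "compose ?I ?f -` {z \<in> space ?P. is_sample (length \<pi>) z \<pi>} \<inter> space (PiM ?I (\<lambda>_. Leb)) =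
      {x \<in> space (PiM ?I (\<lambda>_. Leb)). is_sample (length \<pi>) (\<lambda>i. ?f (x i)) \<pi>}"
  proof -
    have "is_sample (length \<pi>) (compose ?I ?f x) \<pi> \<longleftrightarrow> is_sample (length \<pi>) (\<lambda>i. ?f (x i)) \<pi>" for x
      by (rule is_sample_cong) (simp add: compose_def)
    then show ?thesis using measurable_space[OF c] by auto
  qed
  finally show ?thesis .
qed

section \<open>The random order and its level sets\<close>

text \<open>
  Almost every sequence of uniform points is dense; on such sequences \<^const>\<open>prec\<close> is a total order
  of the unit interval.
\<close>

definition separates_points :: "(nat \<Rightarrow> real) \<Rightarrow> bool" where
  "separates_points u \<longleftrightarrow> (\<forall>x y. 0 \<le> x \<longrightarrow> x < y \<longrightarrow> y \<le> 1 \<longrightarrow> separated u x y)"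

lemma first_sep_between:
  assumes "separated u x z" "x \<le> y" "y \<le> z"
  shows "first_sep u x z = first_sep u x y \<or> first_sep u x z = first_sep u y z"
proof -
  let ?j = "first_sep u x z"
  note j = first_sep[OF assms(1)]
  have "u ?j \<in> {x<..y} \<or> u ?j \<in> {y<..z}" using j(2) by auto
  then show ?thesis
  proof
    assume "u ?j \<in> {x<..y}"
    then have "first_sep u x y = ?j" using j assms by (intro first_sep_eqI) force+
    then show ?thesis by simp
  next
    assume "u ?j \<in> {y<..z}"
    then have "first_sep u y z = ?j" using j assms by (intro first_sep_eqI) force+
    then show ?thesis by simp
  qed
qed

lemma
  assumes u: "separates_points u" and x: "x \<in> {0..1}" and y: "y \<in> {0..1}"
  shows prec_iff: "prec u s x y \<longleftrightarrow>
      (x < y \<and> s (first_sep u x y) = Plus) \<or> (y < x \<and> s (first_sep u y x) = Minus)"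
    and prec_asym: "prec u s x y \<Longrightarrow> \<not> prec u s y x"
    and prec_total: "x \<noteq> y \<Longrightarrow> prec u s x y \<or> prec u s y x"
proof -
  have *: "prec u s x y \<longleftrightarrow>
      (x < y \<and> s (first_sep u x y) = Plus) \<or> (y < x \<and> s (first_sep u y x) = Minus)"
    if "x \<in> {0..1}" "y \<in> {0..1}" for x y
    using u that by (auto simp: prec_def separates_points_def)
  show "prec u s x y \<longleftrightarrow>
      (x < y \<and> s (first_sep u x y) = Plus) \<or> (y < x \<and> s (first_sep u y x) = Minus)"
    using *[OF x y] .
  show "prec u s x y \<Longrightarrow> \<not> prec u s y x" using *[OF x y] *[OF y x] by auto
  show "x \<noteq> y \<Longrightarrow> prec u s x y \<or> prec u s y x"
    using *[OF x y] *[OF y x] sign.exhaust by (metis linorder_neqE)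
qed

text \<open>
  Let \<open>a < b < c\<close> be the three points. By \<open>first_sep_between\<close> the pair \<open>a, c\<close> is first separated where \<open>a, b\<close>
  or \<open>b, c\<close> is, so a sign that these two pairs share is also the sign of \<open>a, c\<close>. This rules out a cycle.
\<close>

lemma prec_trans:
  assumes u: "separates_points u" and I: "x \<in> {0..1}" "y \<in> {0..1}" "z \<in> {0..1}"
    and xy: "prec u s x y" and yz: "prec u s y z"
  shows "prec u s x z"
proof -
  have bet: "first_sep u a c = first_sep u a b \<or> first_sep u a c = first_sep u b c"
    if "a < b" "b < c" "a \<in> {0..1}" "c \<in> {0..1}" for a b c
    using u that by (intro first_sep_between) (auto simp: separates_points_def)
  have ne: "x \<noteq> z" using prec_asym[OF u I(1,2) xy] yz by auto
  have s: "s j = Plus \<longleftrightarrow> s j \<noteq> Minus" for j by (cases "s j") auto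
  note iff = prec_iff[OF u]
  show ?thesis
    using xy yz ne bet[of x y z] bet[of x z y] bet[of y x z] bet[of y z x] bet[of z x y] bet[of z y x] I
    unfolding iff[OF I(1,2)] iff[OF I(2,3)] iff[OF I(1,3)]
    by (smt (verit) s)
qed

text \<open>
  A total order on a set \<open>A\<close> puts half of the pairs of points in order, so if every point has the
  same mass \<open>d\<close> of predecessors, then \<open>d\<close> is half the mass of \<open>A\<close>.
\<close>

lemma constant_rank:
  fixes R :: "real \<Rightarrow> real \<Rightarrow> bool"
  assumes R[measurable]: "Measurable.pred (borel \<Otimes>\<^sub>M borel) (\<lambda>(x, y). R x y)" and A[measurable]: "A \<in> sets borel"
    and asym: "\<And>x y. x \<in> A \<Longrightarrow> y \<in> A \<Longrightarrow> R x y \<Longrightarrow> \<not> R y x"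
    and total: "\<And>x y. x \<in> A \<Longrightarrow> y \<in> A \<Longrightarrow> x \<noteq> y \<Longrightarrow> R x y \<or> R y x"
    and rank: "\<And>x. x \<in> A \<Longrightarrow> measure Leb {y \<in> A. R y x} = d"
    and pos: "measure Leb A > 0"
  shows "d = measure Leb A / 2"
proof -
  let ?P = "Leb \<Otimes>\<^sub>M Leb"
  let ?E = "{(x, y). x \<in> A \<and> y \<in> A \<and> R y x}" and ?F = "{(x, y). x \<in> A \<and> y \<in> A \<and> R x y}"
  have R'[measurable]: "Measurable.pred (borel \<Otimes>\<^sub>M borel) (\<lambda>(x, y). R y x)"
    using measurable_compose[OF measurable_pair_swap' R] by (simp add: split_beta')
  have E: "?E \<in> sets ?P" and F: "?F \<in> sets ?P"
  proof -
    have "{w \<in> space (borel \<Otimes>\<^sub>M borel). fst w \<in> A \<and> snd w \<in> A \<and> (\<lambda>(x, y). R y x) w} \<in> sets (borel \<Otimes>\<^sub>M borel)"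
      by measurable
    then show "?E \<in> sets ?P" by (simp add: split_beta' space_pair_measure cong: sets_pair_measure_cong)
    have "{w \<in> space (borel \<Otimes>\<^sub>M borel). fst w \<in> A \<and> snd w \<in> A \<and> (\<lambda>(x, y). R x y) w} \<in> sets (borel \<Otimes>\<^sub>M borel)"
      by measurable
    then show "?F \<in> sets ?P" by (simp add: split_beta' space_pair_measure cong: sets_pair_measure_cong)
  qed
  have mE: "measure ?P ?E = measure Leb A * d"
  proof -
    have "emeasure ?P ?E = (\<integral>\<^sup>+ x. emeasure Leb (Pair x -` ?E) \<partial>Leb)"
      by (rule Leb.emeasure_pair_measure_alt[OF E])
    also have "\<dots> = (\<integral>\<^sup>+ x. ennreal d * indicator A x \<partial>Leb)"
      using rank by (intro nn_integral_cong) (auto simp: vimage_def indicator_def Leb.emeasure_eq_measure)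
    also have "\<dots> = ennreal d * emeasure Leb A" by (rule nn_integral_cmult_indicator) simp
    finally have "ennreal (measure ?P ?E) = ennreal d * ennreal (measure Leb A)"
      by (simp add: Leb_pair.P.emeasure_eq_measure Leb.emeasure_eq_measure)
    moreover obtain x where "x \<in> A" using pos by (metis measure_empty less_irrefl ex_in_conv)
    then have "d \<ge> 0" using rank by (metis measure_nonneg)
    ultimately show ?thesis by (simp flip: ennreal_mult add: mult.commute)
  qed
  have mF: "measure ?P ?F = measure ?P ?E"
  proof -
    have "measure ?P ?F = measure (distr ?P ?P (\<lambda>(x, y). (y, x))) ?F"
      by (subst Leb_pair.distr_pair_swap[symmetric]) simp
    also have "\<dots> = measure ?P ((\<lambda>(x, y). (y, x)) -` ?F \<inter> space ?P)"
      by (rule measure_distr[OF measurable_pair_swap' F])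
    also have "(\<lambda>(x, y). (y, x)) -` ?F \<inter> space ?P = ?E" by (auto simp: space_pair_measure)
    finally show ?thesis .
  qed
  have AA: "measure ?P (A \<times> A) = measure Leb A * measure Leb A"
    by (simp add: measure_def Leb.emeasure_pair_measure_Times enn2real_mult)
  let ?D = "{(x, y). x = (y :: real)}"
  have D: "?D \<in> sets ?P"
  proof -
    have "{w \<in> space (borel \<Otimes>\<^sub>M borel). fst w = (snd w :: real)} \<in> sets (borel \<Otimes>\<^sub>M borel)" by measurable
    then show ?thesis by (simp add: split_beta' space_pair_measure cong: sets_pair_measure_cong)
  qed
  have "emeasure ?P ?D = (\<integral>\<^sup>+ x. emeasure Leb (Pair x -` ?D) \<partial>Leb)"
    by (rule Leb.emeasure_pair_measure_alt[OF D])
  also have "\<dots> = 0" by (simp add: vimage_def emeasure_Leb_singleton)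
  finally have D0: "measure ?P ?D = 0" by (simp add: measure_def)
  have "measure ?P (A \<times> A) = measure ?P (?E \<union> ?F)"
  proof (rule Leb_pair.P.finite_measure_eq_AE)
    have "?D \<in> null_sets ?P"
      using D0 D by (simp add: null_sets_def Leb_pair.P.emeasure_eq_measure)
    then have "AE w in ?P. w \<notin> ?D" by (rule AE_not_in)
    then show "AE w in ?P. (w \<in> A \<times> A) = (w \<in> ?E \<union> ?F)"
      by eventually_elim (use total in auto)
  qed (use E F in auto)
  also have "\<dots> = measure ?P ?E + measure ?P ?F"
    using E F asym by (intro Leb_pair.P.finite_measure_Union) auto
  finally have "measure Leb A * measure Leb A = 2 * (measure Leb A * d)"
    using AA mE mF by simp
  then show ?thesis using pos by (simp add: field_simps)
qed

text \<open>
  Suppose a level set \<open>A\<close> of the rank function had positive mass. Two points of \<open>A\<close> have the same rank, so no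
  mass of \<open>A\<close> lies between them. Hence all points of \<open>A\<close> have the same mass \<open>d\<close> of predecessors within \<open>A\<close>, and
  \<open>d\<close> is half the mass of \<open>A\<close>. The predecessors of a point within \<open>A\<close> form a set of mass \<open>d\<close> in which again
  every point has predecessors of mass \<open>d\<close>, so \<open>d = d / 2\<close>, a contradiction.
\<close>

lemma level_set_null:
  fixes R :: "real \<Rightarrow> real \<Rightarrow> bool"
  assumes R[measurable]: "Measurable.pred (borel \<Otimes>\<^sub>M borel) (\<lambda>(x, y). R x y)" and I[measurable]: "I \<in> sets borel"
    and asym: "\<And>x y. x \<in> I \<Longrightarrow> y \<in> I \<Longrightarrow> R x y \<Longrightarrow> \<not> R y x"
    and total: "\<And>x y. x \<in> I \<Longrightarrow> y \<in> I \<Longrightarrow> x \<noteq> y \<Longrightarrow> R x y \<or> R y x"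
    and trans: "\<And>x y z. x \<in> I \<Longrightarrow> y \<in> I \<Longrightarrow> z \<in> I \<Longrightarrow> R x y \<Longrightarrow> R y z \<Longrightarrow> R x z"
    and A[measurable]: "{x \<in> I. measure Leb {y \<in> I. R y x} = c} \<in> sets borel"
  shows "measure Leb {x \<in> I. measure Leb {y \<in> I. R y x} = c} = 0"
proof (rule ccontr)
  let ?A = "{x \<in> I. measure Leb {y \<in> I. R y x} = c}"
  assume "measure Leb ?A \<noteq> 0"
  then have pos: "measure Leb ?A > 0" by (simp add: zero_less_measure_iff)
  have below[measurable]: "{y \<in> B. R y x} \<in> sets borel" if [measurable]: "B \<in> sets borel" for B x
  proof -
    have [measurable]: "Measurable.pred borel (\<lambda>y. R y x)"
      using measurable_compose[OF measurable_Pair2' R, of x] by simp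
    have "{y \<in> space borel. y \<in> B \<and> R y x} \<in> sets borel" by measurable
    then show ?thesis by simp
  qed
  have mono: "measure Leb {y \<in> ?A. R y x} = measure Leb {y \<in> ?A. R y x'}"
    if x: "x \<in> ?A" "x' \<in> ?A" "R x x'" for x x'
  proof -
    have sub: "{y \<in> B. R y x} \<subseteq> {y \<in> B. R y x'}" if "B \<subseteq> I" for B
      using x trans that by blast
    have "measure Leb ({y \<in> ?A. R y x'} - {y \<in> ?A. R y x}) \<le> measure Leb ({y \<in> I. R y x'} - {y \<in> I. R y x})"
      by (intro Leb.finite_measure_mono) auto
    also have "\<dots> = measure Leb {y \<in> I. R y x'} - measure Leb {y \<in> I. R y x}"
      using sub[of I] by (intro Leb.finite_measure_Diff) auto
    also have "\<dots> = 0" using x by simp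
    finally have "measure Leb {y \<in> ?A. R y x'} - measure Leb {y \<in> ?A. R y x} \<le> 0"
      using sub[of ?A] by (subst (asm) Leb.finite_measure_Diff) auto
    moreover have "measure Leb {y \<in> ?A. R y x} \<le> measure Leb {y \<in> ?A. R y x'}"
      using sub[of ?A] by (intro Leb.finite_measure_mono) auto
    ultimately show ?thesis by simp
  qed
  obtain x where x: "x \<in> ?A" using pos by (metis (no_types, lifting) measure_empty less_irrefl ex_in_conv)
  define d where "d = measure Leb {y \<in> ?A. R y x}"
  have const: "measure Leb {y \<in> ?A. R y x'} = d" if "x' \<in> ?A" for x'
    using mono[OF x that] mono[OF that x] total[of x x'] x that unfolding d_def by (cases "x = x'") auto
  have d: "d = measure Leb ?A / 2"
    by (rule constant_rank[OF R A _ _ const pos]) (use asym total in auto)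
  let ?B = "{y \<in> ?A. R y x}"
  have "d = measure Leb ?B / 2"
  proof (rule constant_rank[OF R below[OF A]])
    show "measure Leb ?B > 0" using d pos by (simp add: d_def)
    fix y assume y: "y \<in> ?B"
    have "{z \<in> ?B. R z y} = {z \<in> ?A. R z y}" using y x trans by blast
    then show "measure Leb {z \<in> ?B. R z y} = d" using const[of y] y by simp
  qed (use asym total in auto)
  then show False using d pos by (simp add: d_def)
qed

section \<open>Patterns of samples\<close>

definition ordered_points :: "nat \<Rightarrow> (nat \<Rightarrow> real) \<Rightarrow> bool" where
  "ordered_points n y \<longleftrightarrow> (\<forall>i<n. y i \<in> {0..1}) \<and> (\<forall>i j. i < j \<longrightarrow> j < n \<longrightarrow> y i < y j)"

definition prec_pattern :: "(nat \<Rightarrow> real) \<Rightarrow> (nat \<Rightarrow> sign) \<Rightarrow> nat list \<Rightarrow> (nat \<Rightarrow> real) \<Rightarrow> bool" where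
  "prec_pattern u s \<pi> y \<longleftrightarrow>
     (\<forall>i j. i < j \<longrightarrow> j < length \<pi> \<longrightarrow> (\<pi> ! i < \<pi> ! j \<longleftrightarrow> prec u s (y i) (y j)))"

lemma measure_level_set_rec_phi:
  assumes u: "separates_points u"
  shows "measure Leb {x \<in> {0..1}. rec_phi u s x = c} = 0"
  unfolding rec_phi_def
proof (rule level_set_null)
  show "Measurable.pred (borel \<Otimes>\<^sub>M borel) (\<lambda>(x, y). prec u s x y)"
    unfolding split_beta' by (rule prec_measurable_points) auto
  have "{x \<in> {0..1}. rec_phi u s x = c} = {0..1} \<inter> rec_phi u s -` {c}" by auto
  moreover have "rec_phi u s -` {c} \<in> sets borel"
    using measurable_sets_borel[OF rec_phi_measurable_point] by simp
  ultimately have "{x \<in> {0..1}. rec_phi u s x = c} \<in> sets borel" by simp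
  then show "{x \<in> {0..1}. measure Leb {y \<in> {0..1}. prec u s y x} = c} \<in> sets borel"
    unfolding rec_phi_def .
  fix x y z :: real
  assume I: "x \<in> {0..1}" "y \<in> {0..1}"
  show "prec u s x y \<Longrightarrow> \<not> prec u s y x" by (rule prec_asym[OF u I])
  show "x \<noteq> y \<Longrightarrow> prec u s x y \<or> prec u s y x" by (rule prec_total[OF u I])
  show "z \<in> {0..1} \<Longrightarrow> prec u s x y \<Longrightarrow> prec u s y z \<Longrightarrow> prec u s x z"
    by (rule prec_trans[OF u I])
qed auto

lemma rec_phi_mono:
  assumes u: "separates_points u" and x: "x \<in> {0..1}" "y \<in> {0..1}" and xy: "prec u s x y"
  shows "rec_phi u s x \<le> rec_phi u s y"
  unfolding rec_phi_def
proof (rule Leb.finite_measure_mono)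
  show "{z \<in> {0..1}. prec u s z x} \<subseteq> {z \<in> {0..1}. prec u s z y}"
    using prec_trans[OF u _ x(1,2) _ xy] by auto
  have "{z \<in> space borel. z \<in> {0..1} \<and> prec u s z y} \<in> sets borel"
    using prec_measurable_points[of "\<lambda>z. z" borel "\<lambda>_. y"] by measurable
  then show "{z \<in> {0..1}. prec u s z y} \<in> sets Leb" by simp
qed

text \<open>Given all other points, the \<open>i\<close>-th one avoids the null level set that contains the \<open>j\<close>-th one.\<close>

lemma AE_components_distinct:
  fixes f :: "real \<Rightarrow> real"
  assumes f[measurable]: "f \<in> borel_measurable borel"
    and null: "\<And>c. measure Leb {x \<in> {0..1}. f x = c} = 0"
    and I: "finite I" "i \<in> I" "j \<in> I" "i \<noteq> j"
  shows "AE x in PiM I (\<lambda>_. Leb). f (x i) \<noteq> f (x (j :: nat))"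
proof -
  let ?J = "I - {i}"
  have I': "I = insert i ?J" using I by auto
  have [measurable]: "(\<lambda>x. x i) \<in> borel_measurable (PiM I (\<lambda>_. Leb))"
      "(\<lambda>x. x j) \<in> borel_measurable (PiM I (\<lambda>_. Leb))"
    using measurable_component_singleton[of i I "\<lambda>_. Leb"] measurable_component_singleton[of j I "\<lambda>_. Leb"] I
    by (auto cong: measurable_cong_sets)
  let ?E = "{x \<in> space (PiM I (\<lambda>_. Leb)). f (x i) = f (x j)}"
  have E: "?E \<in> sets (PiM I (\<lambda>_. Leb))" by measurable
  have "emeasure (PiM I (\<lambda>_. Leb)) ?E = (\<integral>\<^sup>+ x. indicator ?E x \<partial>PiM I (\<lambda>_. Leb))"
    using E by simp
  also have "\<dots> = (\<integral>\<^sup>+ x. (\<integral>\<^sup>+ y. indicator ?E (x(i := y)) \<partial>Leb) \<partial>PiM ?J (\<lambda>_. Leb))"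
    using E I by (subst (1) I', subst Leb_prod.product_nn_integral_insert) (auto simp: insert_absorb)
  also have "\<dots> = (\<integral>\<^sup>+ x. 0 \<partial>PiM ?J (\<lambda>_. Leb))"
  proof (intro nn_integral_cong)
    fix x assume x: "x \<in> space (PiM ?J (\<lambda>_. Leb))"
    have m: "{y \<in> {0..1}. f y = f (x j)} \<in> sets borel"
    proof -
      have "{y \<in> space borel. y \<in> {0..1} \<and> f y = f (x j)} \<in> sets borel" by measurable
      then show ?thesis by simp
    qed
    have "(\<integral>\<^sup>+ y. indicator ?E (x(i := y)) \<partial>Leb) = (\<integral>\<^sup>+ y. indicator {y \<in> {0..1}. f y = f (x j)} y \<partial>Leb)"
    proof (rule nn_integral_cong_AE)
      show "AE y in Leb. indicator ?E (x(i := y)) = (indicator {y \<in> {0..1}. f y = f (x j)} y :: ennreal)"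
        using AE_Leb
      proof eventually_elim
        fix y :: real assume y: "y \<in> {0..1}"
        have "x(i := y) \<in> space (PiM I (\<lambda>_. Leb))"
          using x I by (auto simp: space_PiM PiE_def extensional_def)
        then show "indicator ?E (x(i := y)) = (indicator {y \<in> {0..1}. f y = f (x j)} y :: ennreal)"
          using y I by (auto simp: indicator_def)
      qed
    qed
    also have "\<dots> = emeasure Leb {y \<in> {0..1}. f y = f (x j)}" using m by simp
    also have "\<dots> = 0" using null by (simp add: Leb.emeasure_eq_measure)
    finally show "(\<integral>\<^sup>+ y. indicator ?E (x(i := y)) \<partial>Leb) = 0" .
  qed
  finally have "?E \<in> null_sets (PiM I (\<lambda>_. Leb))" using E by (simp add: null_sets_def)
  from AE_not_in[OF this] show ?thesis
    using AE_space[of "PiM I (\<lambda>_. Leb)"] by eventually_elim auto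
qed

corollary AE_pairwise_distinct:
  fixes f :: "real \<Rightarrow> real"
  assumes "f \<in> borel_measurable borel" "\<And>c. measure Leb {x \<in> {0..1}. f x = c} = 0"
    and I: "finite I"
  shows "AE x in PiM I (\<lambda>_. Leb). \<forall>i\<in>I. \<forall>j\<in>I. i \<noteq> j \<longrightarrow> f (x i) \<noteq> f (x (j :: nat))"
proof (intro AE_ball_countable' countable_finite I)
  fix i j assume "i \<in> I" "j \<in> I"
  then show "AE x in PiM I (\<lambda>_. Leb). i \<noteq> j \<longrightarrow> f (x i) \<noteq> f (x j)"
    using AE_components_distinct[OF assms] by (cases "i = j") auto
qed

text \<open>
  The permutation \<open>\<kappa>\<close> lists the sample points from left to right. Heights are monotone along
  \<^const>\<open>prec\<close>, so distinct heights are ordered exactly as the points are by \<^const>\<open>prec\<close>.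
\<close>

lemma is_sample_iff_prec_pattern:
  assumes u: "separates_points u" and \<pi>: "\<pi> \<in> permutations_of_set {1..n}"
    and x: "\<And>i. i \<in> {1..n} \<Longrightarrow> x i \<in> {0..1}"
    and ne: "\<And>i j. i \<in> {1..n} \<Longrightarrow> j \<in> {1..n} \<Longrightarrow> i \<noteq> j \<Longrightarrow> rec_phi u s (x i) \<noteq> rec_phi u s (x j)"
  shows "is_sample n (\<lambda>i. (x i, rec_phi u s (x i))) \<pi> \<longleftrightarrow>
    (\<exists>\<kappa>\<in>permutations_of_set {1..n}.
       ordered_points n (\<lambda>i. x (\<kappa> ! i)) \<and> prec_pattern u s \<pi> (\<lambda>i. x (\<kappa> ! i)))"
proof -
  let ?\<phi> = "\<lambda>i. rec_phi u s (x i)"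
  have len: "length \<pi> = n" using length_permutations_of_set_upto[OF \<pi>] .
  have \<phi>: "prec u s (x i) (x j) \<longleftrightarrow> ?\<phi> i < ?\<phi> j" if ij: "i \<in> {1..n}" "j \<in> {1..n}" "i \<noteq> j" for i j
  proof -
    have "x i \<noteq> x j" using ne[OF ij] by auto
    then have "prec u s (x i) (x j) \<or> prec u s (x j) (x i)"
      using prec_total[OF u x[OF ij(1)] x[OF ij(2)]] by simp
    then show ?thesis
      using rec_phi_mono[OF u x[OF ij(1)] x[OF ij(2)]] rec_phi_mono[OF u x[OF ij(2)] x[OF ij(1)]]
        ne[OF ij] by fastforce
  qed
  have \<pi>in: "\<pi> ! i \<in> {1..n}" if "i < n" for i
    using bij_betw_apply[OF bij_betw_nth_permutation[OF \<pi>]] that by auto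
  have \<pi>inj: "\<pi> ! i \<noteq> \<pi> ! j" if "i < n" "j < n" "i \<noteq> j" for i j
    using \<pi> that len by (auto simp: permutations_of_set_def nth_eq_iff_index_eq)
  show ?thesis
  proof
    assume "is_sample n (\<lambda>i. (x i, ?\<phi> i)) \<pi>"
    then obtain \<rho> where \<rho>: "\<rho> permutes {1..n}"
        "\<forall>i\<in>{1..n}. \<forall>j\<in>{1..n}. i < j \<longrightarrow> ?\<phi> (\<rho> i) < ?\<phi> (\<rho> j)"
        "\<forall>i\<in>{1..n}. \<forall>j\<in>{1..n}. i < j \<longrightarrow> x (\<rho> (\<pi> ! (i - 1))) < x (\<rho> (\<pi> ! (j - 1)))"
      unfolding is_sample_def fst_conv snd_conv by blast
    define \<kappa> where "\<kappa> = map \<rho> \<pi>"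
    have \<kappa>: "\<kappa> ! i = \<rho> (\<pi> ! i)" if "i < n" for i using that len by (simp add: \<kappa>_def)
    have \<rho>in: "\<rho> a \<in> {1..n}" if "a \<in> {1..n}" for a using \<rho>(1) that permutes_in_image by fastforce
    have "\<kappa> \<in> permutations_of_set {1..n}"
      using \<pi> permutes_image[OF \<rho>(1)] permutes_inj_on[OF \<rho>(1)]
      by (auto simp: \<kappa>_def permutations_of_set_def distinct_map)
    moreover have "ordered_points n (\<lambda>i. x (\<kappa> ! i))"
      unfolding ordered_points_def
    proof (intro conjI allI impI)
      fix i assume "i < n"
      then show "x (\<kappa> ! i) \<in> {0..1}" using x[OF \<rho>in[OF \<pi>in]] \<kappa> by simp
    next
      fix i j assume ij: "i < j" "j < n"
      then show "x (\<kappa> ! i) < x (\<kappa> ! j)" using \<rho>(3)[rule_format, of "Suc i" "Suc j"] \<kappa> by simp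
    qed
    moreover have "prec_pattern u s \<pi> (\<lambda>i. x (\<kappa> ! i))"
      unfolding prec_pattern_def len
    proof (intro allI impI)
      fix i j assume ij: "i < j" "j < n"
      then have i: "i < n" by simp
      note P = \<pi>in[OF i] \<pi>in[OF ij(2)]
      have ne: "\<pi> ! i \<noteq> \<pi> ! j" using \<pi>inj[of i j] ij by simp
      then have ne': "\<rho> (\<pi> ! i) \<noteq> \<rho> (\<pi> ! j)" using permutes_inj[OF \<rho>(1)] by (auto dest: injD)
      have "\<pi> ! i < \<pi> ! j \<longleftrightarrow> ?\<phi> (\<rho> (\<pi> ! i)) < ?\<phi> (\<rho> (\<pi> ! j))"
        using \<rho>(2)[rule_format, OF P] \<rho>(2)[rule_format, OF P(2,1)] ne by linarith
      also have "\<dots> \<longleftrightarrow> prec u s (x (\<rho> (\<pi> ! i))) (x (\<rho> (\<pi> ! j)))"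
        using \<phi>[OF \<rho>in[OF P(1)] \<rho>in[OF P(2)] ne'] by simp
      finally show "\<pi> ! i < \<pi> ! j \<longleftrightarrow> prec u s (x (\<kappa> ! i)) (x (\<kappa> ! j))"
        using \<kappa> i ij by simp
    qed
    ultimately show "\<exists>\<kappa>\<in>permutations_of_set {1..n}.
       ordered_points n (\<lambda>i. x (\<kappa> ! i)) \<and> prec_pattern u s \<pi> (\<lambda>i. x (\<kappa> ! i))" by blast
  next
    assume "\<exists>\<kappa>\<in>permutations_of_set {1..n}.
       ordered_points n (\<lambda>i. x (\<kappa> ! i)) \<and> prec_pattern u s \<pi> (\<lambda>i. x (\<kappa> ! i))"
    then obtain \<kappa> where \<kappa>: "\<kappa> \<in> permutations_of_set {1..n}" "ordered_points n (\<lambda>i. x (\<kappa> ! i))"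
      "prec_pattern u s \<pi> (\<lambda>i. x (\<kappa> ! i))" by blast
    note b\<pi> = bij_betw_nth_permutation[OF \<pi>] and b\<kappa> = bij_betw_nth_permutation[OF \<kappa>(1)]
    define \<rho> where "\<rho> v = (if v \<in> {1..n} then \<kappa> ! the_inv_into {..<n} ((!) \<pi>) v else v)" for v
    have \<rho>\<pi>: "\<rho> (\<pi> ! i) = \<kappa> ! i" if "i < n" for i
      using \<pi>in[OF that] that the_inv_into_f_f[OF bij_betw_imp_inj_on[OF b\<pi>], of i]
      by (simp add: \<rho>_def)
    have "bij_betw (\<lambda>v. \<kappa> ! the_inv_into {..<n} ((!) \<pi>) v) {1..n} {1..n}"
      using bij_betw_trans[OF bij_betw_the_inv_into[OF b\<pi>] b\<kappa>] by (simp add: comp_def)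
    then have "bij_betw \<rho> {1..n} {1..n}"
      by (rule bij_betw_cong[THEN iffD1, rotated]) (simp add: \<rho>_def)
    then have "\<rho> permutes {1..n}" by (rule bij_imp_permutes) (auto simp: \<rho>_def)
    moreover have "?\<phi> (\<rho> a) < ?\<phi> (\<rho> b)" if ab: "a \<in> {1..n}" "b \<in> {1..n}" "a < b" for a b
    proof -
      have "a \<in> (!) \<pi> ` {..<n}" "b \<in> (!) \<pi> ` {..<n}" using b\<pi> ab by (auto simp: bij_betw_def)
      then obtain i j where ij: "i < n" "a = \<pi> ! i" "j < n" "b = \<pi> ! j" by auto
      have K: "\<kappa> ! i \<in> {1..n}" "\<kappa> ! j \<in> {1..n}" using bij_betw_apply[OF b\<kappa>] ij by auto
      have "i \<noteq> j" using ab ij by auto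
      then have K': "\<kappa> ! i \<noteq> \<kappa> ! j" using b\<kappa> ij by (auto simp: bij_betw_def inj_on_def)
      have "?\<phi> (\<kappa> ! i) < ?\<phi> (\<kappa> ! j)"
      proof (cases "i < j")
        case True
        then have "prec u s (x (\<kappa> ! i)) (x (\<kappa> ! j))"
          using \<kappa>(3) ij ab len by (auto simp: prec_pattern_def)
        then show ?thesis using \<phi>[OF K K'] by simp
      next
        case False
        then have "j < i" using \<open>i \<noteq> j\<close> by simp
        then have "\<not> prec u s (x (\<kappa> ! j)) (x (\<kappa> ! i))"
          using \<kappa>(3)[unfolded prec_pattern_def, rule_format, of j i] ij ab len by simp
        then show ?thesis using \<phi>[OF K(2,1)] K' ne[OF K(2,1)] by force
      qed
      then show ?thesis using \<rho>\<pi> ij by simp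
    qed
    moreover have "x (\<rho> (\<pi> ! (i - 1))) < x (\<rho> (\<pi> ! (j - 1)))"
      if "i \<in> {1..n}" "j \<in> {1..n}" "i < j" for i j
    proof -
      have "i - 1 < j - 1" "j - 1 < n" using that by auto
      then show ?thesis using \<kappa>(2) \<rho>\<pi> by (simp add: ordered_points_def)
    qed
    ultimately show "is_sample n (\<lambda>i. (x i, ?\<phi> i)) \<pi>"
      unfolding is_sample_def fst_conv snd_conv using \<pi> by blast
  qed
qed

lemma measurable_some_ordering:
  assumes Q: "Measurable.pred (PiM {..<n} (\<lambda>_. Leb)) Q"
    and dep: "\<And>y. Q (restrict y {..<n}) \<longleftrightarrow> Q y"
  shows "Measurable.pred (PiM {1..n} (\<lambda>_. Leb))
      (\<lambda>x. \<exists>\<kappa>\<in>permutations_of_set {1..n}. Q (\<lambda>i. x (\<kappa> ! i)))"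
proof (rule pred_intros_finite)
  fix \<kappa> assume \<kappa>: "\<kappa> \<in> permutations_of_set {1..n}"
  have t: "(\<lambda>x. \<lambda>i\<in>{..<n}. x (\<kappa> ! i)) \<in> PiM {1..n} (\<lambda>_. Leb) \<rightarrow>\<^sub>M PiM {..<n} (\<lambda>_. Leb)"
    by (intro measurable_restrict measurable_component_singleton
        bij_betw_apply[OF bij_betw_nth_permutation[OF \<kappa>]])
  have "Q (\<lambda>i\<in>{..<n}. x (\<kappa> ! i)) \<longleftrightarrow> Q (\<lambda>i. x (\<kappa> ! i))" for x
    using dep[of "\<lambda>i. x (\<kappa> ! i)"] by (simp add: restrict_def)
  then show "Measurable.pred (PiM {1..n} (\<lambda>_. Leb)) (\<lambda>x. Q (\<lambda>i. x (\<kappa> ! i)))"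
    using measurable_compose[OF t Q] by simp
qed simp

text \<open>
  Points can be listed in increasing order in at most one way, so the events for different \<open>\<kappa>\<close> are disjoint;
  relabeling the coordinates shows that they have the same probability.
\<close>

lemma measure_some_ordering:
  assumes Q[measurable]: "Measurable.pred (PiM {..<n} (\<lambda>_. Leb)) Q"
    and dep: "\<And>y. Q (restrict y {..<n}) \<longleftrightarrow> Q y"
    and ord: "\<And>y. Q y \<Longrightarrow> ordered_points n y"
  shows "measure (PiM {1..n} (\<lambda>_. Leb))
      {x \<in> space (PiM {1..n} (\<lambda>_. Leb)). \<exists>\<kappa>\<in>permutations_of_set {1..n}. Q (\<lambda>i. x (\<kappa> ! i))} =
    fact n * measure (PiM {..<n} (\<lambda>_. Leb)) {y \<in> space (PiM {..<n} (\<lambda>_. Leb)). Q y}"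
proof -
  let ?P = "PiM {1..n} (\<lambda>_. Leb)" and ?P' = "PiM {..<n} (\<lambda>_. Leb)"
  let ?A = "\<lambda>\<kappa>. {x \<in> space ?P. Q (\<lambda>i. x (\<kappa> ! i))}"
  have meas: "?A \<kappa> \<in> sets ?P"
    and eq: "measure ?P (?A \<kappa>) = measure ?P' {y \<in> space ?P'. Q y}"
    if \<kappa>: "\<kappa> \<in> permutations_of_set {1..n}" for \<kappa>
  proof -
    let ?t = "\<lambda>x. \<lambda>i\<in>{..<n}. x (\<kappa> ! i)"
    note b = bij_betw_nth_permutation[OF \<kappa>]
    have t: "?t \<in> ?P \<rightarrow>\<^sub>M ?P'"
      by (intro measurable_restrict measurable_component_singleton bij_betw_apply[OF b])
    have "Q (?t x) \<longleftrightarrow> Q (\<lambda>i. x (\<kappa> ! i))" for x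
      using dep[of "\<lambda>i. x (\<kappa> ! i)"] by (simp add: restrict_def)
    then have A: "?A \<kappa> = ?t -` {y \<in> space ?P'. Q y} \<inter> space ?P"
      using measurable_space[OF t] by auto
    show "?A \<kappa> \<in> sets ?P" unfolding A by (rule measurable_sets[OF t]) measurable
    have "distr ?P ?P' ?t = ?P'"
      using distr_PiM_reindex[of "{1..n}" "\<lambda>_. Leb" "(!) \<kappa>" "{..<n}"] Leb.prob_space_axioms b
      by (auto simp: bij_betw_def)
    then show "measure ?P (?A \<kappa>) = measure ?P' {y \<in> space ?P'. Q y}"
      unfolding A by (subst measure_distr[OF t, symmetric]) auto
  qed
  have disj: "disjoint_family_on ?A (permutations_of_set {1..n})"
    unfolding disjoint_family_on_def
  proof (intro ballI impI, rule ccontr)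
    fix \<kappa> \<kappa>' assume k: "\<kappa> \<in> permutations_of_set {1..n}" "\<kappa>' \<in> permutations_of_set {1..n}" "\<kappa> \<noteq> \<kappa>'"
      and "?A \<kappa> \<inter> ?A \<kappa>' \<noteq> {}"
    then obtain x where x: "Q (\<lambda>i. x (\<kappa> ! i))" "Q (\<lambda>i. x (\<kappa>' ! i))" by auto
    have len: "length \<kappa> = n" "length \<kappa>' = n" using k length_permutations_of_set_upto by auto
    have sorted: "sorted_wrt (<) (map x \<kappa>)" "sorted_wrt (<) (map x \<kappa>')"
      using ord[OF x(1)] ord[OF x(2)] len by (auto simp: ordered_points_def sorted_wrt_iff_nth_less)
    have set: "set \<kappa> = {1..n}" "set \<kappa>' = {1..n}" using k by (auto simp: permutations_of_set_def)
    have "map x \<kappa> = map x \<kappa>'"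
      using sorted set by (intro strict_sorted_equal) auto
    moreover have "inj_on x {1..n}"
      using strict_sorted_iff[of "map x \<kappa>"] sorted set by (auto simp: distinct_map)
    ultimately show False using k set by (metis map_inj_on Un_absorb)
  qed
  have "measure ?P {x \<in> space ?P. \<exists>\<kappa>\<in>permutations_of_set {1..n}. Q (\<lambda>i. x (\<kappa> ! i))} =
      measure ?P (\<Union>\<kappa>\<in>permutations_of_set {1..n}. ?A \<kappa>)"
    by (rule arg_cong[where f = "measure ?P"]) auto
  also have "\<dots> = (\<Sum>\<kappa>\<in>permutations_of_set {1..n}. measure ?P (?A \<kappa>))"
    using meas disj Leb_prod.P.emeasure_finite
    by (intro measure_finite_Union) auto
  also have "\<dots> = (\<Sum>\<kappa>\<in>permutations_of_set {1..n}. measure ?P' {y \<in> space ?P'. Q y})"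
    using eq by (intro sum.cong refl)
  also have "\<dots> = fact n * measure ?P' {y \<in> space ?P'. Q y}"
    by simp
  finally show ?thesis .
qed

lemma ordered_points_restrict: "ordered_points n (restrict y {..<n}) \<longleftrightarrow> ordered_points n y"
  by (auto simp: ordered_points_def)

lemma measurable_point [measurable (raw)]:
  "i \<in> I \<Longrightarrow> (\<lambda>y. y i) \<in> borel_measurable (PiM I (\<lambda>_. Leb))"
  using measurable_component_singleton[of i I "\<lambda>_. Leb"] by (simp cong: measurable_cong_sets)

lemma measurable_ordered_points: "Measurable.pred (PiM {..<n} (\<lambda>_. Leb)) (ordered_points n)"
proof -
  have [measurable]: "Measurable.pred (PiM {..<n} (\<lambda>_. Leb)) (\<lambda>y. i < n \<longrightarrow> y i \<in> {0..1})" for i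
    by (cases "i < n") auto
  have [measurable]: "Measurable.pred (PiM {..<n} (\<lambda>_. Leb)) (\<lambda>y. i < j \<longrightarrow> j < n \<longrightarrow> y i < y j)" for i j
    by (cases "i < j \<and> j < n") auto
  show ?thesis unfolding ordered_points_def by measurable
qed

lemma AE_points:
  assumes "finite I"
  shows "AE x in PiM I (\<lambda>_. Leb). \<forall>i\<in>I. x i \<in> {0..1}"
  by (intro AE_ball_countable' AE_PiM_component AE_Leb countable_finite assms)
    (rule Leb.prob_space_axioms)

text \<open>
  Almost surely the points can be sorted, so the case of the whole event in \<open>measure_some_ordering\<close> gives the
  mass of the ordered points.
\<close>

lemma measure_ordered_points:
  "fact n * measure (PiM {..<n} (\<lambda>_. Leb)) {y \<in> space (PiM {..<n} (\<lambda>_. Leb)). ordered_points n y} = 1"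
proof -
  let ?P = "PiM {1..n} (\<lambda>_. Leb)"
  have id: "measure Leb {x \<in> {0..1}. x = c} = 0" for c
    using emeasure_Leb_singleton[of c] by (cases "c \<in> {0..1}") (auto simp: measure_def Collect_conv_if)
  have ae: "AE x in ?P. \<forall>i\<in>{1..n}. \<forall>j\<in>{1..n}. i \<noteq> j \<longrightarrow> x i \<noteq> x j"
    by (rule AE_pairwise_distinct[where f = "\<lambda>x. x", OF _ id]) auto
  have "AE x in ?P. \<exists>\<kappa>\<in>permutations_of_set {1..n}. ordered_points n (\<lambda>i. x (\<kappa> ! i))"
    using ae AE_points[OF finite_atLeastAtMost[of 1 n]]
  proof eventually_elim
    fix x :: "nat \<Rightarrow> real"
    assume ne: "\<forall>i\<in>{1..n}. \<forall>j\<in>{1..n}. i \<noteq> j \<longrightarrow> x i \<noteq> x j" and I: "\<forall>i\<in>{1..n}. x i \<in> {0..1}"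
    define \<kappa> where "\<kappa> = sort_key x [1..<Suc n]"
    have \<kappa>: "\<kappa> \<in> permutations_of_set {1..n}" by (auto simp: \<kappa>_def permutations_of_set_def)
    have len: "length \<kappa> = n" by (simp add: \<kappa>_def)
    have in1: "\<kappa> ! i \<in> {1..n}" if "i < n" for i
      using bij_betw_apply[OF bij_betw_nth_permutation[OF \<kappa>]] that by auto
    have "x (\<kappa> ! i) < x (\<kappa> ! j)" if "i < j" "j < n" for i j
    proof -
      have "sorted (map x \<kappa>)" by (simp add: \<kappa>_def)
      from sorted_nth_mono[OF this, of i j] have "x (\<kappa> ! i) \<le> x (\<kappa> ! j)" using that len by simp
      moreover have "\<kappa> ! i \<noteq> \<kappa> ! j"
        using \<kappa> that len by (auto simp: permutations_of_set_def nth_eq_iff_index_eq)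
      ultimately show ?thesis using ne in1[of i] in1[of j] that by fastforce
    qed
    then have "ordered_points n (\<lambda>i. x (\<kappa> ! i))" using I in1 by (auto simp: ordered_points_def)
    then show "\<exists>\<kappa>\<in>permutations_of_set {1..n}. ordered_points n (\<lambda>i. x (\<kappa> ! i))" using \<kappa> by blast
  qed
  then have "measure ?P {x \<in> space ?P. \<exists>\<kappa>\<in>permutations_of_set {1..n}. ordered_points n (\<lambda>i. x (\<kappa> ! i))} = 1"
    by (rule Leb_prod.P.prob_Collect_eq_1[THEN iffD2, rotated])
       (rule predE[OF measurable_some_ordering[OF measurable_ordered_points ordered_points_restrict]])
  then show ?thesis
    using measure_some_ordering[OF measurable_ordered_points ordered_points_restrict] by simp
qed

text \<open>
  Sorting the sample contributes the factor \<open>n!\<close>, and comparing heights is the same as comparing points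
  by \<^const>\<open>prec\<close> outside a null set.
\<close>

lemma dens_eq_prec_pattern:
  assumes u: "separates_points u" and \<pi>: "\<pi> \<in> permutations_of_set {1..n}"
  shows "dens \<pi> (rec_sep_permuton u s) = fact n * measure (PiM {..<n} (\<lambda>_. Leb))
      {y \<in> space (PiM {..<n} (\<lambda>_. Leb)). ordered_points n y \<and> prec_pattern u s \<pi> y}"
proof -
  let ?P = "PiM {1..n} (\<lambda>_. Leb)"
  let ?Q = "\<lambda>y. ordered_points n y \<and> prec_pattern u s \<pi> y"
  have len: "length \<pi> = n" using length_permutations_of_set_upto[OF \<pi>] .
  have "Measurable.pred (PiM {..<n} (\<lambda>_. Leb))
      (\<lambda>y. i < j \<longrightarrow> j < n \<longrightarrow> (\<pi> ! i < \<pi> ! j \<longleftrightarrow> prec u s (y i) (y j)))" for i j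
  proof (cases "i < j \<and> j < n")
    case True
    then have [measurable]: "Measurable.pred (PiM {..<n} (\<lambda>_. Leb)) (\<lambda>y. prec u s (y i) (y j))"
      by (intro prec_measurable_points measurable_point) auto
    show ?thesis by measurable
  qed auto
  then have [measurable]: "Measurable.pred (PiM {..<n} (\<lambda>_. Leb)) (prec_pattern u s \<pi>)"
    unfolding prec_pattern_def len by measurable
  note measurable_ordered_points[measurable]
  have Q: "Measurable.pred (PiM {..<n} (\<lambda>_. Leb)) ?Q" by measurable
  have dep: "?Q (restrict y {..<n}) \<longleftrightarrow> ?Q y" for y
    by (auto simp: ordered_points_restrict prec_pattern_def len)
  let ?S = "{x \<in> space ?P. is_sample n (\<lambda>i. (x i, rec_phi u s (x i))) \<pi>}"
  let ?K = "{x \<in> space ?P. \<exists>\<kappa>\<in>permutations_of_set {1..n}. ?Q (\<lambda>i. x (\<kappa> ! i))}"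
  have "AE x in ?P. \<forall>i\<in>{1..n}. \<forall>j\<in>{1..n}. i \<noteq> j \<longrightarrow> rec_phi u s (x i) \<noteq> rec_phi u s (x j)"
    by (rule AE_pairwise_distinct[OF rec_phi_measurable_point measure_level_set_rec_phi[OF u]]) auto
  then have ae: "AE x in ?P. x \<in> ?S \<longleftrightarrow> x \<in> ?K"
    using AE_points[OF finite_atLeastAtMost[of 1 n]]
  proof eventually_elim
    fix x assume "\<forall>i\<in>{1..n}. \<forall>j\<in>{1..n}. i \<noteq> j \<longrightarrow> rec_phi u s (x i) \<noteq> rec_phi u s (x j)"
      "\<forall>i\<in>{1..n}. x i \<in> {0..1}"
    then show "x \<in> ?S \<longleftrightarrow> x \<in> ?K" using is_sample_iff_prec_pattern[OF u \<pi>, of x s] by auto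
  qed
  have S: "?S \<in> sets ?P"
  proof -
    have "Measurable.pred ?P (\<lambda>x. is_sample n (\<lambda>i. (x i, rec_phi u s (x i))) \<pi>)"
      by (intro is_sample_measurable measurable_point
          measurable_compose[OF measurable_point rec_phi_measurable_point])
    then show ?thesis by simp
  qed
  have K: "?K \<in> sets ?P" using measurable_some_ordering[OF Q dep] by simp
  have "dens \<pi> (rec_sep_permuton u s) = measure ?P ?S" by (simp add: dens_rec_sep_permuton_eq len)
  also have "\<dots> = measure ?P ?K" by (rule Leb_prod.P.finite_measure_eq_AE[OF ae S K])
  also have "\<dots> = fact n * measure (PiM {..<n} (\<lambda>_. Leb)) {y \<in> space (PiM {..<n} (\<lambda>_. Leb)). ?Q y}"
    by (rule measure_some_ordering[OF Q dep]) auto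
  finally show ?thesis .
qed

section \<open>First hitting times of the gaps between ordered points\<close>

abbreviation gap :: "(nat \<Rightarrow> real) \<Rightarrow> nat \<Rightarrow> real set" where
  "gap y l \<equiv> {y l<..y (Suc l)}"

definition cut_times :: "nat \<Rightarrow> (nat \<Rightarrow> real) \<Rightarrow> (nat \<Rightarrow> real) \<Rightarrow> (nat \<Rightarrow> nat) \<Rightarrow> bool" where
  "cut_times N u y t \<longleftrightarrow>
     (\<forall>l<N. 1 \<le> t l \<and> u (t l) \<in> gap y l \<and> (\<forall>j. 1 \<le> j \<longrightarrow> j < t l \<longrightarrow> u j \<notin> gap y l))"

lemma cut_times_cong:
  assumes "\<And>j. 1 \<le> j \<Longrightarrow> u j = u' j"
  shows "cut_times N u y t \<longleftrightarrow> cut_times N u' y t"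
proof -
  have "1 \<le> t l \<and> u (t l) \<in> gap y l \<and> (\<forall>j. 1 \<le> j \<longrightarrow> j < t l \<longrightarrow> u j \<notin> gap y l) \<longleftrightarrow>
      1 \<le> t l \<and> u' (t l) \<in> gap y l \<and> (\<forall>j. 1 \<le> j \<longrightarrow> j < t l \<longrightarrow> u' j \<notin> gap y l)" for l
    using assms by (cases "1 \<le> t l") simp_all
  then show ?thesis unfolding cut_times_def by simp
qed

text \<open>
  The functions are extensional, so that the cutting times of a row of gaps form a single element.
\<close>

definition injective_times :: "nat \<Rightarrow> (nat \<Rightarrow> nat) set" where
  "injective_times N = {t \<in> {..<N} \<rightarrow>\<^sub>E {1..}. inj_on t {..<N}}"

lemma countable_injective_times: "countable (injective_times N)"
  unfolding injective_times_def by (rule countable_subset[OF _ countable_PiE[of "{..<N}" "\<lambda>_. {1..}"]]) auto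

lemma ordered_points_mono:
  "ordered_points n y \<Longrightarrow> i \<le> j \<Longrightarrow> j < n \<Longrightarrow> y i \<le> y j"
  by (cases "i = j") (auto simp: ordered_points_def less_imp_le)

lemma gaps_disjoint:
  assumes "ordered_points (Suc N) y" "k < N" "l < N" "v \<in> gap y k" "v \<in> gap y l"
  shows "k = l"
proof (rule ccontr)
  assume "k \<noteq> l"
  then consider "Suc k \<le> l" | "Suc l \<le> k" by linarith
  then show False
  proof cases
    case 1
    then have "y (Suc k) \<le> y l" using assms by (intro ordered_points_mono[OF assms(1)]) auto
    then show False using assms by auto
  next
    case 2
    then have "y (Suc l) \<le> y k" using assms by (intro ordered_points_mono[OF assms(1)]) auto
    then show False using assms by auto
  qed
qed

lemma interval_gap:
  fixes y :: "nat \<Rightarrow> real"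
  assumes "i < j" "v \<in> {y i<..y j}"
  obtains l where "i \<le> l" "l < j" "v \<in> gap y l"
proof -
  have "\<exists>l. i \<le> l \<and> l < j \<and> v \<in> gap y l"
    using assms
  proof (induction j)
    case (Suc j)
    show ?case
    proof (cases "v \<le> y j")
      case True
      then have "i < j" using Suc.prems by (cases "i = j") auto
      then show ?thesis using Suc True by (metis greaterThanAtMost_iff less_SucI)
    next
      case False
      then show ?thesis using Suc.prems by (intro exI[of _ j]) auto
    qed
  qed simp
  then show ?thesis using that by blast
qed

lemma cut_times_exists:
  assumes u: "separates_points u" and y: "ordered_points (Suc N) y"
  shows "\<exists>t\<in>injective_times N. cut_times N u y t"
proof -
  define t where "t = (\<lambda>l\<in>{..<N}. first_sep u (y l) (y (Suc l)))"
  have sep: "separated u (y l) (y (Suc l))" if "l < N" for l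
    using u y that by (auto simp: separates_points_def ordered_points_def)
  have ct: "cut_times N u y t"
    unfolding cut_times_def
  proof (intro allI impI conjI)
    fix l assume l: "l < N"
    show "1 \<le> t l" "u (t l) \<in> gap y l" using first_sep(1,2)[OF sep[OF l]] l by (auto simp: t_def)
    fix j assume "1 \<le> j" "j < t l"
    then show "u j \<notin> gap y l" using first_sep(3)[OF sep[OF l]] l by (simp add: t_def)
  qed
  have "inj_on t {..<N}"
  proof (rule inj_onI)
    fix k l assume kl: "k \<in> {..<N}" "l \<in> {..<N}" "t k = t l"
    then have "u (t k) \<in> gap y k" "u (t k) \<in> gap y l" using ct by (auto simp: cut_times_def)
    then show "k = l" using gaps_disjoint[OF y] kl by auto
  qed
  moreover have "t \<in> {..<N} \<rightarrow>\<^sub>E {1..}" using ct by (auto simp: t_def cut_times_def)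
  ultimately show ?thesis using ct by (auto simp: injective_times_def)
qed

lemma cut_times_unique:
  assumes "t \<in> injective_times N" "t' \<in> injective_times N" "cut_times N u y t" "cut_times N u y t'"
  shows "t = t'"
proof
  fix l
  show "t l = t' l"
  proof (cases "l < N")
    case True
    have "\<not> \<tau> l < \<tau>' l" if "cut_times N u y \<tau>" "cut_times N u y \<tau>'" for \<tau> \<tau>'
      using that True unfolding cut_times_def by blast
    from this[OF assms(3,4)] this[OF assms(4,3)] show ?thesis by simp
  next
    case False
    then show ?thesis using assms(1,2) by (simp add: injective_times_def PiE_def extensional_def)
  qed
qed

text \<open>
  A point \<open>u j\<close> falls between two sample points if it falls into one of the gaps between them, so the first
  such index is the smallest hitting time of these gaps.
\<close>

lemma prec_iff_earliest_plus:
  assumes y: "ordered_points (Suc N) y" and t: "t \<in> injective_times N" "cut_times N u y t"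
    and ij: "i < j" "j \<le> N"
  shows "prec u s (y i) (y j) \<longleftrightarrow> earliest_plus t (\<lambda>l. s (t l)) i j"
proof -
  have yij: "y i < y j" using y ij by (simp add: ordered_points_def)
  obtain k where k: "k \<in> {i..<j}" "\<And>l. l \<in> {i..<j} \<Longrightarrow> t k \<le> t l"
    using ex_min_if_finite[of "t ` {i..<j}"] ij by (auto simp: not_less image_iff)
  have kN: "k < N" using k ij by auto
  have "gap y k \<subseteq> {y i<..y j}"
    using ordered_points_mono[OF y, of i k] ordered_points_mono[OF y, of "Suc k" j] k ij by auto
  then have uk: "u (t k) \<in> {y i<..y j}" "1 \<le> t k" using t(2) kN unfolding cut_times_def by blast+
  have fs: "first_sep u (y i) (y j) = t k"
  proof (rule first_sep_eqI)
    show "1 \<le> t k" "u (t k) \<in> {y i<..y j}" by (rule uk)+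
    fix m assume m: "1 \<le> m" "m < t k"
    show "u m \<notin> {y i<..y j}"
    proof
      assume "u m \<in> {y i<..y j}"
      then obtain l where l: "i \<le> l" "l < j" "u m \<in> gap y l" using interval_gap[OF ij(1)] by metis
      then have "m < t l" using m k(2)[of l] by auto
      then show False using t(2) l m ij by (auto simp: cut_times_def)
    qed
  qed
  have sep: "separated u (y i) (y j)" unfolding separated_def using uk by blast
  have "earliest_plus t (\<lambda>l. s (t l)) i j \<longleftrightarrow> s (t k) = Plus"
  proof
    assume "earliest_plus t (\<lambda>l. s (t l)) i j"
    then obtain m where m: "m \<in> {i..<j}" "s (t m) = Plus" "t m \<le> t k"
      using k by (auto simp: earliest_plus_def)
    then have "t m = t k" using k(2)[of m] by simp
    then show "s (t k) = Plus" using m by simp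
  qed (use k in \<open>auto simp: earliest_plus_def\<close>)
  moreover have "prec u s (y i) (y j) \<longleftrightarrow> s (t k) = Plus"
    using yij sep fs by (auto simp: prec_def)
  ultimately show ?thesis by simp
qed

lemma prec_pattern_iff_realizes:
  assumes y: "ordered_points (Suc N) y" and t: "t \<in> injective_times N" "cut_times N u y t"
    and \<pi>: "length \<pi> = Suc N"
  shows "prec_pattern u s \<pi> y \<longleftrightarrow> (\<forall>l<N. s (t l) = step_sign \<pi> l) \<and> realizes t (step_sign \<pi>) \<pi>"
proof -
  have "prec_pattern u s \<pi> y \<longleftrightarrow> realizes t (\<lambda>l. s (t l)) \<pi>"
    using prec_iff_earliest_plus[OF y t] \<pi> by (auto simp: prec_pattern_def realizes_def)
  also have "\<dots> \<longleftrightarrow> (\<forall>l<N. s (t l) = step_sign \<pi> l) \<and> realizes t (\<lambda>l. s (t l)) \<pi>"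
    using realizes_step_sign[of t "\<lambda>l. s (t l)" \<pi>] \<pi> by auto
  also have "\<dots> \<longleftrightarrow> (\<forall>l<N. s (t l) = step_sign \<pi> l) \<and> realizes t (step_sign \<pi>) \<pi>"
    using realizes_cong[of \<pi> "\<lambda>l. s (t l)" "step_sign \<pi>" t t] \<pi> by auto
  finally show ?thesis .
qed

text \<open>
  Where the point with index \<open>j\<close> may lie if the gaps are first hit at the times \<open>t\<close>: in the gap hit at time
  \<open>j\<close>, if there is one, and in no gap that is hit later. The conditions for different \<open>j\<close> are independent.
\<close>

definition allowed :: "nat \<Rightarrow> (nat \<Rightarrow> real) \<Rightarrow> (nat \<Rightarrow> nat) \<Rightarrow> nat \<Rightarrow> real set" where
  "allowed N y t j = {v. \<forall>l<N. (t l = j \<longrightarrow> v \<in> gap y l) \<and> (j < t l \<longrightarrow> v \<notin> gap y l)}"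

lemma cut_times_iff_allowed:
  assumes "\<And>l. l < N \<Longrightarrow> 1 \<le> t l \<and> t l \<le> m"
  shows "cut_times N u y t \<longleftrightarrow> (\<forall>j\<in>{1..m}. u j \<in> allowed N y t j)"
  unfolding cut_times_def allowed_def using assms by fastforce

lemma allowed_borel [measurable]: "allowed N y t j \<in> sets borel"
proof -
  have "{v \<in> space borel. \<forall>l<N. (t l = j \<longrightarrow> v \<in> gap y l) \<and> (j < t l \<longrightarrow> v \<notin> gap y l)} \<in> sets borel"
    by measurable
  then show ?thesis by (simp add: allowed_def)
qed

text \<open>
  The probability that a uniform point may be the \<open>j\<close>-th one, in terms of the lengths \<open>L\<close> of the gaps. It
  is symmetric under simultaneous relabeling of lengths and times.
\<close>

definition allowed_mass :: "nat \<Rightarrow> (nat \<Rightarrow> real) \<Rightarrow> (nat \<Rightarrow> nat) \<Rightarrow> nat \<Rightarrow> real" where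
  "allowed_mass N L t j =
     (if j \<in> t ` {..<N} then \<Sum>l | l < N \<and> t l = j. L l else 1 - (\<Sum>l | l < N \<and> j < t l. L l))"

text \<open>
  The sum of the times bounds each of them and does not depend on the labels of the gaps; its successor
  keeps the range of factors nonempty when there are no gaps.
\<close>

definition cut_mass :: "nat \<Rightarrow> (nat \<Rightarrow> real) \<Rightarrow> (nat \<Rightarrow> nat) \<Rightarrow> real" where
  "cut_mass N L t = (\<Prod>j\<in>{1..Suc (\<Sum>l<N. t l)}. allowed_mass N L t j)"

abbreviation gap_length :: "(nat \<Rightarrow> real) \<Rightarrow> nat \<Rightarrow> real" where
  "gap_length y l \<equiv> y (Suc l) - y l"

lemma measure_gap:
  assumes "ordered_points (Suc N) y" "l < N"
  shows "measure Leb (gap y l) = gap_length y l"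
proof -
  have "0 \<le> y l" "y l < y (Suc l)" "y (Suc l) \<le> 1" using assms by (auto simp: ordered_points_def)
  then have "{0..1} \<inter> gap y l = gap y l" by auto
  then show ?thesis using \<open>y l < y (Suc l)\<close> by (simp add: measure_def emeasure_Leb)
qed

lemma measure_allowed:
  assumes y: "ordered_points (Suc N) y" and t: "inj_on t {..<N}"
  shows "measure Leb (allowed N y t j) = allowed_mass N (gap_length y) t j"
proof (cases "j \<in> t ` {..<N}")
  case True
  then obtain k where k: "k < N" "t k = j" by auto
  have uniq: "t l = j \<longleftrightarrow> l = k" if "l < N" for l using k t that by (auto simp: inj_on_def)
  have "v \<notin> gap y l" if "v \<in> gap y k" "l < N" "j < t l" for v l
    using gaps_disjoint[OF y k(1) that(2,1)] that(3) k(2) by blast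
  then have "allowed N y t j = gap y k"
    using uniq k(1) unfolding allowed_def by blast
  moreover have "{l. l < N \<and> t l = j} = {k}" using k t by (auto simp: inj_on_def)
  ultimately show ?thesis using True measure_gap[OF y k(1)] by (simp add: allowed_mass_def)
next
  case False
  let ?K = "{l. l < N \<and> j < t l}"
  have "allowed N y t j = UNIV - (\<Union>l\<in>?K. gap y l)" using False by (auto simp: allowed_def)
  then have "measure Leb (allowed N y t j) = 1 - measure Leb (\<Union>l\<in>?K. gap y l)"
    using Leb.prob_compl[of "\<Union>l\<in>?K. gap y l"] by simp
  also have "measure Leb (\<Union>l\<in>?K. gap y l) = (\<Sum>l\<in>?K. measure Leb (gap y l))"
  proof (rule measure_finite_Union)
    show "disjoint_family_on (gap y) ?K"
      unfolding disjoint_family_on_def using gaps_disjoint[OF y] by blast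
  qed auto
  also have "\<dots> = (\<Sum>l\<in>?K. gap_length y l)" by (rule sum.cong) (auto simp: measure_gap[OF y])
  finally show ?thesis using False by (simp add: allowed_mass_def)
qed

lemma cut_mass_permute:
  assumes \<sigma>: "\<sigma> permutes {..<N}"
  shows "cut_mass N (L \<circ> \<sigma>) (t \<circ> \<sigma>) = cut_mass N L t"
proof -
  have sum: "(\<Sum>l | l < N \<and> P (t (\<sigma> l)). L (\<sigma> l)) = (\<Sum>l | l < N \<and> P (t l). L l)" for P
  proof (rule sum.reindex_bij_betw)
    show "bij_betw \<sigma> {l. l < N \<and> P (t (\<sigma> l))} {l. l < N \<and> P (t l)}"
      unfolding bij_betw_def
    proof
      show "inj_on \<sigma> {l. l < N \<and> P (t (\<sigma> l))}" using permutes_inj_on[OF \<sigma>] .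
      show "\<sigma> ` {l. l < N \<and> P (t (\<sigma> l))} = {l. l < N \<and> P (t l)}"
      proof (intro set_eqI iffI)
        fix l assume l: "l \<in> {l. l < N \<and> P (t l)}"
        then have "l \<in> \<sigma> ` {..<N}" using permutes_image[OF \<sigma>] by simp
        then show "l \<in> \<sigma> ` {l. l < N \<and> P (t (\<sigma> l))}" using l by auto
      next
        fix l assume "l \<in> \<sigma> ` {l. l < N \<and> P (t (\<sigma> l))}"
        then show "l \<in> {l. l < N \<and> P (t l)}" using permutes_in_image[OF \<sigma>] by auto
      qed
    qed
  qed
  have "(t \<circ> \<sigma>) ` {..<N} = t ` {..<N}" by (metis image_comp permutes_image[OF \<sigma>])
  moreover have "(\<Sum>l<N. (t \<circ> \<sigma>) l) = (\<Sum>l<N. t l)"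
    using sum.permute[OF \<sigma>, of t] by simp
  moreover have "allowed_mass N (L \<circ> \<sigma>) (t \<circ> \<sigma>) j = allowed_mass N L t j" for j
    using sum[of "\<lambda>a. a = j"] sum[of "\<lambda>a. j < a"] calculation(1) unfolding allowed_mass_def by simp
  ultimately show ?thesis unfolding cut_mass_def by simp
qed

section \<open>Exchangeability of the gaps\<close>

text \<open>
  With \<open>N\<close> gaps there are \<open>N + 1\<close> points; for injective \<open>t\<close>, \<open>mean_cut_mass N t\<close> is the
  probability that they are ordered and their gaps are first hit at the times \<open>t\<close>.
\<close>

definition ordered_mass :: "nat \<Rightarrow> (nat \<Rightarrow> nat) \<Rightarrow> (nat \<Rightarrow> real) \<Rightarrow> ennreal" where
  "ordered_mass N t y = indicator {y. ordered_points (Suc N) y} y * ennreal (cut_mass N (gap_length y) t)"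

definition mean_cut_mass :: "nat \<Rightarrow> (nat \<Rightarrow> nat) \<Rightarrow> ennreal" where
  "mean_cut_mass N t = (\<integral>\<^sup>+ y. ordered_mass N t y \<partial>PiM {..<Suc N} (\<lambda>_. Leb))"

lemma measurable_ordered_mass: "ordered_mass N t \<in> borel_measurable (PiM {..<Suc N} (\<lambda>_. Leb))"
proof -
  have "(\<lambda>y. cut_mass N (gap_length y) t) \<in> borel_measurable (PiM {..<Suc N} (\<lambda>_. Leb))"
  proof -
    have "(\<lambda>y. allowed_mass N (gap_length y) t j) \<in> borel_measurable (PiM {..<Suc N} (\<lambda>_. Leb))" for j
      unfolding allowed_mass_def
      by (cases "j \<in> t ` {..<N}")
        (auto intro!: borel_measurable_sum borel_measurable_diff measurable_point)
    then show ?thesis unfolding cut_mass_def by (intro borel_measurable_prod)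
  qed
  moreover have "(\<lambda>y. indicator {y. ordered_points (Suc N) y} y :: ennreal)
      \<in> borel_measurable (PiM {..<Suc N} (\<lambda>_. Leb))"
    using measurable_ordered_points[of "Suc N"] by (simp add: indicator_def) measurable
  ultimately show ?thesis unfolding ordered_mass_def by measurable
qed

text \<open>
  Reflecting one point in the interval between its two neighbours swaps two adjacent gaps and
  preserves Lebesgue measure.
\<close>

lemma nn_integral_reflect_point:
  fixes F :: "(nat \<Rightarrow> real) \<Rightarrow> ennreal"
  assumes F[measurable]: "F \<in> borel_measurable (PiM {..<n} (\<lambda>_. Leb))"
    and vanish: "\<And>y. \<not> ordered_points n y \<Longrightarrow> F y = 0" and i: "Suc (Suc i) < n"
  shows "(\<integral>\<^sup>+ y. F (y(Suc i := y i + y (Suc (Suc i)) - y (Suc i))) \<partial>PiM {..<n} (\<lambda>_. Leb)) =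
    (\<integral>\<^sup>+ y. F y \<partial>PiM {..<n} (\<lambda>_. Leb))"
proof -
  let ?J = "{..<n} - {Suc i}"
  have ins: "insert (Suc i) ?J = {..<n}" using i by auto
  let ?r = "\<lambda>y :: nat \<Rightarrow> real. y(Suc i := y i + y (Suc (Suc i)) - y (Suc i))"
  have upd: "(\<lambda>(x, v). x(Suc i := v)) \<in> PiM ?J (\<lambda>_. Leb) \<Otimes>\<^sub>M Leb \<rightarrow>\<^sub>M PiM {..<n} (\<lambda>_. Leb)"
    using measurable_add_dim[of "Suc i" ?J "\<lambda>_. Leb"] ins by simp
  have r: "?r \<in> PiM {..<n} (\<lambda>_. Leb) \<rightarrow>\<^sub>M PiM {..<n} (\<lambda>_. Leb)"
  proof (rule measurable_PiM_single')
    fix k assume k: "k \<in> {..<n}"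
    show "(\<lambda>y. ?r y k) \<in> PiM {..<n} (\<lambda>_. Leb) \<rightarrow>\<^sub>M Leb"
      using k i measurable_point[of _ "{..<n}"] by (cases "k = Suc i") (auto cong: measurable_cong_sets)
  qed (use i in \<open>auto simp: space_PiM PiE_def extensional_def\<close>)
  have inner: "(\<integral>\<^sup>+ v. F (x(Suc i := x i + x (Suc (Suc i)) - v)) \<partial>Leb) = (\<integral>\<^sup>+ v. F (x(Suc i := v)) \<partial>Leb)"
    if x: "x \<in> space (PiM ?J (\<lambda>_. Leb))" for x
  proof -
    let ?c = "x i + x (Suc (Suc i))"
    have g[measurable]: "(\<lambda>v. F (x(Suc i := v))) \<in> borel_measurable borel"
      using measurable_compose[OF measurable_compose[OF measurable_Pair1'[OF x] upd] F]
      by (simp cong: measurable_cong_sets)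
    have btw: "x i < v \<and> v < x (Suc (Suc i)) \<and> 0 \<le> x i \<and> x (Suc (Suc i)) \<le> 1"
      if "F (x(Suc i := v)) \<noteq> 0" for v
    proof -
      have o: "ordered_points n (x(Suc i := v))" using vanish that by blast
      have "(x(Suc i := v)) i < (x(Suc i := v)) (Suc i)" "(x(Suc i := v)) (Suc i) < (x(Suc i := v)) (Suc (Suc i))"
        "(x(Suc i := v)) i \<in> {0..1}" "(x(Suc i := v)) (Suc (Suc i)) \<in> {0..1}"
        using o i unfolding ordered_points_def by (meson lessI less_trans)+
      then show ?thesis by simp
    qed
    have leb: "(\<integral>\<^sup>+ v. f v \<partial>Leb) = (\<integral>\<^sup>+ v. f v \<partial>lborel)"
      if [measurable]: "f \<in> borel_measurable borel" and "\<And>v. f v \<noteq> 0 \<Longrightarrow> v \<in> {0..1}" for f :: "real \<Rightarrow> ennreal"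
    proof -
      have "(\<integral>\<^sup>+ v. f v \<partial>Leb) = (\<integral>\<^sup>+ v. f v * indicator {0..1} v \<partial>lborel)"
        unfolding Leb_def by (subst nn_integral_uniform_measure) (auto simp: divide_ennreal_def)
      also have "\<dots> = (\<integral>\<^sup>+ v. f v \<partial>lborel)"
        using that(2) by (intro nn_integral_cong) (auto simp: indicator_def)
      finally show ?thesis .
    qed
    have "(\<integral>\<^sup>+ v. F (x(Suc i := ?c - v)) \<partial>Leb) = (\<integral>\<^sup>+ v. F (x(Suc i := ?c - v)) \<partial>lborel)"
    proof (rule leb)
      show "(\<lambda>v. F (x(Suc i := ?c - v))) \<in> borel_measurable borel"
        by (rule measurable_compose[OF _ g]) measurable
      show "v \<in> {0..1}" if "F (x(Suc i := ?c - v)) \<noteq> 0" for v using btw[OF that] by auto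
    qed
    also have "\<dots> = (\<integral>\<^sup>+ v. F (x(Suc i := v)) \<partial>lborel)"
      using nn_integral_real_affine[OF g, of "-1" ?c] by simp
    also have "\<dots> = (\<integral>\<^sup>+ v. F (x(Suc i := v)) \<partial>Leb)"
      by (rule leb[OF g, symmetric]) (use btw in fastforce)
    finally show ?thesis .
  qed
  note split = Leb_prod.product_nn_integral_insert[of ?J "Suc i", unfolded ins]
  have "(\<integral>\<^sup>+ y. F (?r y) \<partial>PiM {..<n} (\<lambda>_. Leb)) =
      (\<integral>\<^sup>+ x. \<integral>\<^sup>+ v. F (?r (x(Suc i := v))) \<partial>Leb \<partial>PiM ?J (\<lambda>_. Leb))"
    using measurable_compose[OF r F] by (intro split) auto
  also have "\<dots> = (\<integral>\<^sup>+ x. \<integral>\<^sup>+ v. F (x(Suc i := x i + x (Suc (Suc i)) - v)) \<partial>Leb \<partial>PiM ?J (\<lambda>_. Leb))"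
    by simp
  also have "\<dots> = (\<integral>\<^sup>+ x. \<integral>\<^sup>+ v. F (x(Suc i := v)) \<partial>Leb \<partial>PiM ?J (\<lambda>_. Leb))"
    by (intro nn_integral_cong inner)
  also have "\<dots> = (\<integral>\<^sup>+ y. F y \<partial>PiM {..<n} (\<lambda>_. Leb))"
    using F by (intro split[symmetric]) auto
  finally show ?thesis .
qed

lemma mean_cut_mass_adjacent_swap:
  assumes i: "Suc i < N"
  shows "mean_cut_mass N (t \<circ> Transposition.transpose i (Suc i)) = mean_cut_mass N t"
proof -
  let ?\<sigma> = "Transposition.transpose i (Suc i)"
  let ?r = "\<lambda>y :: nat \<Rightarrow> real. y(Suc i := y i + y (Suc (Suc i)) - y (Suc i))"
  have \<sigma>: "?\<sigma> permutes {..<N}" using i by (intro permutes_swap_id) auto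
  have ord: "ordered_points (Suc N) (?r y) \<longleftrightarrow> ordered_points (Suc N) y" for y
  proof -
    have "ordered_points (Suc N) (?r y)" if y: "ordered_points (Suc N) y" for y
    proof -
      have b: "y i < y (Suc i)" "y (Suc i) < y (Suc (Suc i))" "y i \<in> {0..1}" "y (Suc (Suc i)) \<in> {0..1}"
        using y i by (auto simp: ordered_points_def)
      have "?r y k < ?r y l" if kl: "k < l" "l < Suc N" for k l
      proof -
        have "y k < y l" using y kl by (simp add: ordered_points_def)
        moreover have "y k \<le> y i" if "l = Suc i" using ordered_points_mono[OF y, of k i] that kl i by simp
        moreover have "y (Suc (Suc i)) \<le> y l" if "k = Suc i"
          using ordered_points_mono[OF y, of "Suc (Suc i)" l] that kl by simp
        ultimately show ?thesis using b by auto
      qed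
      moreover have "?r y k \<in> {0..1}" if "k < Suc N" for k
        using y b that by (auto simp: ordered_points_def)
      ultimately show ?thesis by (simp add: ordered_points_def)
    qed
    from this[of y] this[of "?r y"] show ?thesis by auto
  qed
  have gaps: "gap_length (?r y) = gap_length y \<circ> ?\<sigma>" for y
    by (auto simp: fun_eq_iff Transposition.transpose_def)
  have "ordered_mass N (t \<circ> ?\<sigma>) (?r y) = ordered_mass N t y" for y
    unfolding ordered_mass_def gaps cut_mass_permute[OF \<sigma>] using ord[of y] by (simp add: indicator_def)
  then have "mean_cut_mass N t =
      (\<integral>\<^sup>+ y. ordered_mass N (t \<circ> ?\<sigma>) (?r y) \<partial>PiM {..<Suc N} (\<lambda>_. Leb))"
    by (simp add: mean_cut_mass_def)
  also have "\<dots> = mean_cut_mass N (t \<circ> ?\<sigma>)"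
    unfolding mean_cut_mass_def using i
    by (intro nn_integral_reflect_point measurable_ordered_mass) (auto simp: ordered_mass_def)
  finally show ?thesis ..
qed

text \<open>
  Adjacent transpositions generate all permutations; \<open>(a b+1) = (b b+1) (a b) (b b+1)\<close>.
\<close>

lemma mean_cut_mass_permute:
  assumes "\<sigma> permutes {..<N}"
  shows "mean_cut_mass N (t \<circ> \<sigma>) = mean_cut_mass N t"
proof -
  have swap: "mean_cut_mass N (t \<circ> Transposition.transpose a (a + Suc d)) = mean_cut_mass N t"
    if "a + Suc d < N" for a d t
    using that
  proof (induction d arbitrary: t)
    case 0
    then show ?case using mean_cut_mass_adjacent_swap[of a N t] by (simp only: add_Suc_right add_0_right)
  next
    case (Suc d)
    let ?b = "a + Suc d"
    have b: "Suc ?b < N" using Suc.prems by simp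
    have "Transposition.transpose a (Suc ?b) =
        Transposition.transpose ?b (Suc ?b) \<circ> (Transposition.transpose a ?b \<circ> Transposition.transpose ?b (Suc ?b))"
      by (auto simp: fun_eq_iff Transposition.transpose_def)
    then have "t \<circ> Transposition.transpose a (Suc ?b) = ((t \<circ> Transposition.transpose ?b (Suc ?b))
        \<circ> Transposition.transpose a ?b) \<circ> Transposition.transpose ?b (Suc ?b)"
      by (simp only: comp_assoc)
    then have "mean_cut_mass N (t \<circ> Transposition.transpose a (Suc ?b)) =
        mean_cut_mass N ((t \<circ> Transposition.transpose ?b (Suc ?b)) \<circ> Transposition.transpose a ?b)"
      by (simp only: mean_cut_mass_adjacent_swap[OF b])
    also have "\<dots> = mean_cut_mass N (t \<circ> Transposition.transpose ?b (Suc ?b))"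
      using Suc.prems by (intro Suc.IH) simp
    also have "\<dots> = mean_cut_mass N t" by (rule mean_cut_mass_adjacent_swap[OF b])
    finally show ?case by (simp only: add_Suc_right)
  qed
  have swap': "mean_cut_mass N (t \<circ> Transposition.transpose a b) = mean_cut_mass N t"
    if ab: "a < N" "b < N" "a \<noteq> b" for a b t
  proof (cases "a < b")
    case True
    then have "a + Suc (b - a - 1) = b" by simp
    then show ?thesis using swap[of a "b - a - 1" t] ab by metis
  next
    case False
    then have "b + Suc (a - b - 1) = a" using ab by simp
    then show ?thesis using swap[of b "a - b - 1" t] ab by (metis transpose_commute)
  qed
  show ?thesis
    using finite_lessThan assms
  proof (induction rule: permutes_rev_induct)
    case (swap a b \<sigma>)
    then have "mean_cut_mass N ((t \<circ> \<sigma>) \<circ> Transposition.transpose a b) = mean_cut_mass N (t \<circ> \<sigma>)"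
      by (intro swap') auto
    then show ?case using swap by (simp only: comp_assoc)
  qed simp
qed

definition times_in_order :: "nat \<Rightarrow> nat list \<Rightarrow> (nat \<Rightarrow> nat) set" where
  "times_in_order N g =
     {t \<in> injective_times N. \<forall>k<N. \<forall>l<N. t k \<le> t l \<longleftrightarrow> g ! k \<le> g ! l}"

text \<open>
  Relabeling the gaps by the order \<open>g\<close> matches the times in the order \<open>g\<close> with the increasing times, without
  changing their masses. So every cutting order has the same total mass.
\<close>

lemma mean_cut_mass_times_in_order:
  assumes g: "g \<in> permutations_of_set {1..N}"
  shows "(\<integral>\<^sup>+ t. mean_cut_mass N t \<partial>count_space (times_in_order N g)) =
    (\<integral>\<^sup>+ t. mean_cut_mass N t \<partial>count_space (times_in_order N [1..<Suc N]))"
proof -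
  define \<sigma> where "\<sigma> l = (if l \<in> {..<N} then g ! l - 1 else l)" for l
  have "bij_betw (\<lambda>v. v - 1) {1..N} {..<N}"
    by (rule bij_betw_byWitness[where f' = Suc]) auto
  from bij_betw_trans[OF bij_betw_nth_permutation[OF g] this]
  have "bij_betw \<sigma> {..<N} {..<N}"
    by (rule bij_betw_cong[THEN iffD1, rotated]) (simp add: \<sigma>_def)
  then have \<sigma>: "\<sigma> permutes {..<N}" by (rule bij_imp_permutes) (auto simp: \<sigma>_def)
  have g1: "g ! l = Suc (\<sigma> l)" if "l < N" for l
    using bij_betw_apply[OF bij_betw_nth_permutation[OF g], of l] that by (simp add: \<sigma>_def)
  have id: "[1..<Suc N] ! l = Suc l" if "l < N" for l using that by (simp del: upt_Suc)
  have \<sigma>N: "\<sigma> l < N \<longleftrightarrow> l < N" for l using permutes_in_image[OF \<sigma>, of l] by simp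
  have \<sigma>': "inv \<sigma> permutes {..<N}" using permutes_inv[OF \<sigma>] .
  have \<sigma>'N: "inv \<sigma> l < N \<longleftrightarrow> l < N" for l using permutes_in_image[OF \<sigma>', of l] by simp
  have comp: "t \<circ> \<tau> \<in> injective_times N" if "t \<in> injective_times N" "\<tau> permutes {..<N}" for t \<tau>
  proof -
    have "\<tau> l < N \<longleftrightarrow> l < N" for l using permutes_in_image[OF that(2), of l] by simp
    moreover have "inj_on (t \<circ> \<tau>) {..<N}"
      using that permutes_image[OF that(2)] permutes_inj_on[OF that(2)]
      by (intro comp_inj_on) (auto simp: injective_times_def)
    ultimately show ?thesis
      using that by (fastforce simp: injective_times_def PiE_def extensional_def Pi_def)
  qed
  have "bij_betw (\<lambda>t. t \<circ> \<sigma>) (times_in_order N [1..<Suc N]) (times_in_order N g)"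
  proof (rule bij_betw_byWitness[where f' = "\<lambda>t. t \<circ> inv \<sigma>"])
    show "\<forall>t\<in>times_in_order N [1..<Suc N]. t \<circ> \<sigma> \<circ> inv \<sigma> = t"
      using permutes_inv_o(1)[OF \<sigma>] by (simp add: comp_assoc)
    show "\<forall>t\<in>times_in_order N g. t \<circ> inv \<sigma> \<circ> \<sigma> = t"
      using permutes_inv_o(2)[OF \<sigma>] by (simp add: comp_assoc)
    show "(\<lambda>t. t \<circ> \<sigma>) ` times_in_order N [1..<Suc N] \<subseteq> times_in_order N g"
      using comp[OF _ \<sigma>] by (auto simp: times_in_order_def id g1 \<sigma>N simp del: upt_Suc)
    show "(\<lambda>t. t \<circ> inv \<sigma>) ` times_in_order N g \<subseteq> times_in_order N [1..<Suc N]"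
      using comp[OF _ \<sigma>'] by (auto simp: times_in_order_def id g1 \<sigma>'N permutes_inverses[OF \<sigma>] simp del: upt_Suc)
  qed
  from nn_integral_bij_count_space[OF this, of "mean_cut_mass N"] show ?thesis
    by (simp add: mean_cut_mass_permute[OF \<sigma>])
qed

lemma times_in_order_exists:
  assumes t: "t \<in> injective_times N"
  shows "\<exists>g\<in>permutations_of_set {1..N}. t \<in> times_in_order N g"
proof -
  define r where "r l = card {k. k < N \<and> t k \<le> t l}" for l
  define g where "g = map r [0..<N]"
  have inj: "inj_on t {..<N}" using t by (simp add: injective_times_def)
  have le: "r k \<le> r l \<longleftrightarrow> t k \<le> t l" if "k < N" "l < N" for k l
  proof
    assume "t k \<le> t l"
    then show "r k \<le> r l" unfolding r_def by (intro card_mono) auto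
  next
    assume rkl: "r k \<le> r l"
    show "t k \<le> t l"
    proof (rule ccontr)
      assume "\<not> t k \<le> t l"
      then have "{m. m < N \<and> t m \<le> t l} \<subset> {m. m < N \<and> t m \<le> t k}" using that by auto
      then have "r l < r k" unfolding r_def by (intro psubset_card_mono) auto
      then show False using rkl by simp
    qed
  qed
  have injr: "inj_on r {..<N}"
    using le inj by (intro inj_onI) (metis inj_onD lessThan_iff order_antisym order_refl)
  have "r l \<in> {1..N}" if "l < N" for l
  proof -
    have "r l \<le> card {..<N}" unfolding r_def by (intro card_mono) auto
    moreover have "l \<in> {k. k < N \<and> t k \<le> t l}" using that by simp
    then have "r l > 0" unfolding r_def by (auto simp: card_gt_0_iff)
    ultimately show ?thesis by simp
  qed
  then have "r ` {..<N} \<subseteq> {1..N}" by auto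
  moreover have "card (r ` {..<N}) = N" using card_image[OF injr] by simp
  ultimately have "r ` {..<N} = {1..N}" by (intro card_subset_eq) auto
  then have "g \<in> permutations_of_set {1..N}"
    using injr by (simp add: g_def permutations_of_set_def distinct_map lessThan_atLeast0)
  moreover have "t \<in> times_in_order N g" using t le by (simp add: times_in_order_def g_def)
  ultimately show ?thesis by blast
qed

lemma times_in_order_unique:
  assumes "g \<in> permutations_of_set {1..N}" "g' \<in> permutations_of_set {1..N}"
    and "t \<in> times_in_order N g" "t \<in> times_in_order N g'"
  shows "g = g'"
proof (rule permutation_eqI[OF assms(1,2)])
  fix i j assume "i < j" "j < N"
  then have "t j \<le> t i \<longleftrightarrow> g ! j \<le> g ! i" "t j \<le> t i \<longleftrightarrow> g' ! j \<le> g' ! i"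
    using assms(3,4) by (auto simp: times_in_order_def)
  then show "g ! i < g ! j \<longleftrightarrow> g' ! i < g' ! j" by (metis not_le)
qed

lemma mean_cut_mass_orders:
  assumes G: "G \<subseteq> permutations_of_set {1..N}"
  shows "(\<integral>\<^sup>+ t. mean_cut_mass N t \<partial>count_space (\<Union>g\<in>G. times_in_order N g)) =
    card G * (\<integral>\<^sup>+ t. mean_cut_mass N t \<partial>count_space (times_in_order N [1..<Suc N]))"
proof -
  have fin: "finite G" using G by (rule finite_subset) simp
  have disj: "disjoint_family_on (times_in_order N) G"
    using times_in_order_unique G by (fastforce simp: disjoint_family_on_def)
  have "(\<integral>\<^sup>+ t. mean_cut_mass N t \<partial>count_space (\<Union>g\<in>G. times_in_order N g)) =
      (\<integral>\<^sup>+ t. mean_cut_mass N t * indicator (\<Union>g\<in>G. times_in_order N g) t \<partial>count_space UNIV)"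
    by (rule nn_integral_count_space_indicator) simp
  also have "\<dots> = (\<integral>\<^sup>+ t. (\<Sum>g\<in>G. mean_cut_mass N t * indicator (times_in_order N g) t) \<partial>count_space UNIV)"
    by (simp add: indicator_UN_disjoint[OF fin disj] sum_distrib_left)
  also have "\<dots> = (\<Sum>g\<in>G. \<integral>\<^sup>+ t. mean_cut_mass N t * indicator (times_in_order N g) t \<partial>count_space UNIV)"
    by (rule nn_integral_sum) simp
  also have "\<dots> = (\<Sum>g\<in>G. \<integral>\<^sup>+ t. mean_cut_mass N t \<partial>count_space (times_in_order N g))"
    by (intro sum.cong refl nn_integral_count_space_indicator[symmetric]) simp
  also have "\<dots> = (\<Sum>g\<in>G. \<integral>\<^sup>+ t. mean_cut_mass N t \<partial>count_space (times_in_order N [1..<Suc N]))"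
    using G by (intro sum.cong refl mean_cut_mass_times_in_order) auto
  finally show ?thesis by simp
qed

section \<open>The expected density\<close>

lemma ennreal_fact: "ennreal (fact n) = fact n"
  by (metis ennreal_of_nat_eq_real_of_nat of_nat_fact)

locale points_and_signs = prob_space M for M :: "'a measure" +
  fixes U :: "nat \<Rightarrow> 'a \<Rightarrow> real" and S :: "nat \<Rightarrow> 'a \<Rightarrow> sign" and p :: real
  assumes p: "0 < p" "p < 1"
    and indep_U: "indep_vars (\<lambda>_. borel) U {1..}"
    and distr_U: "\<And>j. j \<ge> 1 \<Longrightarrow> distr M borel (U j) = Leb"
    and indep_S: "indep_vars (\<lambda>_. count_space UNIV) S {1..}"
    and prob_S: "\<And>j. j \<ge> 1 \<Longrightarrow> prob {\<omega> \<in> space M. S j \<omega> = Plus} = p"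
    and indep_US: "indep_set
           (sets (vimage_algebra (space M) (\<lambda>\<omega>. \<lambda>j\<in>{1..}. U j \<omega>) (PiM {1..} (\<lambda>_. borel))))
           (sets (vimage_algebra (space M) (\<lambda>\<omega>. \<lambda>j\<in>{1..}. S j \<omega>) (PiM {1..} (\<lambda>_. count_space UNIV))))"
begin

abbreviation "Us \<omega> \<equiv> \<lambda>j. U j \<omega>"
abbreviation "Ss \<omega> \<equiv> \<lambda>j. S j \<omega>"

lemma measurable_U: "j \<ge> 1 \<Longrightarrow> U j \<in> borel_measurable M"
  using indep_U by (simp add: indep_vars_def)

lemma measurable_S: "j \<ge> 1 \<Longrightarrow> S j \<in> M \<rightarrow>\<^sub>M count_space UNIV"
  using indep_S by (simp add: indep_vars_def)

lemma prob_U: "j \<ge> 1 \<Longrightarrow> A \<in> sets borel \<Longrightarrow> prob (U j -` A \<inter> space M) = measure Leb A"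
  using measure_distr[OF measurable_U, of j A] distr_U[of j] by simp

lemma prob_U_all:
  assumes "m \<ge> 1" "\<And>j. j \<in> {1..m} \<Longrightarrow> A j \<in> sets borel"
  shows "prob {\<omega> \<in> space M. \<forall>j\<in>{1..m}. U j \<omega> \<in> A j} = (\<Prod>j\<in>{1..m}. measure Leb (A j))"
proof -
  have "{\<omega> \<in> space M. \<forall>j\<in>{1..m}. U j \<omega> \<in> A j} = (\<Inter>j\<in>{1..m}. U j -` A j \<inter> space M)"
    using assms(1) by auto
  also have "prob \<dots> = (\<Prod>j\<in>{1..m}. prob (U j -` A j \<inter> space M))"
    using assms by (intro indep_varsD[OF indep_U]) auto
  also have "\<dots> = (\<Prod>j\<in>{1..m}. measure Leb (A j))"
    using assms by (intro prod.cong prob_U) auto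
  finally show ?thesis .
qed

text \<open>
  The first \<open>m\<close> points miss the interval with probability \<open>(1 - (b - a))\<^sup>m\<close>, which tends to \<open>0\<close>.
\<close>

lemma AE_hits_interval:
  assumes "0 \<le> a" "a < b" "b \<le> 1"
  shows "AE \<omega> in M. \<exists>j\<ge>1. U j \<omega> \<in> {a<..b}"
proof -
  let ?B = "\<lambda>m. {\<omega> \<in> space M. \<forall>j\<in>{1..Suc m}. U j \<omega> \<in> UNIV - {a<..b}}"
  let ?B' = "{\<omega> \<in> space M. \<forall>j. U (Suc j) \<omega> \<notin> {a<..b}}"
  have [measurable]: "U (Suc j) \<in> borel_measurable M" for j using measurable_U by simp
  have B': "?B' \<in> sets M" by measurable
  have "measure Leb {a<..b} = b - a"
  proof -
    have "{0..1} \<inter> {a<..b} = {a<..b}" using assms by auto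
    then show ?thesis using assms by (simp add: measure_def emeasure_Leb)
  qed
  then have "measure Leb (UNIV - {a<..b}) = 1 - (b - a)"
    using Leb.prob_compl[of "{a<..b}"] by simp
  then have B: "prob (?B m) = (1 - (b - a)) ^ Suc m" for m
    using prob_U_all[of "Suc m" "\<lambda>_. UNIV - {a<..b}"] by simp
  have "prob ?B' \<le> (1 - (b - a)) ^ Suc m" for m
  proof -
    have "?B m \<in> sets M" 
    proof -
      have "{\<omega> \<in> space M. \<forall>j\<in>{..m}. U (Suc j) \<omega> \<in> UNIV - {a<..b}} \<in> sets M" by measurable
      also have "{\<omega> \<in> space M. \<forall>j\<in>{..m}. U (Suc j) \<omega> \<in> UNIV - {a<..b}} = ?B m"
        by (auto simp: Suc_le_eq gr0_conv_Suc)
      finally show ?thesis .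
    qed
    moreover have "?B' \<subseteq> ?B m" by (auto simp: Suc_le_eq gr0_conv_Suc)
    ultimately have "prob ?B' \<le> prob (?B m)" by (intro finite_measure_mono)
    then show ?thesis unfolding B .
  qed
  moreover have "(\<lambda>m. (1 - (b - a)) ^ Suc m) \<longlonglongrightarrow> 0"
    using assms by (intro LIMSEQ_Suc LIMSEQ_power_zero) auto
  ultimately have "prob ?B' \<le> 0" by (intro LIMSEQ_le_const) auto
  then have "?B' \<in> null_sets M"
    using B' by (auto simp: null_sets_def emeasure_eq_measure measure_le_0_iff)
  from AE_not_in[OF this] show ?thesis
    using AE_space by eventually_elim (auto intro: exI[of _ "Suc _"])
qed

lemma AE_separates_points: "AE \<omega> in M. separates_points (Us \<omega>)"
proof -
  have "AE \<omega> in M. \<forall>q\<in>{(a :: rat, b). 0 \<le> a \<and> a < b \<and> b \<le> 1}.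
      \<exists>j\<ge>1. U j \<omega> \<in> {real_of_rat (fst q)<..real_of_rat (snd q)}"
    by (intro AE_ball_countable' AE_hits_interval) (auto simp: of_rat_less)
  then show ?thesis
  proof eventually_elim
    fix \<omega> assume hit: "\<forall>q\<in>{(a :: rat, b). 0 \<le> a \<and> a < b \<and> b \<le> 1}.
      \<exists>j\<ge>1. U j \<omega> \<in> {real_of_rat (fst q)<..real_of_rat (snd q)}"
    show "separates_points (Us \<omega>)"
      unfolding separates_points_def
    proof (intro allI impI)
      fix x y :: real assume xy: "0 \<le> x" "x < y" "y \<le> 1"
      obtain a where a: "x < real_of_rat a" "real_of_rat a < y" using of_rat_dense[OF xy(2)] by blast
      obtain b where b: "real_of_rat a < real_of_rat b" "real_of_rat b < y" using of_rat_dense[OF a(2)] by blast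
      have "0 < real_of_rat a" "real_of_rat b < 1" using xy a b by linarith+
      then have "(a, b) \<in> {(a :: rat, b). 0 \<le> a \<and> a < b \<and> b \<le> 1}"
        using b by (simp add: of_rat_less)
      from hit[rule_format, OF this] obtain j where "j \<ge> 1" "U j \<omega> \<in> {real_of_rat a<..real_of_rat b}" by auto
      then show "separated (Us \<omega>) x y" using a b unfolding separated_def by force
    qed
  qed
qed

lemma injective_times_ge_1: "t \<in> injective_times N \<Longrightarrow> l < N \<Longrightarrow> 1 \<le> t l"
  by (auto simp: injective_times_def PiE_def Pi_def)

lemma prob_cut_times:
  assumes t: "t \<in> injective_times N" and y: "ordered_points (Suc N) y"
  shows "prob {\<omega> \<in> space M. cut_times N (Us \<omega>) y t} = cut_mass N (gap_length y) t"
proof -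
  let ?m = "Suc (\<Sum>l<N. t l)"
  have "1 \<le> t l \<and> t l \<le> ?m" if "l < N" for l
    using injective_times_ge_1[OF t that] member_le_sum[of l "{..<N}" t] that by auto
  then have "{\<omega> \<in> space M. cut_times N (Us \<omega>) y t} =
      {\<omega> \<in> space M. \<forall>j\<in>{1..?m}. U j \<omega> \<in> allowed N y t j}"
    using cut_times_iff_allowed[of N t ?m] by auto
  then show ?thesis
    using prob_U_all[of ?m "allowed N y t"] t
    by (simp add: cut_mass_def measure_allowed[OF y] injective_times_def)
qed

lemma prob_sign: "j \<ge> 1 \<Longrightarrow> prob (S j -` {a} \<inter> space M) = sign_weight p a"
proof -
  assume j: "j \<ge> 1"
  have P: "S j -` {Plus} \<inter> space M = {\<omega> \<in> space M. S j \<omega> = Plus}" by auto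
  have "s = Minus \<longleftrightarrow> s \<noteq> Plus" for s by (cases s) auto
  then have "S j -` {Minus} \<inter> space M = space M - (S j -` {Plus} \<inter> space M)" by auto
  moreover have "S j -` {Plus} \<inter> space M \<in> events"
    using measurable_sets[OF measurable_S[OF j], of "{Plus}"] by simp
  ultimately have "prob (S j -` {Minus} \<inter> space M) = 1 - prob (S j -` {Plus} \<inter> space M)"
    using prob_compl by simp
  then show ?thesis using prob_S[OF j] P by (cases a) (simp_all add: sign_weight_def)
qed

lemma prob_signs:
  assumes t: "t \<in> injective_times N"
  shows "prob {\<omega> \<in> space M. \<forall>l<N. S (t l) \<omega> = a l} = (\<Prod>l<N. sign_weight p (a l))"
proof (cases "N = 0")
  case True
  then show ?thesis by (simp add: prob_space)
next
  case False
  have inj: "inj_on t {..<N}" using t by (simp add: injective_times_def)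
  define b where "b j = a (the_inv_into {..<N} t j)" for j
  have b: "b (t l) = a l" if "l < N" for l
    using the_inv_into_f_f[OF inj, of l] that by (simp add: b_def)
  have "{\<omega> \<in> space M. \<forall>l<N. S (t l) \<omega> = a l} = (\<Inter>j\<in>t ` {..<N}. S j -` {b j} \<inter> space M)"
    using False b by auto
  also have "prob \<dots> = (\<Prod>j\<in>t ` {..<N}. prob (S j -` {b j} \<inter> space M))"
    using False injective_times_ge_1[OF t] by (intro indep_varsD[OF indep_S]) auto
  also have "\<dots> = (\<Prod>l<N. prob (S (t l) -` {b (t l)} \<inter> space M))"
    by (rule prod.reindex_cong[OF inj]) auto
  also have "\<dots> = (\<Prod>l<N. sign_weight p (a l))"
    using injective_times_ge_1[OF t] by (intro prod.cong) (auto simp: prob_sign b)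
  finally show ?thesis .
qed

text \<open>
  The times are a function of the points and the signs at fixed indices are a function of the sign sequence;
  both events are pulled back from the product spaces to apply the independence of the two sequences.
\<close>

lemma prob_cut_times_signs:
  assumes t: "t \<in> injective_times N" and y: "ordered_points (Suc N) y"
  shows "prob {\<omega> \<in> space M. cut_times N (Us \<omega>) y t \<and> (\<forall>l<N. S (t l) \<omega> = a l)} =
    cut_mass N (gap_length y) t * (\<Prod>l<N. sign_weight p (a l))"
proof -
  let ?X = "{\<omega> \<in> space M. cut_times N (Us \<omega>) y t}" and ?Y = "{\<omega> \<in> space M. \<forall>l<N. S (t l) \<omega> = a l}"
  let ?PU = "PiM {1..} (\<lambda>_. borel) :: (nat \<Rightarrow> real) measure"
  let ?PS = "PiM {1..} (\<lambda>_. count_space UNIV) :: (nat \<Rightarrow> sign) measure"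
  let ?fU = "\<lambda>\<omega>. \<lambda>j\<in>{1..}. U j \<omega>" and ?fS = "\<lambda>\<omega>. \<lambda>j\<in>{1..}. S j \<omega>"

  have tge: "1 \<le> t l" if "l < N" for l using injective_times_ge_1[OF t that] .
  have mU: "{f \<in> space ?PU. cut_times N f y t} \<in> sets ?PU"
  proof -
    have hit: "Measurable.pred ?PU (\<lambda>f. f j \<in> gap y l)" if "1 \<le> j" for j l
    proof -
      have [measurable]: "(\<lambda>f. f j) \<in> ?PU \<rightarrow>\<^sub>M borel"
        using that by (auto intro!: measurable_component_singleton)
      show ?thesis by measurable
    qed
    have [measurable]: "Measurable.pred ?PU (\<lambda>f. 1 \<le> j \<longrightarrow> j < t l \<longrightarrow> f j \<notin> gap y l)" for j l
    proof (cases "1 \<le> j")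
      case True
      note hit[OF this, measurable]
      show ?thesis by measurable
    qed simp
    have "Measurable.pred ?PU (\<lambda>f. l < N \<longrightarrow> 1 \<le> t l \<and> f (t l) \<in> gap y l \<and> (\<forall>j. 1 \<le> j \<longrightarrow> j < t l \<longrightarrow> f j \<notin> gap y l))" for l
    proof (cases "l < N")
      case True
      note hit[OF tge[OF True], measurable]
      show ?thesis by measurable
    qed simp
    then have "Measurable.pred ?PU (\<lambda>f. cut_times N f y t)"
      unfolding cut_times_def by (rule pred_intros_countable)
    then show ?thesis by (rule predE)
  qed
  have mS: "{f \<in> space ?PS. \<forall>l<N. f (t l) = a l} \<in> sets ?PS"
  proof -
    have "Measurable.pred ?PS (\<lambda>f. l < N \<longrightarrow> f (t l) = a l)" for l
    proof (cases "l < N")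
      case True
      then have [measurable]: "(\<lambda>f. f (t l)) \<in> ?PS \<rightarrow>\<^sub>M count_space UNIV"
        using tge by (auto intro!: measurable_component_singleton)
      show ?thesis by measurable
    qed simp
    then have "Measurable.pred ?PS (\<lambda>f. \<forall>l<N. f (t l) = a l)"
      by (rule pred_intros_countable)
    then show ?thesis by (rule predE)
  qed
  have "cut_times N (?fU \<omega>) y t \<longleftrightarrow> cut_times N (Us \<omega>) y t" for \<omega>
    by (rule cut_times_cong) simp
  moreover have "?fU \<omega> \<in> space ?PU" "?fS \<omega> \<in> space ?PS" for \<omega>
    by (simp_all add: space_PiM)
  ultimately have eqX: "?X = ?fU -` {f \<in> space ?PU. cut_times N f y t} \<inter> space M"
    by blast
  have X: "?X \<in> sets (vimage_algebra (space M) ?fU ?PU)"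
    by (subst eqX) (rule in_vimage_algebra[OF mU])
  have eqY: "?Y = ?fS -` {f \<in> space ?PS. \<forall>l<N. f (t l) = a l} \<inter> space M"
    using tge \<open>\<And>\<omega>. ?fS \<omega> \<in> space ?PS\<close> by auto
  have Y: "?Y \<in> sets (vimage_algebra (space M) ?fS ?PS)"
    by (subst eqY) (rule in_vimage_algebra[OF mS])
  have "{\<omega> \<in> space M. cut_times N (Us \<omega>) y t \<and> (\<forall>l<N. S (t l) \<omega> = a l)} = ?X \<inter> ?Y" by auto
  then show ?thesis
    using indep_setD[OF indep_US X Y] prob_cut_times[OF t y] prob_signs[OF t, of a] by simp
qed

lemma measurable_cut_times:
  assumes t: "t \<in> injective_times N"
  shows "Measurable.pred M (\<lambda>\<omega>. cut_times N (Us \<omega>) y t)"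
    and "Measurable.pred M (\<lambda>\<omega>. \<forall>l<N. S (t l) \<omega> = a l)"
proof -
  have [measurable]: "U (Suc j) \<in> borel_measurable M" "S (Suc j) \<in> M \<rightarrow>\<^sub>M count_space UNIV" for j
    using measurable_U measurable_S by auto
  define t' where "t' l = t l - 1" for l
  have t': "t l = Suc (t' l)" if "l < N" for l using injective_times_ge_1[OF t that] by (simp add: t'_def)
  have "cut_times N (Us \<omega>) y t \<longleftrightarrow>
      (\<forall>l<N. U (Suc (t' l)) \<omega> \<in> gap y l \<and> (\<forall>j<t' l. U (Suc j) \<omega> \<notin> gap y l))" for \<omega>
    unfolding cut_times_def by (auto simp: t' Suc_le_eq gr0_conv_Suc)
  then show "Measurable.pred M (\<lambda>\<omega>. cut_times N (Us \<omega>) y t)"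
    unfolding greaterThanAtMost_iff by simp measurable
  have "(\<forall>l<N. S (t l) \<omega> = a l) \<longleftrightarrow> (\<forall>l<N. S (Suc (t' l)) \<omega> = a l)" for \<omega> using t' by auto
  then show "Measurable.pred M (\<lambda>\<omega>. \<forall>l<N. S (t l) \<omega> = a l)" by simp measurable
qed

text \<open>
  The pattern is \<open>\<pi>\<close> if and only if the order of the hitting times is compatible with \<open>\<pi>\<close> and the signs at
  these times are the ones that \<open>\<pi>\<close> forces. Whatever the times are, these signs are independent of them, so
  they contribute the same factor for all times.
\<close>

lemma emeasure_prec_pattern:
  assumes \<pi>: "length \<pi> = Suc N" and y: "ordered_points (Suc N) y"
  shows "emeasure M {\<omega> \<in> space M. prec_pattern (Us \<omega>) (Ss \<omega>) \<pi> y} =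
    ennreal (\<Prod>l<N. sign_weight p (step_sign \<pi> l)) *
      (\<integral>\<^sup>+ t. ennreal (cut_mass N (gap_length y) t)
         \<partial>count_space {t \<in> injective_times N. realizes t (step_sign \<pi>) \<pi>})"
proof -
  let ?T = "{t \<in> injective_times N. realizes t (step_sign \<pi>) \<pi>}"
  let ?c = "\<Prod>l<N. sign_weight p (step_sign \<pi> l)"
  let ?X = "\<lambda>t. {\<omega> \<in> space M. cut_times N (Us \<omega>) y t \<and> (\<forall>l<N. S (t l) \<omega> = step_sign \<pi> l)}"
  have X: "?X t \<in> sets M" if "t \<in> injective_times N" for t
    using measurable_cut_times[OF that] by measurable
  have c: "?c \<ge> 0" using p by (intro prod_nonneg) (auto simp: sign_weight_def split: sign.split)
  have pos: "cut_mass N (gap_length y) t \<ge> 0" if "t \<in> injective_times N" for t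
    by (subst prob_cut_times[OF that y, symmetric]) (rule measure_nonneg)
  have "emeasure M {\<omega> \<in> space M. prec_pattern (Us \<omega>) (Ss \<omega>) \<pi> y} = emeasure M (\<Union>t\<in>?T. ?X t)"
  proof (rule emeasure_eq_AE)
    show "AE \<omega> in M. \<omega> \<in> {\<omega> \<in> space M. prec_pattern (Us \<omega>) (Ss \<omega>) \<pi> y} \<longleftrightarrow> \<omega> \<in> (\<Union>t\<in>?T. ?X t)"
      using AE_separates_points
    proof eventually_elim
      fix \<omega> assume sep: "separates_points (Us \<omega>)"
      obtain t where t: "t \<in> injective_times N" "cut_times N (Us \<omega>) y t"
        using cut_times_exists[OF sep y] by blast
      have "prec_pattern (Us \<omega>) (Ss \<omega>) \<pi> y \<longleftrightarrow> (\<exists>t\<in>?T. cut_times N (Us \<omega>) y t \<and> (\<forall>l<N. S (t l) \<omega> = step_sign \<pi> l))"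
      proof -
        have "t' = t" if "t' \<in> injective_times N" "cut_times N (Us \<omega>) y t'" for t'
          by (rule cut_times_unique[OF that(1) t(1) that(2) t(2)])
        then show ?thesis using prec_pattern_iff_realizes[OF y t \<pi>, of "Ss \<omega>"] t by blast
      qed
      then show "\<omega> \<in> {\<omega> \<in> space M. prec_pattern (Us \<omega>) (Ss \<omega>) \<pi> y} \<longleftrightarrow> \<omega> \<in> (\<Union>t\<in>?T. ?X t)" by auto
    qed
    have "Measurable.pred M (\<lambda>\<omega>. i < j \<longrightarrow> j < length \<pi> \<longrightarrow> (\<pi> ! i < \<pi> ! j \<longleftrightarrow> prec (Us \<omega>) (Ss \<omega>) (y i) (y j)))" for i j
      using prec_measurable[where M = M and h = "\<lambda>\<omega>. \<omega>" and N = M and f = "\<lambda>_. y i" and g = "\<lambda>_. y j",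
          OF measurable_U measurable_S] by simp
    then show "{\<omega> \<in> space M. prec_pattern (Us \<omega>) (Ss \<omega>) \<pi> y} \<in> sets M"
      unfolding prec_pattern_def by measurable
    show "(\<Union>t\<in>?T. ?X t) \<in> sets M"
      using X by (intro sets.countable_UN'' countable_subset[OF _ countable_injective_times]) auto
  qed
  also have "\<dots> = (\<integral>\<^sup>+ t. emeasure M (?X t) \<partial>count_space ?T)"
  proof (rule emeasure_UN_countable)
    show "countable ?T" by (rule countable_subset[OF _ countable_injective_times]) auto
    show "disjoint_family_on ?X ?T"
      unfolding disjoint_family_on_def using cut_times_unique by blast
  qed (use X in auto)
  also have "\<dots> = (\<integral>\<^sup>+ t. ennreal ?c * ennreal (cut_mass N (gap_length y) t) \<partial>count_space ?T)"
    using prob_cut_times_signs[OF _ y, of _ "step_sign \<pi>"] c pos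
    by (intro nn_integral_cong) (auto simp: emeasure_eq_measure mult.commute ennreal_mult)
  also have "\<dots> = ennreal ?c * (\<integral>\<^sup>+ t. ennreal (cut_mass N (gap_length y) t) \<partial>count_space ?T)"
    by (rule nn_integral_cmult) simp
  finally show ?thesis .
qed

text \<open>
  Almost surely every gap is hit, so the probabilities of the possible times add up to \<open>1\<close>.
\<close>

lemma nn_integral_cut_mass:
  assumes y: "ordered_points (Suc N) y"
  shows "(\<integral>\<^sup>+ t. ennreal (cut_mass N (gap_length y) t) \<partial>count_space (injective_times N)) = 1"
proof -
  let ?X = "\<lambda>t. {\<omega> \<in> space M. cut_times N (Us \<omega>) y t}"
  have X: "?X t \<in> sets M" if "t \<in> injective_times N" for t
    using measurable_cut_times[OF that] by measurable
  have "(\<integral>\<^sup>+ t. ennreal (cut_mass N (gap_length y) t) \<partial>count_space (injective_times N)) =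
      (\<integral>\<^sup>+ t. emeasure M (?X t) \<partial>count_space (injective_times N))"
    using prob_cut_times[OF _ y] by (intro nn_integral_cong) (auto simp: emeasure_eq_measure)
  also have "\<dots> = emeasure M (\<Union>t\<in>injective_times N. ?X t)"
  proof (rule emeasure_UN_countable[symmetric])
    show "disjoint_family_on ?X (injective_times N)"
      unfolding disjoint_family_on_def using cut_times_unique by blast
  qed (use X countable_injective_times in auto)
  also have "\<dots> = 1"
  proof (rule emeasure_eq_1_AE)
    show "(\<Union>t\<in>injective_times N. ?X t) \<in> events"
      using X by (intro sets.countable_UN'' countable_injective_times) auto
    show "AE \<omega> in M. \<omega> \<in> (\<Union>t\<in>injective_times N. ?X t)"
      using AE_separates_points AE_space by eventually_elim (use cut_times_exists[OF _ y] in fastforce)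
  qed
  finally show ?thesis .
qed



text \<open>The \<open>N!\<close> orders of the gaps share equally the mass \<open>1/(N + 1)!\<close> of the ordered points.\<close>

lemma common_order_mass:
  "fact (Suc N) * fact N * (\<integral>\<^sup>+ t. mean_cut_mass N t \<partial>count_space (times_in_order N [1..<Suc N])) = 1"
proof -
  let ?P = "PiM {..<Suc N} (\<lambda>_. Leb)"
  have "injective_times N = (\<Union>g\<in>permutations_of_set {1..N}. times_in_order N g)"
    using times_in_order_exists by (auto simp: times_in_order_def)
  then have "fact N * (\<integral>\<^sup>+ t. mean_cut_mass N t \<partial>count_space (times_in_order N [1..<Suc N])) =
      (\<integral>\<^sup>+ t. mean_cut_mass N t \<partial>count_space (injective_times N))"
    using mean_cut_mass_orders[OF order_refl, of N] by simp
  also have "\<dots> = (\<integral>\<^sup>+ y. \<integral>\<^sup>+ t. ordered_mass N t y \<partial>count_space (injective_times N) \<partial>?P)"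
    unfolding mean_cut_mass_def
    by (intro nn_integral_count_space_nn_integral[symmetric] countable_injective_times measurable_ordered_mass)
  also have "\<dots> = (\<integral>\<^sup>+ y. indicator {y \<in> space ?P. ordered_points (Suc N) y} y \<partial>?P)"
    by (intro nn_integral_cong)
      (auto simp: ordered_mass_def nn_integral_cut_mass indicator_def)
  also have "\<dots> = emeasure ?P {y \<in> space ?P. ordered_points (Suc N) y}"
    using measurable_ordered_points[of "Suc N"] by (intro nn_integral_indicator) simp
  also have "\<dots> = ennreal (measure ?P {y \<in> space ?P. ordered_points (Suc N) y})"
    by (rule Leb_prod.P.emeasure_eq_measure)
  finally have eq: "fact N * (\<integral>\<^sup>+ t. mean_cut_mass N t \<partial>count_space (times_in_order N [1..<Suc N])) =
      ennreal (measure ?P {y \<in> space ?P. ordered_points (Suc N) y})" .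
  have "ennreal (fact (Suc N) * measure ?P {y \<in> space ?P. ordered_points (Suc N) y}) = 1"
    unfolding measure_ordered_points[of "Suc N"] by simp
  then show ?thesis
    unfolding mult.assoc eq by (simp add: ennreal_mult ennreal_fact del: fact_Suc)
qed

text \<open>
  By Fubini the points are fixed first and the randomness of the permuton is integrated out by
  \<open>emeasure_prec_pattern\<close>; then the mass of the times that realize \<open>\<pi>\<close> is split according to the order of
  the gaps.
\<close>

lemma integral_dens:
  assumes \<pi>: "\<pi> \<in> permutations_of_set {1..Suc N}"
  defines "D \<equiv> \<lambda>\<omega>. dens \<pi> (rec_sep_permuton (Us \<omega>) (Ss \<omega>))"
  shows "integrable M D"
    and "expectation D = real (card (cut_orders \<pi>)) / fact N * (\<Prod>l<N. sign_weight p (step_sign \<pi> l))"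
proof -
  let ?n = "Suc N" and ?P = "PiM {..<Suc N} (\<lambda>_. Leb)" and ?Q = "PiM {1..Suc N} (\<lambda>_. Leb)"
  let ?c = "\<Prod>l<N. sign_weight p (step_sign \<pi> l)"
  let ?T = "{t \<in> injective_times N. realizes t (step_sign \<pi>) \<pi>}"
  let ?Z = "\<integral>\<^sup>+ t. mean_cut_mass N t \<partial>count_space (times_in_order N [1..<Suc N])"
  have len: "length \<pi> = Suc N" using length_permutations_of_set_upto[OF \<pi>] .
  have c: "?c \<ge> 0" using p by (intro prod_nonneg) (auto simp: sign_weight_def split: sign.split)
  have D01: "0 \<le> D \<omega>" "D \<omega> \<le> 1" for \<omega>
    unfolding D_def dens_rec_sep_permuton_eq by auto
  have D: "D \<in> borel_measurable M"
  proof -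
    let ?E = "{z \<in> space (M \<Otimes>\<^sub>M ?Q). is_sample ?n (\<lambda>i. (snd z i, rec_phi (Us (fst z)) (Ss (fst z)) (snd z i))) \<pi>}"
    have pt: "(\<lambda>z. snd z i) \<in> borel_measurable (M \<Otimes>\<^sub>M ?Q)" if "i \<in> {1..?n}" for i
      using measurable_compose[OF measurable_snd measurable_point[OF that]] .
    have "Measurable.pred (M \<Otimes>\<^sub>M ?Q)
        (\<lambda>z. is_sample ?n (\<lambda>i. (snd z i, rec_phi (Us (fst z)) (Ss (fst z)) (snd z i))) \<pi>)"
      by (intro is_sample_measurable pt
          rec_phi_measurable[where h = fst and M = M and U = U and S = S, OF measurable_U measurable_S])
        simp_all
    then have "?E \<in> sets (M \<Otimes>\<^sub>M ?Q)" by simp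
    from Leb_prod.P.measurable_emeasure_Pair[OF this]
    have "(\<lambda>\<omega>. enn2real (emeasure ?Q (Pair \<omega> -` ?E))) \<in> borel_measurable M" by measurable
    moreover have "D \<omega> = enn2real (emeasure ?Q (Pair \<omega> -` ?E))" if "\<omega> \<in> space M" for \<omega>
      using that unfolding D_def dens_rec_sep_permuton_eq measure_def len
      by (simp add: space_pair_measure vimage_def)
    ultimately show ?thesis by (simp cong: measurable_cong)
  qed
  show "integrable M D"
    using D D01 by (intro integrable_const_bound[where B = 1]) auto
  interpret MP: pair_sigma_finite M ?P ..
  have [measurable]: "Measurable.pred (M \<Otimes>\<^sub>M ?P) (\<lambda>z. prec_pattern (Us (fst z)) (Ss (fst z)) \<pi> (snd z))"
  proof -
    have "Measurable.pred (M \<Otimes>\<^sub>M ?P) (\<lambda>z. i < j \<longrightarrow> j < ?n \<longrightarrow>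
        (\<pi> ! i < \<pi> ! j \<longleftrightarrow> prec (Us (fst z)) (Ss (fst z)) (snd z i) (snd z j)))" for i j
    proof (cases "i < j \<and> j < ?n")
      case True
      have pt: "(\<lambda>z. snd z k) \<in> borel_measurable (M \<Otimes>\<^sub>M ?P)" if "k < ?n" for k
        using that by (intro measurable_compose[OF measurable_snd measurable_point]) auto
      have [measurable]: "Measurable.pred (M \<Otimes>\<^sub>M ?P) (\<lambda>z. prec (Us (fst z)) (Ss (fst z)) (snd z i) (snd z j))"
        using True by (intro prec_measurable[where h = fst and M = M and U = U and S = S, OF measurable_U measurable_S] pt) auto
      show ?thesis by measurable
    qed auto
    then show ?thesis unfolding prec_pattern_def len by measurable
  qed
  note measurable_ordered_points[measurable]
  define E where "E = {z \<in> space (M \<Otimes>\<^sub>M ?P). ordered_points ?n (snd z) \<and> prec_pattern (Us (fst z)) (Ss (fst z)) \<pi> (snd z)}"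
  have E: "E \<in> sets (M \<Otimes>\<^sub>M ?P)"
    unfolding E_def by measurable
  have T: "?T = (\<Union>g\<in>cut_orders \<pi>. times_in_order N g)"
  proof -
    have real: "realizes t (step_sign \<pi>) \<pi> \<longleftrightarrow> realizes ((!) g) (step_sign \<pi>) \<pi>"
      if "t \<in> times_in_order N g" for t g
      using that len by (intro realizes_cong) (auto simp: times_in_order_def)
    have cut: "g \<in> cut_orders \<pi> \<longleftrightarrow> g \<in> permutations_of_set {1..N} \<and> realizes ((!) g) (step_sign \<pi>) \<pi>" for g
      by (simp add: cut_orders_def len)
    show ?thesis
    proof (intro set_eqI iffI)
      fix t assume t: "t \<in> ?T"
      then obtain g where "g \<in> permutations_of_set {1..N}" "t \<in> times_in_order N g"
        using times_in_order_exists by blast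
      then show "t \<in> (\<Union>g\<in>cut_orders \<pi>. times_in_order N g)" using t real cut by blast
    next
      fix t assume "t \<in> (\<Union>g\<in>cut_orders \<pi>. times_in_order N g)"
      then obtain g where "g \<in> cut_orders \<pi>" "t \<in> times_in_order N g" by blast
      then show "t \<in> ?T" using real cut by (auto simp: times_in_order_def)
    qed
  qed
  have "(\<integral>\<^sup>+ \<omega>. ennreal (D \<omega>) \<partial>M) = (\<integral>\<^sup>+ \<omega>. fact ?n * emeasure ?P (Pair \<omega> -` E) \<partial>M)"
  proof (rule nn_integral_cong_AE)
    show "AE \<omega> in M. ennreal (D \<omega>) = fact ?n * emeasure ?P (Pair \<omega> -` E)"
      using AE_separates_points AE_space
    proof eventually_elim
      fix \<omega> assume "separates_points (Us \<omega>)" and \<omega>: "\<omega> \<in> space M"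
      then have "D \<omega> = fact ?n * measure ?P {y \<in> space ?P. ordered_points ?n y \<and> prec_pattern (Us \<omega>) (Ss \<omega>) \<pi> y}"
        unfolding D_def by (intro dens_eq_prec_pattern \<pi>)
      also have "{y \<in> space ?P. ordered_points ?n y \<and> prec_pattern (Us \<omega>) (Ss \<omega>) \<pi> y} = Pair \<omega> -` E"
        using \<omega> by (auto simp: E_def space_pair_measure)
      finally show "ennreal (D \<omega>) = fact ?n * emeasure ?P (Pair \<omega> -` E)"
        by (simp add: Leb_prod.P.emeasure_eq_measure ennreal_mult ennreal_fact del: fact_Suc)
    qed
  qed
  also have "\<dots> = fact ?n * (\<integral>\<^sup>+ \<omega>. emeasure ?P (Pair \<omega> -` E) \<partial>M)"
    using Leb_prod.P.measurable_emeasure_Pair[OF E] by (rule nn_integral_cmult)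
  also have "(\<integral>\<^sup>+ \<omega>. emeasure ?P (Pair \<omega> -` E) \<partial>M) = emeasure (M \<Otimes>\<^sub>M ?P) E"
    by (rule Leb_prod.P.emeasure_pair_measure_alt[OF E, symmetric])
  also have "\<dots> = (\<integral>\<^sup>+ y. emeasure M ((\<lambda>\<omega>. (\<omega>, y)) -` E) \<partial>?P)"
    by (rule MP.emeasure_pair_measure_alt2[OF E])
  also have "\<dots> = (\<integral>\<^sup>+ y. ennreal ?c * (\<integral>\<^sup>+ t. ordered_mass N t y \<partial>count_space ?T) \<partial>?P)"
  proof (rule nn_integral_cong)
    fix y assume y: "y \<in> space ?P"
    show "emeasure M ((\<lambda>\<omega>. (\<omega>, y)) -` E) = ennreal ?c * (\<integral>\<^sup>+ t. ordered_mass N t y \<partial>count_space ?T)"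
    proof (cases "ordered_points ?n y")
      case True
      then have "(\<lambda>\<omega>. (\<omega>, y)) -` E = {\<omega> \<in> space M. prec_pattern (Us \<omega>) (Ss \<omega>) \<pi> y}"
        using y by (auto simp: E_def space_pair_measure)
      then show ?thesis using True emeasure_prec_pattern[OF len True] by (simp add: ordered_mass_def)
    next
      case False
      then have "(\<lambda>\<omega>. (\<omega>, y)) -` E = {}" by (auto simp: E_def)
      then show ?thesis using False by (simp add: ordered_mass_def)
    qed
  qed
  also have "\<dots> = (\<integral>\<^sup>+ y. \<integral>\<^sup>+ t. ennreal ?c * ordered_mass N t y \<partial>count_space ?T \<partial>?P)"
    by (intro nn_integral_cong nn_integral_cmult[symmetric]) simp
  also have "\<dots> = (\<integral>\<^sup>+ t. \<integral>\<^sup>+ y. ennreal ?c * ordered_mass N t y \<partial>?P \<partial>count_space ?T)"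
  proof (rule nn_integral_count_space_nn_integral)
    show "countable ?T" by (rule countable_subset[OF _ countable_injective_times]) auto
    show "(\<lambda>y. ennreal ?c * ordered_mass N t y) \<in> borel_measurable ?P" for t
      using measurable_ordered_mass[of N t] by measurable
  qed
  also have "\<dots> = (\<integral>\<^sup>+ t. ennreal ?c * mean_cut_mass N t \<partial>count_space ?T)"
    unfolding mean_cut_mass_def by (intro nn_integral_cong nn_integral_cmult measurable_ordered_mass)
  also have "\<dots> = ennreal ?c * (\<integral>\<^sup>+ t. mean_cut_mass N t \<partial>count_space ?T)"
    by (rule nn_integral_cmult) simp
  also have "(\<integral>\<^sup>+ t. mean_cut_mass N t \<partial>count_space ?T) = card (cut_orders \<pi>) * ?Z"
    unfolding T by (rule mean_cut_mass_orders) (auto simp: cut_orders_def len)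
  finally have int: "(\<integral>\<^sup>+ \<omega>. ennreal (D \<omega>) \<partial>M) = fact ?n * (ennreal ?c * (card (cut_orders \<pi>) * ?Z))" .
  have "fact N * (\<integral>\<^sup>+ \<omega>. ennreal (D \<omega>) \<partial>M) = ennreal ?c * card (cut_orders \<pi>) * (fact ?n * fact N * ?Z)"
    unfolding int by (simp only: mult_ac)
  also have "\<dots> = ennreal (?c * card (cut_orders \<pi>))"
    unfolding common_order_mass using c by (simp add: ennreal_mult ennreal_of_nat_eq_real_of_nat)
  finally have "ennreal (fact N * expectation D) = ennreal (?c * card (cut_orders \<pi>))"
    using nn_integral_eq_integral[OF \<open>integrable M D\<close>] D01
    by (simp add: ennreal_mult ennreal_fact integral_nonneg_AE)
  then have "fact N * expectation D = ?c * card (cut_orders \<pi>)"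
    using c D01 by (subst (asm) ennreal_inj) (auto intro!: integral_nonneg_AE mult_nonneg_nonneg)
  then show "expectation D = real (card (cut_orders \<pi>)) / fact N * ?c"
    by (simp add: field_simps)
qed

end

theorem proposition1p7:
  fixes M :: "'a measure"
    and U :: "nat \<Rightarrow> 'a \<Rightarrow> real"
    and S :: "nat \<Rightarrow> 'a \<Rightarrow> sign"
    and p :: real and n :: nat and \<pi> :: "nat list"
  assumes "prob_space M"
    and "0 < p" "p < 1"
    and "prob_space.indep_vars M (\<lambda>_. borel) U {1..}"
    and "\<And>j. j \<ge> 1 \<Longrightarrow> distr M borel (U j) = Leb"
    and "prob_space.indep_vars M (\<lambda>_. count_space UNIV) S {1..}"
    and "\<And>j. j \<ge> 1 \<Longrightarrow> measure M {\<omega> \<in> space M. S j \<omega> = Plus} = p"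
    and "prob_space.indep_set M
           (sets (vimage_algebra (space M) (\<lambda>\<omega>. \<lambda>j\<in>{1..}. U j \<omega>) (PiM {1..} (\<lambda>_. borel))))
           (sets (vimage_algebra (space M) (\<lambda>\<omega>. \<lambda>j\<in>{1..}. S j \<omega>) (PiM {1..} (\<lambda>_. count_space UNIV))))"
    and "n \<ge> 1"
    and "\<pi> \<in> permutations_of_set {1..n}"
  shows "integrable M (\<lambda>\<omega>. dens \<pi> (rec_sep_permuton (\<lambda>j. U j \<omega>) (\<lambda>j. S j \<omega>)))
       \<and> prob_space.expectation M (\<lambda>\<omega>. dens \<pi> (rec_sep_permuton (\<lambda>j. U j \<omega>) (\<lambda>j. S j \<omega>)))
           = measure_pmf.prob (rec_sep_perm p n) {\<pi>}
       \<and> measure_pmf.prob (rec_sep_perm p n) {\<pi>}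
           = real (N_inc \<pi>) / fact (n - 1) * (1 - p) ^ des \<pi> * p ^ (n - 1 - des \<pi>)"
proof -
  interpret points_and_signs M U S p
    using assms(1-8) by (simp add: points_and_signs_def points_and_signs_axioms_def)
  have \<pi>: "\<pi> \<in> permutations_of_set {1..Suc (n - 1)}" using assms(9,10) by simp
  have law: "measure_pmf.prob (rec_sep_perm p n) {\<pi>} =
      real (card (cut_orders \<pi>)) / fact (n - 1) * ((1 - p) ^ des \<pi> * p ^ (n - 1 - des \<pi>))"
    using assms(2,3,9,10) by (intro prob_rec_sep_perm) auto
  then show ?thesis
    using integral_dens[OF \<pi>] prod_sign_weight_step_sign[OF assms(10), of p]
      N_inc_eq_card_cut_orders[OF assms(10,9)]
    by simp
qed

end
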